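(* Let $u_0\ge0$ be a local minimum of $\mathscr{F}(u)=\int_\Omega\{\tfrac12\langle a_{ij}(X)\nabla u,\nabla u\rangle+\chi_{\{u>0\}}\}dX$ with $u_0\in L^\infty(\Omega)$, and assume $u_0(\xi)=0$ for some $\xi\in\Omega$. Then there exists $C>0$ depending only on $n$, $\lambda$, $\Lambda$, $\mathrm{dist}(\xi,\partial\Omega)$ and $\|u_0\|_{L^\infty(\Omega)}$ such that $$u_0(X)\le C|X-\xi|\quad\text{for all }X\in\Omega.$$
   Context: $\Omega\subset\mathbb{R}^n$ is a bounded Lipschitz domain, $a_{ij}$ a measurable symmetric matrix field with $\lambda\,\mathrm{Id}\le a_{ij}\le\Lambda\,\mathrm{Id}$ a.e. (no continuity assumed). A local minimum of $\mathscr{G}(u)=\int_\Omega G(X,u,\nabla u)dX$ is $u\in H^1(\Omega)$ such that for every ball $B\Subset\Omega$ and every $v$ with $v-u\in H^1_0(B)$, $\int_B G(X,u,\nabla u)\le\int_B G(X,v,\nabla v)$. Minima are taken continuous (they are Hölder continuous). *)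

theory Defs
  imports "HOL-Analysis.Analysis"
begin

definition partial_deriv :: "'n::finite \<Rightarrow> (real^'n \<Rightarrow> real) \<Rightarrow> real^'n \<Rightarrow> real" where
  "partial_deriv i f x = frechet_derivative f (at x) (axis i 1)"

definition classical_grad :: "(real^'n::finite \<Rightarrow> real) \<Rightarrow> real^'n \<Rightarrow> real^'n" where
  "classical_grad f x = (\<chi> i. partial_deriv i f x)"

fun Ck_on :: "nat \<Rightarrow> (real^'n::finite) set \<Rightarrow> (real^'n \<Rightarrow> real) \<Rightarrow> bool" where
  "Ck_on 0 S f = continuous_on S f"
| "Ck_on (Suc k) S f = ((\<forall>x\<in>S. f differentiable (at x)) \<and> continuous_on S f \<and>
                         (\<forall>i. Ck_on k S (partial_deriv i f)))"

definition smooth_on :: "(real^'n::finite) set \<Rightarrow> (real^'n \<Rightarrow> real) \<Rightarrow> bool" where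
  "smooth_on S f \<longleftrightarrow> (\<forall>k. Ck_on k S f)"

definition test_fun :: "(real^'n::finite) set \<Rightarrow> (real^'n \<Rightarrow> real) \<Rightarrow> bool" where
  "test_fun S \<phi> \<longleftrightarrow> smooth_on UNIV \<phi> \<and> compact (closure {x. \<phi> x \<noteq> 0}) \<and>
                     closure {x. \<phi> x \<noteq> 0} \<subseteq> S"

definition L2_on :: "(real^'n::finite) set \<Rightarrow> (real^'n \<Rightarrow> real) \<Rightarrow> bool" where
  "L2_on S u \<longleftrightarrow> u \<in> borel_measurable (lebesgue_on S) \<and> integrable (lebesgue_on S) (\<lambda>x. (u x)\<^sup>2)"

definition L2vec_on :: "(real^'n::finite) set \<Rightarrow> (real^'n \<Rightarrow> real^'n) \<Rightarrow> bool" where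
  "L2vec_on S g \<longleftrightarrow> g \<in> borel_measurable (lebesgue_on S) \<and> integrable (lebesgue_on S) (\<lambda>x. (norm (g x))\<^sup>2)"

definition has_weak_gradient :: "(real^'n::finite) set \<Rightarrow> (real^'n \<Rightarrow> real) \<Rightarrow> (real^'n \<Rightarrow> real^'n) \<Rightarrow> bool" where
  "has_weak_gradient S u g \<longleftrightarrow>
     (\<forall>K. compact K \<and> K \<subseteq> S \<longrightarrow> integrable (lebesgue_on K) u \<and> (\<forall>i. integrable (lebesgue_on K) (\<lambda>x. g x $ i))) \<and>
     (\<forall>\<phi>. test_fun S \<phi> \<longrightarrow> (\<forall>i.
        (\<integral>x. u x * partial_deriv i \<phi> x \<partial>lebesgue_on S) = - (\<integral>x. g x $ i * \<phi> x \<partial>lebesgue_on S)))"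

definition H1_on :: "(real^'n::finite) set \<Rightarrow> (real^'n \<Rightarrow> real) \<Rightarrow> bool" where
  "H1_on S u \<longleftrightarrow> L2_on S u \<and> (\<exists>g. has_weak_gradient S u g \<and> L2vec_on S g)"

definition H10_on :: "(real^'n::finite) set \<Rightarrow> (real^'n \<Rightarrow> real) \<Rightarrow> bool" where
  "H10_on S w \<longleftrightarrow> L2_on S w \<and> (\<exists>g. has_weak_gradient S w g \<and> L2vec_on S g \<and>
     (\<exists>\<phi> :: nat \<Rightarrow> real^'n \<Rightarrow> real. (\<forall>k. test_fun S (\<phi> k)) \<and>
        (\<lambda>k. \<integral>x. (\<phi> k x - w x)\<^sup>2 \<partial>lebesgue_on S) \<longlonglongrightarrow> 0 \<and>
        (\<lambda>k. \<integral>x. (norm (classical_grad (\<phi> k) x - g x))\<^sup>2 \<partial>lebesgue_on S) \<longlonglongrightarrow> 0))"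

text \<open>F restricted to S: integral over S of (1/2)<A grad u, grad u> + indicator{u>0};
  the integrand is nonnegative, so we use the nonnegative integral.\<close>
definition energy :: "(real^'n::finite \<Rightarrow> real^'n^'n) \<Rightarrow> (real^'n) set \<Rightarrow> (real^'n \<Rightarrow> real)
                       \<Rightarrow> (real^'n \<Rightarrow> real^'n) \<Rightarrow> ennreal" where
  "energy A S u g = (\<integral>\<^sup>+ X. ennreal ((1/2) * ((A X *v g X) \<bullet> g X) + indicator {Y. u Y > 0} X) \<partial>lebesgue_on S)"

definition local_min :: "(real^'n::finite \<Rightarrow> real^'n^'n) \<Rightarrow> (real^'n) set \<Rightarrow> (real^'n \<Rightarrow> real) \<Rightarrow> bool" where
  "local_min A \<Omega> u \<longleftrightarrow> H1_on \<Omega> u \<and>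
     (\<forall>c r. 0 < r \<and> cball c r \<subseteq> \<Omega> \<longrightarrow>
        (\<forall>v. H10_on (ball c r) (\<lambda>X. v X - u X) \<longrightarrow>
          (\<forall>gu gv. has_weak_gradient \<Omega> u gu \<longrightarrow> has_weak_gradient (ball c r) v gv \<longrightarrow>
             energy A (ball c r) u gu \<le> energy A (ball c r) v gv)))"

definition lipschitz_domain :: "(real^'n::finite) set \<Rightarrow> bool" where
  "lipschitz_domain \<Omega> \<longleftrightarrow> open \<Omega> \<and> connected \<Omega> \<and> bounded \<Omega> \<and> \<Omega> \<noteq> {} \<and>
     (\<forall>p\<in>frontier \<Omega>. \<exists>r>0. \<exists>e f L. norm e = 1 \<and> lipschitz_on L {y. y \<bullet> e = 0} f \<and>
        \<Omega> \<inter> ball p r = {x \<in> ball p r. f (x - (x \<bullet> e) *\<^sub>R e) < x \<bullet> e})"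

definition elliptic_coeffs :: "real \<Rightarrow> real \<Rightarrow> (real^'n::finite) set \<Rightarrow> (real^'n \<Rightarrow> real^'n^'n) \<Rightarrow> bool" where
  "elliptic_coeffs lam Lam \<Omega> A \<longleftrightarrow>
     (\<forall>i j. (\<lambda>X. A X $ i $ j) \<in> borel_measurable (lebesgue_on \<Omega>)) \<and>
     (AE X in lebesgue_on \<Omega>. transpose (A X) = A X \<and>
        (\<forall>z. lam * (norm z)\<^sup>2 \<le> z \<bullet> (A X *v z) \<and> z \<bullet> (A X *v z) \<le> Lam * (norm z)\<^sup>2))"

end

theory Submission
  imports Defs "HOL-Computational_Algebra.Polynomial"
begin

text \<open>De Giorgi's method for minimizers of the functional, without compactness. Let
  \<open>u \<ge> 0\<close> be a minimizer with \<open>u \<xi> = 0\<close> and suppose \<open>u \<le> 4 S R\<close> on the ball of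
  radius \<open>4 R\<close>. At levels above \<open>R\<close> the measure term is a lower order perturbation, so
  truncations of \<open>u\<close> from either side satisfy a Caccioppoli inequality and the De Giorgi lemma
  applies to \<open>u\<close> both from above and from below. From below, \<open>u \<xi> = 0\<close> forces every
  sublevel set \<open>{u < k}\<close> to have density at least a constant near \<open>\<xi>\<close>. If
  \<open>{u > S R / 4}\<close> were not of small density as well, then all the strips between geometrically decreasing
  levels would carry a fixed volume, which is impossible once \<open>S\<close> is large. Hence
  \<open>{u > S R / 4}\<close> has small density, and the lemma from above gives \<open>u \<le> S R / 2\<close> on the
  ball of radius \<open>R / 2\<close>. Iterating over the radii \<open>R / 8\<^sup>j\<close> yields the linear bound.\<close>

section \<open>Smooth mollifiers\<close>

text \<open>The characteristic function makes the functional non-differentiable, so no Euler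
  equation holds across the free boundary and only comparison of energies is left. The competitors
  subtract a cube of a truncation \<open>m\<close>; the price is a Caccioppoli inequality that
  controls \<open>|g|^2\<close> only with the weight \<open>m^2\<close>. The weight does no harm in
  either place where the inequality is used. For \<open>V = \<zeta>^2 m^4\<close> the gradient
  contains \<open>\<zeta>^2 m^3 g\<close>, which Young's inequality splits into \<open>m^4\<close>
  and the weighted energy. Below a level \<open>k\<close> the weight is removed by truncating at
  \<open>2 k\<close>, where \<open>m \<ge> k\<close>. The Sobolev inequality and the isoperimetric
  inequality between levels are both replaced by one fact: the \<open>L^1\<close> size of a
  translation difference is at most the length of the shift times the \<open>L^1\<close> norm of the
  gradient.\<close>

definition flat_exp :: "real poly \<Rightarrow> real \<Rightarrow> real" where
  "flat_exp p t = (if t \<le> 0 then 0 else poly p (1 / t) * exp (- 1 / t))"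

lemma poly_times_exp_minus_tendsto_0: "((\<lambda>s::real. poly p s * exp (- s)) \<longlongrightarrow> 0) at_top"
proof -
  have "((\<lambda>s::real. \<Sum>i\<le>degree p. coeff p i * (s ^ i / exp s)) \<longlongrightarrow> (\<Sum>i\<le>degree p. coeff p i * 0)) at_top"
    by (intro tendsto_sum tendsto_mult tendsto_const tendsto_power_div_exp_0)
  moreover have "poly p s * exp (- s) = (\<Sum>i\<le>degree p. coeff p i * (s ^ i / exp s))" for s
    by (simp add: poly_altdef sum_distrib_right exp_minus divide_inverse mult.assoc)
  ultimately show ?thesis by simp
qed

lemma flat_exp_tendsto_0: "(flat_exp p \<longlongrightarrow> 0) (at 0)"
proof (rule filterlim_split_at)
  show "(flat_exp p \<longlongrightarrow> 0) (at_left 0)"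
    by (rule tendsto_eventually) (auto simp: flat_exp_def eventually_at_filter)
  have "((\<lambda>t. poly p (inverse t) * exp (- inverse t)) \<longlongrightarrow> 0) (at_right 0)"
    using filterlim_compose[OF poly_times_exp_minus_tendsto_0 filterlim_inverse_at_top_right] .
  then show "(flat_exp p \<longlongrightarrow> 0) (at_right 0)"
    by (rule Lim_transform_eventually)
       (auto simp: flat_exp_def eventually_at_filter divide_inverse)
qed

text \<open>The family is closed under differentiation: with \<open>s = 1/t\<close>, the derivative
  of \<open>p(s) exp(-s)\<close> in \<open>t\<close> is \<open>s^2 (p(s) - p'(s)) exp(-s)\<close>.
  Keeping the polynomial general turns smoothness of \<open>exp(-1/t)\<close> into an induction on
  the order.\<close>

lemma flat_exp_deriv:
  "(flat_exp p has_real_derivative flat_exp (monom 1 2 * (p - pderiv p)) t) (at t)"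
proof -
  consider "t > 0" | "t < 0" | "t = 0" by linarith
  then show ?thesis
  proof cases
    case 1
    have "((\<lambda>t. poly p (1 / t) * exp (- 1 / t)) has_real_derivative
        flat_exp (monom 1 2 * (p - pderiv p)) t) (at t)"
      using 1 by (auto intro!: derivative_eq_intros poly_DERIV[THEN DERIV_chain2]
          simp: flat_exp_def poly_monom field_simps power2_eq_square)
    then show ?thesis
      by (rule DERIV_cong_ev[THEN iffD1, rotated -1])
         (use 1 in \<open>auto simp: flat_exp_def intro: eventually_mono[OF eventually_nhds_in_open[of "{0<..}"]]\<close>)
  next
    case 2
    have "((\<lambda>_. 0) has_real_derivative flat_exp (monom 1 2 * (p - pderiv p)) t) (at t)"
      using 2 by (auto simp: flat_exp_def)
    then show ?thesis
      by (rule DERIV_cong_ev[THEN iffD1, rotated -1])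
         (use 2 in \<open>auto simp: flat_exp_def intro: eventually_mono[OF eventually_nhds_in_open[of "{..<0}"]]\<close>)
  next
    case 3
    \<comment> \<open>Dividing by \<open>h\<close> multiplies the polynomial by its variable
      \<open>1/h\<close>, so the difference quotient at \<open>0\<close> is again a member of the
      family and tends to \<open>0\<close>. At \<open>h = 0\<close> both sides are \<open>0\<close>
      because division by zero yields \<open>0\<close>.\<close>
    have "(\<lambda>h. (flat_exp p (0 + h) - flat_exp p 0) / h) = flat_exp (pCons 0 p)"
      by (auto simp: flat_exp_def fun_eq_iff)
    then show ?thesis
      using flat_exp_tendsto_0[of "pCons 0 p"] 3
      by (simp add: DERIV_def) (simp add: flat_exp_def)
  qed
qed

section \<open>Calculus of \<open>k\<close> times continuously differentiable functions\<close>

lemma partial_deriv_eqI: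
  assumes "(f has_derivative f') (at x)"
  shows "partial_deriv i f x = f' (axis i 1)"
  using frechet_derivative_at[OF assms] by (simp add: partial_deriv_def)

lemma Ck_on_const: "Ck_on k UNIV (\<lambda>x. c)"
proof (induction k arbitrary: c)
  case (Suc k)
  have "partial_deriv i (\<lambda>x. c) = (\<lambda>x. 0)" for i :: 'a
    by (rule ext, subst partial_deriv_eqI[OF has_derivative_const]) simp
  with Suc show ?case by simp
qed simp

lemma Ck_on_Suc_imp: "Ck_on (Suc k) S f \<Longrightarrow> Ck_on k S f"
  by (induction k arbitrary: f) auto

lemma has_derivative_partial:
  "f differentiable (at x) \<Longrightarrow> (f has_derivative (\<lambda>h. classical_grad f x \<bullet> h)) (at x)"
  for f :: "real^'n \<Rightarrow> real"
proof -
  assume d: "f differentiable (at x)"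
  let ?D = "frechet_derivative f (at x)"
  have D: "(f has_derivative ?D) (at x)"
    using d frechet_derivative_works by blast
  have lin: "linear ?D" using has_derivative_linear[OF D] .
  have "?D h = classical_grad f x \<bullet> h" for h
  proof -
    have "?D h = ?D (\<Sum>i\<in>UNIV. h $ i *\<^sub>R axis i 1)"
      using basis_expansion[of h] by (simp add: scalar_mult_eq_scaleR)
    also have "\<dots> = (\<Sum>i\<in>UNIV. h $ i * ?D (axis i 1))"
      by (simp add: linear_sum[OF lin] linear_cmul[OF lin])
    also have "\<dots> = classical_grad f x \<bullet> h"
      by (simp add: inner_vec_def classical_grad_def partial_deriv_def mult.commute)
    finally show ?thesis .
  qed
  then have "?D = (\<lambda>h. classical_grad f x \<bullet> h)" by auto
  then show ?thesis using D by simp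
qed

lemma Ck_on_add:
  "Ck_on k UNIV f \<Longrightarrow> Ck_on k UNIV g \<Longrightarrow> Ck_on k UNIV (\<lambda>x. f x + g x)"
proof (induction k arbitrary: f g)
  case 0 then show ?case by (auto intro: continuous_intros)
next
  case (Suc k)
  have "partial_deriv i (\<lambda>x. f x + g x) = (\<lambda>x. partial_deriv i f x + partial_deriv i g x)" for i
  proof
    fix x
    have "f differentiable (at x)" "g differentiable (at x)" using Suc by auto
    then show "partial_deriv i (\<lambda>x. f x + g x) x = partial_deriv i f x + partial_deriv i g x"
      by (subst partial_deriv_eqI[OF has_derivative_add])
         (auto simp: partial_deriv_def dest!: frechet_derivative_works[THEN iffD1])
  qed
  with Suc show ?case by (auto intro!: continuous_intros derivative_intros)
qed

lemma Ck_on_mult: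
  "Ck_on k UNIV f \<Longrightarrow> Ck_on k UNIV g \<Longrightarrow> Ck_on k UNIV (\<lambda>x. f x * g x)"
proof (induction k arbitrary: f g)
  case 0 then show ?case by (auto intro: continuous_intros)
next
  case (Suc k)
  have "partial_deriv i (\<lambda>x. f x * g x) = (\<lambda>x. f x * partial_deriv i g x + partial_deriv i f x * g x)" for i
  proof
    fix x
    have "f differentiable (at x)" "g differentiable (at x)" using Suc by auto
    then show "partial_deriv i (\<lambda>x. f x * g x) x = f x * partial_deriv i g x + partial_deriv i f x * g x"
      by (subst partial_deriv_eqI[OF has_derivative_mult])
         (auto simp: partial_deriv_def dest!: frechet_derivative_works[THEN iffD1])
  qed
  moreover have "Ck_on k UNIV f" "Ck_on k UNIV g" using Suc Ck_on_Suc_imp by blast+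
  ultimately show ?case using Suc by (auto intro!: continuous_intros derivative_intros Ck_on_add)
qed

lemma Ck_on_prod:
  "finite I \<Longrightarrow> (\<And>i. i \<in> I \<Longrightarrow> Ck_on k UNIV (f i)) \<Longrightarrow> Ck_on k UNIV (\<lambda>x. \<Prod>i\<in>I. f i x)"
  by (induction I rule: finite_induct) (auto intro: Ck_on_const Ck_on_mult)

text \<open>The polynomial is arbitrary in the induction because each derivative changes it. The
  coefficient \<open>d\<close> admits both signs, as the two-sided bump below requires.\<close>

lemma Ck_on_flat_exp: "Ck_on k UNIV (\<lambda>x::real^'n. flat_exp p (c + d * x $ i))"
proof (induction k arbitrary: p)
  case 0
  have "continuous_on UNIV (flat_exp p)"
    using flat_exp_deriv DERIV_continuous_on by blast
  then show ?case by (auto intro!: continuous_intros elim!: continuous_on_compose2)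
next
  case (Suc k)
  let ?q = "monom 1 2 * (p - pderiv p)"
  have D: "((\<lambda>x::real^'n. flat_exp p (c + d * x $ i)) has_derivative
      (\<lambda>h. flat_exp ?q (c + d * x $ i) * (d * h $ i))) (at x)" for x
  proof -
    have "((\<lambda>x::real^'n. c + d * x $ i) has_derivative (\<lambda>h. d * h $ i)) (at x)"
      using has_derivative_add[OF has_derivative_const
        has_derivative_mult_right[OF bounded_linear_imp_has_derivative[OF bounded_linear_vec_nth]]]
      by simp
    from has_derivative_compose[OF this flat_exp_deriv[of p, THEN DERIV_D, unfolded DERIV_def[symmetric] has_field_derivative_def]]
    show ?thesis by simp
  qed
  have "partial_deriv j (\<lambda>x::real^'n. flat_exp p (c + d * x $ i)) =
      (\<lambda>x. flat_exp ?q (c + d * x $ i) * (d * axis j 1 $ i))" for j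
    by (rule ext, rule partial_deriv_eqI[OF D])
  then have "Ck_on k UNIV (partial_deriv j (\<lambda>x::real^'n. flat_exp p (c + d * x $ i)))" for j
    using Ck_on_mult[OF Suc.IH Ck_on_const] by simp
  moreover have "(\<lambda>x::real^'n. flat_exp p (c + d * x $ i)) differentiable (at x)" for x
    using D differentiableI by blast
  ultimately show ?case
    by (auto intro!: differentiable_imp_continuous_on simp: differentiable_on_def
      intro: differentiable_at_imp_differentiable_on)
qed

text \<open>The bump is a product over coordinates rather than a radial function, so its smoothness
  follows from the one-variable case and the product rule. It lives on the cube where every
  \<open>|x $ i| < d\<close>.\<close>

lemma mollifier_exists:
  assumes "0 < e"
  shows "\<exists>\<rho>::real^'n \<Rightarrow> real. smooth_on UNIV \<rho> \<and> (\<forall>x. 0 \<le> \<rho> x) \<and> (\<forall>x. e \<le> norm x \<longrightarrow> \<rho> x = 0)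
     \<and> integrable lborel \<rho> \<and> (\<integral>x. \<rho> x \<partial>lborel) = 1"
proof -
  \<comment> \<open>The norm is at most the sum of the \<open>CARD('n)\<close> coordinates in
    absolute value, so a cube of half-width \<open>e / CARD('n)\<close> lies in the ball of radius
    \<open>e\<close>.\<close>
  define d where "d = e / real CARD('n)"
  have d: "0 < d" using assms by (simp add: d_def)
  define r where "r = (\<lambda>x::real^'n. \<Prod>i\<in>UNIV. flat_exp 1 (d + 1 * x $ i) * flat_exp 1 (d + (-1) * x $ i))"
  have smooth: "Ck_on k UNIV r" for k
    unfolding r_def by (intro Ck_on_prod Ck_on_mult Ck_on_flat_exp) auto
  have nonneg: "0 \<le> r x" for x
    unfolding r_def by (intro prod_nonneg) (auto simp: flat_exp_def)
  have supp: "r x = 0" if "e \<le> norm x" for x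
  proof (rule ccontr)
    assume "r x \<noteq> 0"
    then have "flat_exp 1 (d + x $ i) \<noteq> 0 \<and> flat_exp 1 (d - x $ i) \<noteq> 0" for i
      by (auto simp: r_def)
    then have "0 < d + x $ i \<and> 0 < d - x $ i" for i
      unfolding flat_exp_def by (metis not_le)
    then have "\<bar>x $ i\<bar> < d" for i
      by (simp add: abs_less_iff) (smt (verit))
    then have "(\<Sum>i\<in>UNIV. \<bar>x $ i\<bar>) < (\<Sum>i\<in>(UNIV::'n set). d)"
      by (intro sum_strict_mono) auto
    then have "norm x < e"
      using norm_le_l1_cart[of x] by (simp add: d_def)
    with that show False by simp
  qed
  have r0: "r 0 > 0" unfolding r_def using d by (intro prod_pos) (auto simp: flat_exp_def)
  have cont: "continuous_on UNIV r" using smooth[of 0] by simp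
  have int: "integrable lborel r"
  proof -
    have "integrable lborel (\<lambda>x. indicator (cball 0 e) x *\<^sub>R r x)"
      by (rule borel_integrable_compact) (auto intro: continuous_on_subset[OF cont])
    moreover have "indicator (cball 0 e) x *\<^sub>R r x = r x" for x
      using supp[of x] by (auto simp: indicator_def)
    ultimately show ?thesis by (simp only:)
  qed
  \<comment> \<open>A vanishing integral makes \<open>r\<close> zero almost everywhere, while
    \<open>{x. r x \<noteq> 0}\<close> is open and contains \<open>0\<close>, hence is not
    negligible.\<close>
  have "(\<integral>x. r x \<partial>lborel) \<noteq> 0"
  proof
    assume "(\<integral>x. r x \<partial>lborel) = 0"
    then have "AE x in lborel. r x = 0"
      using integral_nonneg_eq_0_iff_AE[OF int] nonneg by simp
    then have "AE x in lebesgue. r x = 0" by (rule AE_completion)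
    then have "negligible {x. r x \<noteq> 0}"
      by (simp add: AE_iff_null_sets negligible_iff_null_sets eventually_ae_filter)
        (metis (mono_tags, lifting) completion.complete2 mem_Collect_eq subsetI)
    moreover have "open {x. r x \<noteq> 0}"
      by (intro open_Collect_neq cont continuous_on_const)
    ultimately show False using open_not_negligible r0 by fastforce
  qed
  moreover have "(\<integral>x. r x \<partial>lborel) \<ge> 0" using nonneg by simp
  ultimately have I: "(\<integral>x. r x \<partial>lborel) > 0" by simp
  define c where "c = 1 / (\<integral>x. r x \<partial>lborel)"
  have "smooth_on UNIV (\<lambda>x. c * r x)"
    unfolding smooth_on_def by (auto intro: Ck_on_mult Ck_on_const smooth)
  moreover have "\<forall>x. 0 \<le> c * r x" using nonneg I by (simp add: c_def)
  ultimately show ?thesis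
    using supp int I by (intro exI[of _ "\<lambda>x. c * r x"]) (auto simp: c_def)
qed

section \<open>Convolution with a smooth kernel\<close>

lemma nn_integral_translate:
  fixes f :: "'a::euclidean_space \<Rightarrow> ennreal"
  assumes "f \<in> borel_measurable borel"
  shows "(\<integral>\<^sup>+x. f (x + c) \<partial>lborel) = (\<integral>\<^sup>+x. f x \<partial>lborel)"
proof -
  have "(\<integral>\<^sup>+x. f x \<partial>lborel) = (\<integral>\<^sup>+x. f x \<partial>distr lborel borel ((+) c))"
    by (simp add: lborel_distr_plus)
  also have "\<dots> = (\<integral>\<^sup>+x. f (x + c) \<partial>lborel)"
    using assms by (subst nn_integral_distr) (auto simp: add.commute)
  finally show ?thesis ..
qed

lemma integral_translate:
  fixes f :: "'a::euclidean_space \<Rightarrow> real"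
  assumes "f \<in> borel_measurable borel"
  shows "(\<integral>x. f (x + c) \<partial>lborel) = (\<integral>x. f x \<partial>lborel)"
proof -
  have "(\<integral>x. f x \<partial>lborel) = (\<integral>x. f x \<partial>distr lborel borel ((+) c))"
    by (simp add: lborel_distr_plus)
  also have "\<dots> = (\<integral>x. f (x + c) \<partial>lborel)"
    using assms by (subst integral_distr) (auto simp: add.commute)
  finally show ?thesis ..
qed

section \<open>Uniform estimates for functions of bounded support\<close>

lemma integrable_cont_bounded_support:
  fixes f :: "'a::euclidean_space \<Rightarrow> 'b::euclidean_space"
  assumes "continuous_on UNIV f" and supp: "\<And>x. r < norm x \<Longrightarrow> f x = 0"
  shows "integrable lborel f"
proof -
  have "integrable lborel (\<lambda>x. indicator (cball 0 r) x *\<^sub>R f x)"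
    by (rule borel_integrable_compact) (auto intro: continuous_on_subset[OF assms(1)])
  moreover have "indicator (cball 0 r) x *\<^sub>R f x = f x" for x
    using supp[of x] by (auto simp: indicator_def not_le)
  ultimately show ?thesis by (simp only:)
qed

lemma bounded_cont_bounded_support:
  fixes f :: "'a::euclidean_space \<Rightarrow> 'b::euclidean_space"
  assumes "continuous_on UNIV f" and supp: "\<And>x. r < norm x \<Longrightarrow> f x = 0"
  obtains B where "0 < B" "\<And>x. norm (f x) \<le> B"
proof -
  have "bounded (f ` cball 0 r)"
    by (intro compact_imp_bounded compact_continuous_image) (auto intro: continuous_on_subset[OF assms(1)])
  then obtain B where "0 < B" "\<forall>y \<in> f ` cball 0 r. norm y \<le> B" using bounded_pos by blast
  then show ?thesis using supp by (intro that[of B]) (fastforce simp: not_le[symmetric])+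
qed

lemma uniform_cont_bounded_support:
  fixes f :: "'a::euclidean_space \<Rightarrow> 'b::euclidean_space"
  assumes "continuous_on UNIV f" and supp: "\<And>x. r < norm x \<Longrightarrow> f x = 0" and "0 < e"
  obtains d where "0 < d" "\<And>x y. dist x y < d \<Longrightarrow> dist (f x) (f y) < e"
proof -
  have "uniformly_continuous_on (cball 0 (r + 1)) f"
    by (intro compact_uniformly_continuous) (auto intro: continuous_on_subset[OF assms(1)])
  then obtain d where d: "0 < d" "\<And>x y. x \<in> cball 0 (r+1) \<Longrightarrow> y \<in> cball 0 (r+1) \<Longrightarrow> dist x y < d \<Longrightarrow> dist (f x) (f y) < e"
    using \<open>0 < e\<close> unfolding uniformly_continuous_on_def by (metis dist_commute)
  show ?thesis
  proof (rule that[of "min d 1"])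
    fix x y :: 'a assume xy: "dist x y < min d 1"
    show "dist (f x) (f y) < e"
    proof (cases "x \<in> cball 0 (r+1) \<and> y \<in> cball 0 (r+1)")
      case True then show ?thesis using d(2)[of x y] xy by auto
    next
      case False
      have "\<bar>norm x - norm y\<bar> < 1" using xy norm_triangle_ineq3[of x y] by (simp add: dist_norm)
      with False have "r < norm x" "r < norm y" by auto
      with supp \<open>0 < e\<close> show ?thesis by simp
    qed
  qed (use d in auto)
qed

text \<open>Compositions with truncations are only \<open>C^1\<close>, so the calculus is set up at
  that level, with the gradient field carried as an explicit second argument.\<close>

definition C1_grad :: "(real^'n \<Rightarrow> real) \<Rightarrow> (real^'n \<Rightarrow> real^'n) \<Rightarrow> bool" where
  "C1_grad f D \<longleftrightarrow> (\<forall>x. (f has_derivative (\<lambda>h. D x \<bullet> h)) (at x)) \<and> continuous_on UNIV D"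

lemma C1_gradD:
  assumes "C1_grad f D"
  shows "(f has_derivative (\<lambda>h. D x \<bullet> h)) (at x)" "continuous_on UNIV D" "continuous_on UNIV f"
proof -
  show "(f has_derivative (\<lambda>h. D x \<bullet> h)) (at x)" for x using assms by (simp add: C1_grad_def)
  then show "continuous_on UNIV f"
    by (blast intro: continuous_at_imp_continuous_on has_derivative_continuous)
qed (use assms in \<open>simp add: C1_grad_def\<close>)

lemma C1_grad_borel:
  assumes "C1_grad f D"
  shows "f \<in> borel_measurable borel" "D \<in> borel_measurable borel"
  using C1_gradD[OF assms] borel_measurable_continuous_onI by auto

lemma C1_grad_zero_open:
  assumes f: "C1_grad f D" and U: "open U" "\<And>x. x \<in> U \<Longrightarrow> f x = 0" and x: "x \<in> U"
  shows "D x = 0"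
proof -
  have "((\<lambda>_. 0) has_derivative (\<lambda>h. D x \<bullet> h)) (at x)"
    by (rule has_derivative_transform_within_open[OF C1_gradD(1)[OF f] U(1) x]) (use U in auto)
  then have "(\<lambda>h. D x \<bullet> h) = (\<lambda>h. 0)"
    using has_derivative_unique has_derivative_const by blast
  then have "D x \<bullet> D x = 0" by meson
  then show ?thesis by simp
qed

lemma C1_grad_bounded_support:
  assumes "C1_grad f D" and "\<And>x. r < norm x \<Longrightarrow> f x = 0" and "r < norm x"
  shows "D x = 0"
  by (rule C1_grad_zero_open[OF assms(1), of "{y. r < norm y}"])
     (use assms in \<open>auto intro!: open_Collect_less continuous_intros\<close>)

lemma C1_grad_unique: "C1_grad f D \<Longrightarrow> classical_grad f = D"
  by (auto simp: fun_eq_iff vec_eq_iff classical_grad_def inner_axis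
      partial_deriv_eqI[OF C1_gradD(1)])

lemma smooth_C1_grad:
  assumes "smooth_on UNIV f"
  shows "C1_grad f (classical_grad f)"
proof -
  have 1: "Ck_on (Suc 0) UNIV f" using assms by (simp add: smooth_on_def)
  then have "continuous_on UNIV (\<lambda>x. \<chi> i. partial_deriv i f x)"
    by (intro continuous_on_vec_lambda) auto
  then have "continuous_on UNIV (classical_grad f)"
    by (simp add: classical_grad_def[abs_def])
  then show ?thesis
    using 1 by (auto simp: C1_grad_def intro: has_derivative_partial)
qed

lemma smooth_on_partial_deriv: "smooth_on UNIV f \<Longrightarrow> smooth_on UNIV (partial_deriv i f)"
  unfolding smooth_on_def by (metis Ck_on.simps(2))

text \<open>Bounded support makes \<open>D\<close> uniformly continuous, and the mean value
  inequality on a ball turns this into a first order remainder whose rate does not depend on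
  \<open>x\<close>. Such a remainder can be integrated against any integrable function.\<close>

lemma C1_grad_uniform:
  fixes f :: "real^'n \<Rightarrow> real"
  assumes f: "C1_grad f D" and supp: "\<And>x. r < norm x \<Longrightarrow> f x = 0" and "0 < e"
  obtains d where "0 < d" "\<And>x h. norm h < d \<Longrightarrow> \<bar>f (x + h) - f x - D x \<bullet> h\<bar> \<le> e * norm h"
proof -
  have "D x = 0" if "r < norm x" for x
    using C1_grad_bounded_support[OF f supp that] .
  from uniform_cont_bounded_support[OF C1_gradD(2)[OF f] this \<open>0 < e\<close>]
  obtain d where d: "0 < d" "\<And>x y. dist x y < d \<Longrightarrow> dist (D x) (D y) < e"
    by metis
  show ?thesis
  proof (rule that[OF d(1)])
    fix x h :: "real^'n" assume h: "norm h < d"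
    have "norm (f (x + h) - f x - D x \<bullet> (x + h - x)) \<le> norm (x + h - x) * e"
    proof (rule differentiable_bound_linearization[where S="ball x d" and f'="\<lambda>x h. D x \<bullet> h"])
      show "x + t *\<^sub>R (x + h - x) \<in> ball x d" if "t \<in> {0..1}" for t
        using h that mult_left_le_one_le[of "norm h" "t"] by (auto simp: dist_norm)
      show "(f has_derivative (\<lambda>h. D y \<bullet> h)) (at y within ball x d)" for y
        using C1_gradD(1)[OF f] has_derivative_at_withinI by blast
      show "onorm ((\<bullet>) (D y) - (\<bullet>) (D x)) \<le> e" if "y \<in> ball x d" for y
        unfolding fun_diff_def
      proof (rule onorm_le)
        fix k
        have "norm (D y \<bullet> k - D x \<bullet> k) \<le> norm (D y - D x) * norm k"
          by (simp add: inner_diff_left[symmetric] Cauchy_Schwarz_ineq2)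
        also have "\<dots> \<le> e * norm k"
          using d(2)[of x y] that by (intro mult_right_mono) (auto simp: dist_norm norm_minus_commute)
        finally show "norm (D y \<bullet> k - D x \<bullet> k) \<le> e * norm k" .
      qed
    qed (use d in auto)
    then show "\<bar>f (x + h) - f x - D x \<bullet> h\<bar> \<le> e * norm h" by (simp add: mult.commute)
  qed
qed

text \<open>Translation invariance makes the integral of every difference quotient vanish, and the
  uniform remainder lets the quotient be replaced by the derivative. This is the integration by
  parts behind the weak gradients computed later.\<close>

lemma integral_partial_zero:
  fixes f :: "real^'n \<Rightarrow> real"
  assumes f: "C1_grad f D" and supp: "\<And>x. r < norm x \<Longrightarrow> f x = 0"
  shows "(\<integral>x. D x $ i \<partial>lborel) = 0"
proof -
  note fb = C1_grad_borel[OF f] and suppD = C1_grad_bounded_support[OF f supp]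
  have If: "integrable lborel f"
    by (rule integrable_cont_bounded_support[OF C1_gradD(3)[OF f] supp])
  have ID: "integrable lborel D"
    by (rule integrable_cont_bounded_support[OF C1_gradD(2)[OF f] suppD])
  then have IDi: "integrable lborel (\<lambda>x. D x $ i)"
    using integrable_inner_left[of "axis i 1" lborel D] ID by (simp add: inner_axis)
  let ?m = "measure lborel (cball (0::real^'n) (r + 1))"
  have "\<bar>\<integral>x. D x $ i \<partial>lborel\<bar> \<le> e * ?m" if e: "0 < e" for e
  proof -
    obtain d where d: "0 < d" "\<And>x h. norm h < d \<Longrightarrow> \<bar>f (x + h) - f x - D x \<bullet> h\<bar> \<le> e * norm h"
      using C1_grad_uniform[OF f supp e] by blast
    \<comment> \<open>The bound \<open>t \<le> 1\<close> keeps the shifted support inside the ball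
      of radius \<open>r + 1\<close>, over which the error is integrated.\<close>
    define t where "t = min (d/2) 1"
    have t: "0 < t" "t < d" "t \<le> 1" using d by (auto simp: t_def)
    let ?h = "t *\<^sub>R axis i (1::real)"
    have nh: "norm ?h = t" using t by simp
    have It: "integrable lborel (\<lambda>x. f (x + ?h))"
    proof (rule integrable_cont_bounded_support[of _ "r + 1"])
      show "continuous_on UNIV (\<lambda>x. f (x + ?h))"
        by (rule continuous_on_compose2[OF C1_gradD(3)[OF f]]) (auto intro!: continuous_intros)
      fix x :: "real^'n" assume "r + 1 < norm x"
      moreover have "norm x \<le> norm (x + ?h) + t" using norm_triangle_ineq4[of "x + ?h" ?h] nh by simp
      ultimately show "f (x + ?h) = 0" using t by (intro supp) linarith
    qed
    have "t * (\<integral>x. D x $ i \<partial>lborel) = - (\<integral>x. (f (x + ?h) - f x - t * D x $ i) \<partial>lborel)"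
      using If It IDi integral_translate[OF fb(1), of ?h] by simp
    also have "\<bar>\<dots>\<bar> \<le> (\<integral>x. e * t * indicator (cball (0::real^'n) (r+1)) x \<partial>lborel)"
      unfolding abs_minus_cancel
    proof (rule Bochner_Integration.integral_abs_bound_integral)
      show "integrable lborel (\<lambda>x. f (x + ?h) - f x - t * D x $ i)"
        using If It IDi by auto
      show "integrable lborel (\<lambda>x::real^'n. e * t * indicator (cball 0 (r+1)) x)"
        by (intro integrable_mult_right integrable_real_indicator)
           (simp_all add: emeasure_lborel_cball_finite[unfolded infinity_ennreal_def])
      fix x :: "real^'n"
      show "\<bar>f (x + ?h) - f x - t * D x $ i\<bar> \<le> e * t * indicator (cball 0 (r+1)) x"
      proof (cases "r + 1 < norm x")
        case True
        moreover have "norm x \<le> norm (x + ?h) + t" using norm_triangle_ineq4[of "x + ?h" ?h] nh by simp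
        ultimately have "f (x + ?h) = 0" "f x = 0" "D x = 0" using t by (auto intro!: supp suppD)
        then show ?thesis using t e by simp
      next
        case False
        then show ?thesis using d(2)[of ?h x] t nh by (simp add: inner_axis not_less)
      qed
    qed
    also have "\<dots> = t * (e * ?m)" by simp
    finally show ?thesis using t by (simp add: abs_mult)
  qed
  note main = this
  have "\<bar>\<integral>x. D x $ i \<partial>lborel\<bar> \<le> 0 + e" if "0 < e" for e
  proof -
    have "\<bar>\<integral>x. D x $ i \<partial>lborel\<bar> \<le> (e / (?m + 1)) * ?m"
      using that by (intro main) (simp add: add_nonneg_pos)
    also have "\<dots> = e * (?m / (?m + 1))" by simp
    also have "\<dots> \<le> e * 1"
    proof (rule mult_left_mono)
      have "0 \<le> ?m" by (rule measure_nonneg)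
      then show "?m / (?m + 1) \<le> 1" by (subst divide_le_eq_1_pos) linarith+
    qed (use that in simp)
    finally show ?thesis by simp
  qed
  then have "\<bar>\<integral>x. D x $ i \<partial>lborel\<bar> \<le> 0" by (rule field_le_epsilon)
  then show ?thesis by simp
qed

definition conv :: "(real^'n \<Rightarrow> real) \<Rightarrow> (real^'n \<Rightarrow> real) \<Rightarrow> real^'n \<Rightarrow> real" where
  "conv U \<rho> x = (\<integral>y. U y * \<rho> (x - y) \<partial>lborel)"

lemma integrable_conv:
  fixes \<rho> :: "real^'n \<Rightarrow> real"
  assumes "integrable lborel U" "continuous_on UNIV \<rho>" "\<And>x. r < norm x \<Longrightarrow> \<rho> x = 0"
  shows "integrable lborel (\<lambda>y. U y * \<rho> (x - y))"
proof -
  obtain B where B: "0 < B" "\<And>x. norm (\<rho> x) \<le> B"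
    using bounded_cont_bounded_support[OF assms(2,3)] by blast
  have [measurable]: "\<rho> \<in> borel_measurable borel" using assms(2) borel_measurable_continuous_onI by blast
  have [measurable]: "U \<in> borel_measurable borel" using assms(1) by auto
  show ?thesis
    by (rule Bochner_Integration.integrable_bound[OF integrable_mult_right[OF assms(1), of B]])
       (use B in \<open>auto simp: abs_mult mult.commute[of "B"] intro!: mult_left_mono\<close>)
qed

text \<open>The kernel takes the derivative, so \<open>U\<close> enters only through its
  \<open>L^1\<close> norm; a remainder of rate \<open>e / K\<close>, with \<open>K\<close> above
  that norm and positive, integrates to the rate \<open>e\<close>.\<close>

lemma conv_C1_grad:
  assumes U: "integrable lborel U" and \<rho>: "C1_grad \<rho> D" and supp: "\<And>x. r < norm x \<Longrightarrow> \<rho> x = 0"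
  shows "(conv U \<rho> has_derivative (\<lambda>h. (\<chi> i. conv U (\<lambda>x. D x $ i) x) \<bullet> h)) (at x)"
  unfolding has_derivative_at_alt
proof (intro conjI allI impI)
  show "bounded_linear (\<lambda>h. (\<chi> i. conv U (\<lambda>x. D x $ i) x) \<bullet> h)"
    by (rule bounded_linear_inner_right)
  fix e :: real assume e: "0 < e"
  have [measurable]: "U \<in> borel_measurable borel" using U by auto
  note [measurable] = C1_grad_borel[OF \<rho>]
  define K where "K = (\<integral>y. \<bar>U y\<bar> \<partial>lborel) + 1"
  have K: "K > 0" "(\<integral>y. \<bar>U y\<bar> \<partial>lborel) \<le> K" unfolding K_def by (auto intro: add_nonneg_pos)
  obtain d where d: "0 < d" "\<And>x h. norm h < d \<Longrightarrow> \<bar>\<rho> (x + h) - \<rho> x - D x \<bullet> h\<bar> \<le> e / K * norm h"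
    using C1_grad_uniform[OF \<rho> supp divide_pos_pos[OF e K(1)]] by blast
  have I\<rho>: "integrable lborel (\<lambda>y. U y * \<rho> (z - y))" for z
    by (rule integrable_conv[OF U C1_gradD(3)[OF \<rho>] supp])
  have Ii: "integrable lborel (\<lambda>y. U y * D (z - y) $ i)" for z i
  proof (rule integrable_conv[OF U])
    show "continuous_on UNIV (\<lambda>x. D x $ i)" using C1_gradD(2)[OF \<rho>] by (intro continuous_intros)
    show "\<And>x. r < norm x \<Longrightarrow> D x $ i = 0" using C1_grad_bounded_support[OF \<rho> supp] by simp
  qed
  show "\<exists>d>0. \<forall>y. norm (y - x) < d \<longrightarrow>
      norm (conv U \<rho> y - conv U \<rho> x - (\<chi> i. conv U (\<lambda>x. D x $ i) x) \<bullet> (y - x)) \<le> e * norm (y - x)"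
  proof (intro exI conjI allI impI)
    fix y assume y: "norm (y - x) < d"
    let ?h = "y - x"
    have eq: "(\<chi> i. conv U (\<lambda>x. D x $ i) x) \<bullet> ?h = (\<integral>z. U z * (D (x - z) \<bullet> ?h) \<partial>lborel)"
      unfolding inner_vec_def conv_def using Ii
      by (simp add: sum_distrib_left mult.assoc[symmetric] Bochner_Integration.integral_sum)
    have Ih: "integrable lborel (\<lambda>z. U z * (D (x - z) \<bullet> ?h))"
      unfolding inner_vec_def using Ii by (simp add: sum_distrib_left mult.assoc[symmetric])
    have "conv U \<rho> y - conv U \<rho> x - (\<chi> i. conv U (\<lambda>x. D x $ i) x) \<bullet> ?h
       = (\<integral>z. U z * (\<rho> (x - z + ?h) - \<rho> (x - z) - D (x - z) \<bullet> ?h) \<partial>lborel)"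
      unfolding eq unfolding conv_def using I\<rho>[of x] I\<rho>[of y] Ih by (simp add: right_diff_distrib)
    also have "norm \<dots> \<le> (\<integral>z. \<bar>U z\<bar> * (e / K * norm ?h) \<partial>lborel)"
    proof (rule Bochner_Integration.integral_norm_bound_integral)
      show "integrable lborel (\<lambda>z. U z * (\<rho> (x - z + ?h) - \<rho> (x - z) - D (x - z) \<bullet> ?h))"
        using I\<rho>[of x] I\<rho>[of y] Ih by (simp add: right_diff_distrib)
      show "integrable lborel (\<lambda>z. \<bar>U z\<bar> * (e / K * norm ?h))" using U by auto
      show "norm (U z * (\<rho> (x - z + ?h) - \<rho> (x - z) - D (x - z) \<bullet> ?h)) \<le> \<bar>U z\<bar> * (e / K * norm ?h)" for z
        unfolding norm_mult using d(2)[OF y, of "x - z"] by (intro mult_mono) auto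
    qed
    also have "\<dots> = (\<integral>y. \<bar>U y\<bar> \<partial>lborel) * (e / K * norm ?h)" by simp
    also have "\<dots> \<le> K * (e / K * norm ?h)" using K e by (intro mult_right_mono) auto
    also have "\<dots> = e * norm ?h" using K by simp
    finally show "norm (conv U \<rho> y - conv U \<rho> x - (\<chi> i. conv U (\<lambda>x. D x $ i) x) \<bullet> (y - x)) \<le> e * norm (y - x)" .
  qed (rule d)
qed

lemma partial_deriv_conv:
  assumes U: "integrable lborel U" and \<rho>: "smooth_on UNIV \<rho>" and supp: "\<And>x. r < norm x \<Longrightarrow> \<rho> x = 0"
  shows "partial_deriv i (conv U \<rho>) = conv U (partial_deriv i \<rho>)"
  using partial_deriv_eqI[OF conv_C1_grad[OF U smooth_C1_grad[OF \<rho>] supp], where i=i]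
  by (auto simp: fun_eq_iff inner_axis classical_grad_def)

text \<open>Partial derivatives of the convolution are convolutions with partial derivatives of the
  kernel, which vanish outside the same ball. The induction therefore runs over all kernels with
  that support.\<close>

lemma smooth_conv:
  assumes U: "integrable lborel U" and \<rho>: "smooth_on UNIV \<rho>" and supp: "\<And>x. r < norm x \<Longrightarrow> \<rho> x = 0"
  shows "smooth_on UNIV (conv U \<rho>)"
proof -
  have "Ck_on k UNIV (conv U \<rho>)" for k
    using \<rho> supp
  proof (induction k arbitrary: \<rho>)
    case 0
    then show ?case using has_derivative_continuous[OF conv_C1_grad[OF U smooth_C1_grad[OF 0(1)] 0(2)]]
      by (simp add: continuous_at_imp_continuous_on)
  next
    case (Suc k)
    note D = conv_C1_grad[OF U smooth_C1_grad[OF Suc(2)] Suc(3)]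
    have "partial_deriv i \<rho> x = 0" if "r < norm x" for i x
      using C1_grad_bounded_support[OF smooth_C1_grad[OF Suc(2)] Suc(3) that]
      by (simp add: classical_grad_def vec_eq_iff)
    then have "Ck_on k UNIV (partial_deriv i (conv U \<rho>))" for i
      using Suc.IH[OF smooth_on_partial_deriv[OF Suc(2)]] partial_deriv_conv[OF U Suc(2,3)] by metis
    moreover have "continuous_on UNIV (conv U \<rho>)"
      using has_derivative_continuous[OF D] by (simp add: continuous_at_imp_continuous_on)
    moreover have "conv U \<rho> differentiable (at x)" for x
      by (rule differentiableI[OF D])
    ultimately show ?case by simp
  qed
  then show ?thesis by (simp add: smooth_on_def)
qed

section \<open>Continuity of translations in \<open>L\<^sup>2\<close>\<close>

lemma power2_add_le: "(a + b)\<^sup>2 \<le> 2 * a\<^sup>2 + 2 * b\<^sup>2" for a b :: real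
  using sum_squares_ge_zero[of "a - b" 0] by (simp add: power2_eq_square algebra_simps)

lemma two_ennreal: "0 \<le> a \<Longrightarrow> 2 * ennreal a = ennreal (2 * a)"
  by (simp add: ennreal_mult)

lemma [measurable]: "cball c r \<in> sets borel" "ball c r \<in> sets borel"
  by auto

lemma integral_reflect:
  fixes f :: "'a::euclidean_space \<Rightarrow> real"
  assumes [measurable]: "f \<in> borel_measurable borel"
  shows "(\<integral>x. f (c - x) \<partial>lborel) = (\<integral>x. f x \<partial>lborel)"
    and "integrable lborel (\<lambda>x. f (c - x)) \<longleftrightarrow> integrable lborel f"
proof -
  have "(\<integral>x. f x \<partial>lborel) = (\<integral>x. f x \<partial>distr lborel borel (\<lambda>x. c + (-1) *\<^sub>R x))"
    by (subst lborel_affine[of "-1" c]) (simp_all add: density_1)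
  also have "\<dots> = (\<integral>x. f (c - x) \<partial>lborel)"
    by (subst integral_distr) auto
  finally show "(\<integral>x. f (c - x) \<partial>lborel) = (\<integral>x. f x \<partial>lborel)" ..
  have "integrable lborel f \<longleftrightarrow> integrable (distr lborel borel (\<lambda>x. c + (-1) *\<^sub>R x)) f"
    by (subst lborel_affine[of "-1" c]) (simp_all add: density_1)
  also have "\<dots> \<longleftrightarrow> integrable lborel (\<lambda>x. f (c - x))"
    by (subst integrable_distr_eq) auto
  finally show "integrable lborel (\<lambda>x. f (c - x)) \<longleftrightarrow> integrable lborel f" ..
qed

lemma borel_AE_limit_continuous:
  fixes f :: "'a::euclidean_space \<Rightarrow> real"
  assumes "f \<in> borel_measurable borel"
  obtains h where "\<And>n::nat. continuous_on UNIV (h n)" "AE x in lborel. (\<lambda>n. h n x) \<longlonglongrightarrow> f x"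
proof -
  have "f \<in> borel_measurable lebesgue" using assms by (intro measurable_completion) simp
  then have "f measurable_on UNIV"
    using lebesgue_measurable_imp_measurable_on[of f UNIV] by (simp add: lebesgue_on_UNIV_eq)
  then obtain N h where N: "negligible N" and h: "\<And>n::nat. continuous_on UNIV (h n)"
     "\<And>x. x \<notin> N \<Longrightarrow> (\<lambda>n. h n x) \<longlonglongrightarrow> f x"
    unfolding measurable_on_def by auto
  have [measurable]: "h n \<in> borel_measurable borel" for n using h(1) borel_measurable_continuous_onI by blast
  have [measurable]: "f \<in> borel_measurable borel" by fact
  have "AE x in lebesgue. x \<notin> N"
    using N by (intro AE_not_in) (simp add: negligible_iff_null_sets)
  then have "AE x in lebesgue. (\<lambda>n. h n x) \<longlonglongrightarrow> f x" by eventually_elim (rule h(2))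
  then have "AE x in lborel. (\<lambda>n. h n x) \<longlonglongrightarrow> f x"
    by (subst (asm) AE_completion_iff) auto
  then show ?thesis using h(1) that by blast
qed

lemma L2_truncate_approx:
  fixes G :: "'a::euclidean_space \<Rightarrow> real"
  assumes G[measurable]: "G \<in> borel_measurable borel" and fin: "(\<integral>\<^sup>+x. ennreal ((G x)\<^sup>2) \<partial>lborel) < \<infinity>"
    and e: "0 < e"
  obtains N :: nat where
    "(\<integral>\<^sup>+x. ennreal ((G x - indicator (cball 0 (real N)) x * max (- real N) (min (real N) (G x)))\<^sup>2) \<partial>lborel) < e"
proof -
  let ?F = "\<lambda>N x. indicator (cball 0 (real N)) x * max (- real N) (min (real N) (G x))"
  have "(\<lambda>N. \<integral>\<^sup>+x. ennreal ((G x - ?F N x)\<^sup>2) \<partial>lborel) \<longlonglongrightarrow> (\<integral>\<^sup>+x. 0 \<partial>(lborel :: 'a measure))"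
  proof (rule nn_integral_dominated_convergence[OF _ _ _ _ fin])
    show "AE x in lborel. ennreal ((G x - ?F N x)\<^sup>2) \<le> ennreal ((G x)\<^sup>2)" for N
      by (intro AE_I2 ennreal_leI) (auto simp: indicator_def abs_le_square_iff[symmetric] max_def min_def)
    show "AE x in lborel. (\<lambda>N. ennreal ((G x - ?F N x)\<^sup>2)) \<longlonglongrightarrow> 0"
    proof (rule AE_I2)
      fix x
      obtain M where M: "max (norm x) \<bar>G x\<bar> \<le> real M" using real_arch_simple by blast
      have "\<forall>\<^sub>F N in sequentially. ennreal ((G x - ?F N x)\<^sup>2) = 0"
        using eventually_ge_at_top[of M]
      proof eventually_elim
        case (elim N)
        then have "norm x \<le> real N" "- real N \<le> G x" "G x \<le> real N"
          using M unfolding max.bounded_iff by linarith+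
        then show ?case by (auto simp: indicator_def)
      qed
      then show "(\<lambda>N. ennreal ((G x - ?F N x)\<^sup>2)) \<longlonglongrightarrow> 0" by (rule tendsto_eventually)
    qed
  qed auto
  then have "\<forall>\<^sub>F N in sequentially. (\<integral>\<^sup>+x. ennreal ((G x - ?F N x)\<^sup>2) \<partial>lborel) < e"
    using e by (intro order_tendstoD) auto
  then obtain N where "(\<integral>\<^sup>+x. ennreal ((G x - ?F N x)\<^sup>2) \<partial>lborel) < e"
    using eventually_happens'[OF sequentially_bot] by blast
  then show ?thesis by (rule that)
qed

text \<open>Almost everywhere convergence of continuous functions becomes \<open>L^2\<close>
  convergence once they are clamped to \<open>[-N, N]\<close> and cut off outside radius
  \<open>N + 1\<close>: a constant on that ball is then a dominating function. Neither operation
  changes the limit \<open>G\<close>.\<close>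

lemma bounded_L2_continuous_approx:
  fixes G :: "'a::euclidean_space \<Rightarrow> real"
  assumes G[measurable]: "G \<in> borel_measurable borel" and bd: "\<And>x. \<bar>G x\<bar> \<le> real N"
    and supp: "\<And>x. real N < norm x \<Longrightarrow> G x = 0" and e: "0 < e"
  obtains f where "continuous_on UNIV f" "\<And>x. real N + 1 < norm x \<Longrightarrow> f x = 0"
    "(\<integral>\<^sup>+x. ennreal ((G x - f x)\<^sup>2) \<partial>lborel) < e"
proof -
  obtain h where h: "\<And>n::nat. continuous_on UNIV (h n)" "AE x in lborel. (\<lambda>n. h n x) \<longlonglongrightarrow> G x"
    using borel_AE_limit_continuous[OF G] by blast
  define f where "f = (\<lambda>n x. max (- real N) (min (real N) (h n x)) * max 0 (min 1 (real N + 1 - norm x)))"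
  have cont: "continuous_on UNIV (f n)" for n
    unfolding f_def by (intro continuous_intros h(1))
  then have [measurable]: "f n \<in> borel_measurable borel" for n using borel_measurable_continuous_onI by blast
  have fs: "f n x = 0" if "real N + 1 < norm x" for n x using that by (simp add: f_def)
  have fb: "\<bar>f n x\<bar> \<le> real N" for n x
    unfolding f_def abs_mult by (rule order_trans[OF mult_mono[of _ "real N" _ 1]]) auto
  have "(\<lambda>n. \<integral>\<^sup>+x. ennreal ((G x - f n x)\<^sup>2) \<partial>lborel) \<longlonglongrightarrow> (\<integral>\<^sup>+x. 0 \<partial>(lborel :: 'a measure))"
  proof (rule nn_integral_dominated_convergence[where w="\<lambda>x. ennreal ((2 * real N)\<^sup>2) * indicator (cball 0 (real N + 1)) x"])
    show "AE x in lborel. ennreal ((G x - f n x)\<^sup>2) \<le> ennreal ((2 * real N)\<^sup>2) * indicator (cball 0 (real N + 1)) x" for n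
    proof (rule AE_I2)
      fix x
      show "ennreal ((G x - f n x)\<^sup>2) \<le> ennreal ((2 * real N)\<^sup>2) * indicator (cball 0 (real N + 1)) x"
      proof (cases "real N + 1 < norm x")
        case True then show ?thesis using fs[of x n] supp[of x] by auto
      next
        case False
        have "\<bar>G x - f n x\<bar> \<le> \<bar>2 * real N\<bar>" using bd[of x] fb[of n x] by linarith
        then have "(G x - f n x)\<^sup>2 \<le> (2 * real N)\<^sup>2" by (simp only: abs_le_square_iff)
        then show ?thesis using False by (auto intro!: ennreal_leI)
      qed
    qed
    show "(\<integral>\<^sup>+x. ennreal ((2 * real N)\<^sup>2) * indicator (cball (0::'a) (real N + 1)) x \<partial>lborel) < \<infinity>"
      by (simp add: nn_integral_cmult_indicator ennreal_mult_less_top emeasure_lborel_cball_finite[unfolded infinity_ennreal_def])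
    show "AE x in lborel. (\<lambda>n. ennreal ((G x - f n x)\<^sup>2)) \<longlonglongrightarrow> 0"
      using h(2)
    proof eventually_elim
      case (elim x)
      have "(\<lambda>n. f n x) \<longlonglongrightarrow> max (- real N) (min (real N) (G x)) * max 0 (min 1 (real N + 1 - norm x))"
        unfolding f_def by (intro tendsto_intros elim)
      also have "max (- real N) (min (real N) (G x)) * max 0 (min 1 (real N + 1 - norm x)) = G x"
        using bd[of x] supp[of x] by (cases "real N < norm x") (auto simp: max_def min_def abs_le_iff)
      finally have "(\<lambda>n. (G x - f n x)\<^sup>2) \<longlonglongrightarrow> (G x - G x)\<^sup>2"
        by (intro tendsto_intros)
      then show ?case by (simp add: tendsto_ennreal_iff flip: ennreal_0)
    qed
  qed auto
  then have "\<forall>\<^sub>F n in sequentially. (\<integral>\<^sup>+x. ennreal ((G x - f n x)\<^sup>2) \<partial>lborel) < e"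
    using e by (intro order_tendstoD) auto
  then obtain n where "(\<integral>\<^sup>+x. ennreal ((G x - f n x)\<^sup>2) \<partial>lborel) < e"
    using eventually_happens'[OF sequentially_bot] by blast
  then show ?thesis using that[of "f n"] cont fs by blast
qed

lemma nn_integral_square_add_le:
  fixes f g :: "'a \<Rightarrow> real"
  assumes [measurable]: "f \<in> borel_measurable M" "g \<in> borel_measurable M"
  shows "(\<integral>\<^sup>+x. ennreal ((f x + g x)\<^sup>2) \<partial>M) \<le> 2 * (\<integral>\<^sup>+x. ennreal ((f x)\<^sup>2) \<partial>M) + 2 * (\<integral>\<^sup>+x. ennreal ((g x)\<^sup>2) \<partial>M)"
proof -
  have "(\<integral>\<^sup>+x. ennreal ((f x + g x)\<^sup>2) \<partial>M) \<le> (\<integral>\<^sup>+x. 2 * ennreal ((f x)\<^sup>2) + 2 * ennreal ((g x)\<^sup>2) \<partial>M)"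
  proof (rule nn_integral_mono)
    fix x
    have "ennreal ((f x + g x)\<^sup>2) \<le> ennreal (2 * (f x)\<^sup>2 + 2 * (g x)\<^sup>2)"
      by (intro ennreal_leI power2_add_le)
    then show "ennreal ((f x + g x)\<^sup>2) \<le> 2 * ennreal ((f x)\<^sup>2) + 2 * ennreal ((g x)\<^sup>2)"
      by (simp add: ennreal_mult)
  qed
  also have "\<dots> = 2 * (\<integral>\<^sup>+x. ennreal ((f x)\<^sup>2) \<partial>M) + 2 * (\<integral>\<^sup>+x. ennreal ((g x)\<^sup>2) \<partial>M)"
    by (simp add: nn_integral_add nn_integral_cmult)
  finally show ?thesis .
qed

lemma L2_continuous_approx:
  fixes G :: "'a::euclidean_space \<Rightarrow> real"
  assumes G[measurable]: "G \<in> borel_measurable borel" and fin: "(\<integral>\<^sup>+x. ennreal ((G x)\<^sup>2) \<partial>lborel) < \<infinity>"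
    and e: "0 < e"
  obtains f r where "continuous_on UNIV f" "\<And>x. r < norm x \<Longrightarrow> f x = 0"
    "(\<integral>\<^sup>+x. ennreal ((G x - f x)\<^sup>2) \<partial>lborel) < ennreal e"
proof -
  have e4: "(0::ennreal) < ennreal (e / 4)" using e by (simp add: ennreal_less_zero_iff)
  obtain N where N: "(\<integral>\<^sup>+x. ennreal ((G x - indicator (cball 0 (real N)) x * max (- real N) (min (real N) (G x)))\<^sup>2) \<partial>lborel) < ennreal (e / 4)"
    using L2_truncate_approx[OF G fin e4] by blast
  define H where "H = (\<lambda>x. indicator (cball 0 (real N)) x * max (- real N) (min (real N) (G x)))"
  have [measurable]: "H \<in> borel_measurable borel" unfolding H_def by measurable
  have "\<bar>H x\<bar> \<le> real N" "real N < norm x \<Longrightarrow> H x = 0" for x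
    by (auto simp: H_def indicator_def abs_le_iff)
  from bounded_L2_continuous_approx[OF \<open>H \<in> borel_measurable borel\<close> this e4]
  obtain f where f: "continuous_on UNIV f" "\<And>x. real N + 1 < norm x \<Longrightarrow> f x = 0"
    "(\<integral>\<^sup>+x. ennreal ((H x - f x)\<^sup>2) \<partial>lborel) < ennreal (e / 4)"
    by metis
  have [measurable]: "f \<in> borel_measurable borel" using f(1) borel_measurable_continuous_onI by blast
  have "(\<integral>\<^sup>+x. ennreal ((G x - f x)\<^sup>2) \<partial>lborel) = (\<integral>\<^sup>+x. ennreal (((G x - H x) + (H x - f x))\<^sup>2) \<partial>lborel)"
    by simp
  also have "\<dots> \<le> 2 * (\<integral>\<^sup>+x. ennreal ((G x - H x)\<^sup>2) \<partial>lborel) + 2 * (\<integral>\<^sup>+x. ennreal ((H x - f x)\<^sup>2) \<partial>lborel)"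
    by (rule nn_integral_square_add_le) auto
  also have "\<dots> < 2 * ennreal (e / 4) + 2 * ennreal (e / 4)"
    using N f(3) unfolding H_def
    by (intro add_strict_mono ennreal_mult_strict_left_mono) auto
  also have "\<dots> = ennreal (2 * (e / 4) + 2 * (e / 4))"
    using e by (simp add: two_ennreal ennreal_plus[symmetric] del: ennreal_plus)
  also have "\<dots> = ennreal e" by simp
  finally show ?thesis using that[OF f(1,2)] by blast
qed

text \<open>Translations act isometrically on \<open>L^2\<close>, so the claim passes from
  continuous functions of bounded support, where it is uniform continuity, to their
  \<open>L^2\<close> limits.\<close>

lemma L2_translation_continuous:
  fixes G :: "'a::euclidean_space \<Rightarrow> real"
  assumes G[measurable]: "G \<in> borel_measurable borel" and fin: "(\<integral>\<^sup>+x. ennreal ((G x)\<^sup>2) \<partial>lborel) < \<infinity>"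
    and e: "0 < e"
  obtains d where "0 < d" "\<And>y. norm y < d \<Longrightarrow> (\<integral>\<^sup>+x. ennreal ((G (x - y) - G x)\<^sup>2) \<partial>lborel) \<le> ennreal e"
proof -
  \<comment> \<open>Two applications of \<open>(a + b)^2 \<le> 2 a^2 + 2 b^2\<close> weigh each of
    the two approximation errors by \<open>4\<close> and the shift of \<open>f\<close> by
    \<open>2\<close>; hence \<open>e / 16\<close> here and \<open>e / 4\<close> below.\<close>
  obtain f r where f: "continuous_on UNIV f" "\<And>x. r < norm x \<Longrightarrow> f x = 0"
    "(\<integral>\<^sup>+x. ennreal ((G x - f x)\<^sup>2) \<partial>lborel) < ennreal (e / 16)"
    using L2_continuous_approx[OF G fin, of "e / 16"] e by auto
  have [measurable]: "f \<in> borel_measurable borel" using f(1) borel_measurable_continuous_onI by blast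
  define m where "m = measure lborel (cball (0::'a) (r + 1))"
  define t where "t = sqrt (e / (4 * (m + 1)))"
  have m: "m \<ge> 0" unfolding m_def by (rule measure_nonneg)
  have t: "t > 0" "t\<^sup>2 * m \<le> e / 4"
  proof -
    show "t > 0" using e m by (auto simp: t_def intro!: divide_pos_pos)
    have "t\<^sup>2 * m = e / 4 * (m / (m + 1))"
      using e m by (simp add: t_def divide_simps)
    also have "\<dots> \<le> e / 4 * 1"
      using e m by (intro mult_left_mono) auto
    finally show "t\<^sup>2 * m \<le> e / 4" by simp
  qed
  obtain d where d: "0 < d" "\<And>x y. dist x y < d \<Longrightarrow> dist (f x) (f y) < t"
    using uniform_cont_bounded_support[OF f(1,2) t(1)] by blast
  show ?thesis
  proof (rule that[of "min d 1"])
    fix y :: 'a assume y: "norm y < min d 1"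
    have 1: "(\<integral>\<^sup>+x. ennreal ((G (x - y) - f (x - y))\<^sup>2) \<partial>lborel) = (\<integral>\<^sup>+x. ennreal ((G x - f x)\<^sup>2) \<partial>lborel)"
      using nn_integral_translate[of "\<lambda>x. ennreal ((G x - f x)\<^sup>2)" "- y"] by simp
    have 2: "(\<integral>\<^sup>+x. ennreal ((f x - G x)\<^sup>2) \<partial>lborel) = (\<integral>\<^sup>+x. ennreal ((G x - f x)\<^sup>2) \<partial>lborel)"
      by (simp add: power2_commute)
    have "(\<integral>\<^sup>+x. ennreal ((f (x - y) - f x)\<^sup>2) \<partial>lborel) \<le> (\<integral>\<^sup>+x. ennreal (t\<^sup>2) * indicator (cball (0::'a) (r + 1)) x \<partial>lborel)"
    proof (rule nn_integral_mono)
      fix x :: 'a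
      show "ennreal ((f (x - y) - f x)\<^sup>2) \<le> ennreal (t\<^sup>2) * indicator (cball 0 (r + 1)) x"
      proof (cases "r + 1 < norm x")
        case True
        moreover have "norm x \<le> norm (x - y) + norm y" using norm_triangle_ineq[of "x - y" y] by simp
        ultimately have "f x = 0" "f (x - y) = 0" using y by (auto intro!: f(2))
        then show ?thesis by simp
      next
        case False
        have "\<bar>f (x - y) - f x\<bar> \<le> \<bar>t\<bar>"
          using d(2)[of "x - y" x] y by (simp add: dist_norm)
        then have "(f (x - y) - f x)\<^sup>2 \<le> t\<^sup>2" by (simp only: abs_le_square_iff)
        then show ?thesis using False by (auto intro!: ennreal_leI)
      qed
    qed
    also have "\<dots> = ennreal (t\<^sup>2 * m)"
      by (simp add: m_def nn_integral_cmult_indicator emeasure_eq_ennreal_measure ennreal_mult'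
          emeasure_lborel_cball_finite[unfolded infinity_ennreal_def, THEN less_imp_neq])
    also have "\<dots> \<le> ennreal (e / 4)" using t by (intro ennreal_leI)
    finally have 3: "(\<integral>\<^sup>+x. ennreal ((f (x - y) - f x)\<^sup>2) \<partial>lborel) \<le> ennreal (e / 4)" .
    have "(\<integral>\<^sup>+x. ennreal ((G (x - y) - G x)\<^sup>2) \<partial>lborel)
       = (\<integral>\<^sup>+x. ennreal (((f (x - y) - f x) + ((G (x - y) - f (x - y)) + (f x - G x)))\<^sup>2) \<partial>lborel)"
      by simp
    also have "\<dots> \<le> 2 * (\<integral>\<^sup>+x. ennreal ((f (x - y) - f x)\<^sup>2) \<partial>lborel)
        + 2 * (\<integral>\<^sup>+x. ennreal (((G (x - y) - f (x - y)) + (f x - G x))\<^sup>2) \<partial>lborel)"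
      by (rule nn_integral_square_add_le) auto
    also have "\<dots> \<le> 2 * ennreal (e / 4) + 2 * (2 * ennreal (e / 16) + 2 * ennreal (e / 16))"
    proof (intro add_mono mult_left_mono 3)
      have "(\<integral>\<^sup>+x. ennreal (((G (x - y) - f (x - y)) + (f x - G x))\<^sup>2) \<partial>lborel)
         \<le> 2 * (\<integral>\<^sup>+x. ennreal ((G (x - y) - f (x - y))\<^sup>2) \<partial>lborel) + 2 * (\<integral>\<^sup>+x. ennreal ((f x - G x)\<^sup>2) \<partial>lborel)"
        by (rule nn_integral_square_add_le) auto
      also have "\<dots> \<le> 2 * ennreal (e / 16) + 2 * ennreal (e / 16)"
        unfolding 1 2 using f(3) by (intro add_mono mult_left_mono) auto
      finally show "(\<integral>\<^sup>+x. ennreal (((G (x - y) - f (x - y)) + (f x - G x))\<^sup>2) \<partial>lborel)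
         \<le> 2 * ennreal (e / 16) + 2 * ennreal (e / 16)" .
    qed auto
    also have "\<dots> = ennreal (2 * (e / 4) + 2 * (2 * (e / 16) + 2 * (e / 16)))"
      using e by (simp add: two_ennreal ennreal_plus[symmetric] del: ennreal_plus)
    also have "\<dots> \<le> ennreal e" using e by (intro ennreal_leI) simp
    finally show "(\<integral>\<^sup>+x. ennreal ((G (x - y) - G x)\<^sup>2) \<partial>lborel) \<le> ennreal e" .
  qed (use d in auto)
qed

section \<open>Smooth approximation of functions with a weak gradient\<close>

lemma ennreal_lborel_finite_measure:
  "bounded S \<Longrightarrow> emeasure lborel (S :: 'a::euclidean_space set) = ennreal (measure lborel S)"
  using emeasure_bounded_finite[of S] by (intro emeasure_eq_ennreal_measure) auto

lemma abs_le_add_square: "0 < s \<Longrightarrow> \<bar>t\<bar> \<le> s + t\<^sup>2 / s" for s t :: real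
proof (cases "\<bar>t\<bar> \<le> s")
  case False
  assume s: "0 < s"
  have "s * \<bar>t\<bar> \<le> \<bar>t\<bar> * \<bar>t\<bar>" using False by (intro mult_right_mono) auto
  then have "\<bar>t\<bar> \<le> t\<^sup>2 / s" using s by (simp add: field_simps power2_eq_square)
  with s show ?thesis by simp
qed (auto intro: order_trans)

text \<open>The free parameter \<open>s\<close> stands in for the Cauchy-Schwarz inequality: the
  measure of \<open>K\<close> and the \<open>L^2\<close> energy are balanced by a choice of
  \<open>s\<close>, without square roots of extended reals.\<close>

lemma nn_integral_abs_le_square:
  fixes h :: "'a::euclidean_space \<Rightarrow> real"
  assumes [measurable]: "h \<in> borel_measurable borel" "K \<in> sets borel" and s: "0 < s"
  shows "(\<integral>\<^sup>+x\<in>K. ennreal \<bar>h x\<bar> \<partial>lborel)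
    \<le> ennreal s * emeasure lborel K + ennreal (1 / s) * (\<integral>\<^sup>+x\<in>K. ennreal ((h x)\<^sup>2) \<partial>lborel)"
proof -
  have "(\<integral>\<^sup>+x\<in>K. ennreal \<bar>h x\<bar> \<partial>lborel)
     \<le> (\<integral>\<^sup>+x. ennreal s * indicator K x + ennreal (1 / s) * (ennreal ((h x)\<^sup>2) * indicator K x) \<partial>lborel)"
  proof (rule nn_integral_mono)
    fix x
    have "ennreal \<bar>h x\<bar> \<le> ennreal (s + (1 / s) * (h x)\<^sup>2)"
      using abs_le_add_square[OF s, of "h x"] by (intro ennreal_leI) simp
    also have "\<dots> = ennreal s + ennreal (1 / s) * ennreal ((h x)\<^sup>2)"
      using s by (simp add: ennreal_mult[symmetric])
    finally show "ennreal \<bar>h x\<bar> * indicator K x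
       \<le> ennreal s * indicator K x + ennreal (1 / s) * (ennreal ((h x)\<^sup>2) * indicator K x)"
      by (auto simp: indicator_def)
  qed
  also have "\<dots> = ennreal s * emeasure lborel K + ennreal (1 / s) * (\<integral>\<^sup>+x\<in>K. ennreal ((h x)\<^sup>2) \<partial>lborel)"
    by (simp add: nn_integral_add nn_integral_cmult)
  finally show ?thesis .
qed

lemma integrable_of_L2:
  fixes h :: "'a::euclidean_space \<Rightarrow> real"
  assumes [measurable]: "h \<in> borel_measurable borel" "K \<in> sets borel" and K: "bounded K"
    and h: "(\<integral>\<^sup>+x\<in>K. ennreal ((h x)\<^sup>2) \<partial>lborel) < \<infinity>"
  shows "integrable lborel (\<lambda>x. indicator K x * h x)"
proof (rule integrableI_bounded)
  have "(\<integral>\<^sup>+x. ennreal (norm (indicator K x * h x)) \<partial>lborel) = (\<integral>\<^sup>+x\<in>K. ennreal \<bar>h x\<bar> \<partial>lborel)"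
    by (intro nn_integral_cong) (auto simp: indicator_def)
  also have "\<dots> \<le> ennreal 1 * emeasure lborel K + ennreal (1 / 1) * (\<integral>\<^sup>+x\<in>K. ennreal ((h x)\<^sup>2) \<partial>lborel)"
    by (rule nn_integral_abs_le_square) auto
  also have "\<dots> < \<infinity>" using h emeasure_bounded_finite[OF K] by simp
  finally show "(\<integral>\<^sup>+x. ennreal (norm (indicator K x * h x)) \<partial>lborel) < \<infinity>" .
qed measurable

lemma borel_measurable_vec_component [measurable (raw)]:
  "f \<in> borel_measurable M \<Longrightarrow> (\<lambda>x. (f x :: real^'n) $ i) \<in> borel_measurable M"
  by (rule borel_measurable_continuous_on[of "\<lambda>v. v $ i", OF continuous_on_component[OF continuous_on_id]])

text \<open>The variance of \<open>h\<close> under the probability density \<open>\<rho>\<close> is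
  nonnegative.\<close>

lemma weighted_mean_square_le:
  fixes h \<rho> :: "'a \<Rightarrow> real"
  assumes [measurable]: "h \<in> borel_measurable M" and \<rho>: "integrable M \<rho>" "\<And>x. 0 \<le> \<rho> x" "(\<integral>x. \<rho> x \<partial>M) = 1"
    and h\<rho>: "integrable M (\<lambda>x. h x * \<rho> x)"
  shows "ennreal ((\<integral>x. h x * \<rho> x \<partial>M)\<^sup>2) \<le> (\<integral>\<^sup>+x. ennreal ((h x)\<^sup>2 * \<rho> x) \<partial>M)"
proof (cases "(\<integral>\<^sup>+x. ennreal ((h x)\<^sup>2 * \<rho> x) \<partial>M) < \<infinity>")
  case True
  have [measurable]: "\<rho> \<in> borel_measurable M" using \<rho> by auto
  have I2: "integrable M (\<lambda>x. (h x)\<^sup>2 * \<rho> x)"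
    using True \<rho>(2) by (intro integrableI_nonneg) auto
  define a where "a = (\<integral>x. h x * \<rho> x \<partial>M)"
  have "0 \<le> (\<integral>x. (h x - a)\<^sup>2 * \<rho> x \<partial>M)" using \<rho>(2) by simp
  also have "(\<lambda>x. (h x - a)\<^sup>2 * \<rho> x) = (\<lambda>x. (h x)\<^sup>2 * \<rho> x - 2 * a * (h x * \<rho> x) + a\<^sup>2 * \<rho> x)"
    by (auto simp: power2_eq_square algebra_simps)
  also have "(\<integral>x. \<dots> x \<partial>M) = (\<integral>x. (h x)\<^sup>2 * \<rho> x \<partial>M) - 2 * a * a + a\<^sup>2"
    using I2 h\<rho> \<rho> by (simp add: a_def)
  finally have "a\<^sup>2 \<le> (\<integral>x. (h x)\<^sup>2 * \<rho> x \<partial>M)" by (simp add: power2_eq_square)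
  then show ?thesis
    using nn_integral_eq_integral[OF I2] \<rho>(2) by (simp add: a_def ennreal_leI)
next
  case False
  then show ?thesis by (simp add: less_top[symmetric])
qed

text \<open>\<open>conv G \<rho> - G\<close> averages the translation differences of
  \<open>G\<close> with weight \<open>\<rho>\<close>. Jensen's inequality moves the square inside
  the average, and exchanging the integrals leaves the \<open>L^2\<close> modulus of translation for
  shifts in the support of \<open>\<rho>\<close>.\<close>

lemma conv_L2_dist_le:
  fixes G \<rho> :: "real^'n \<Rightarrow> real"
  assumes G: "integrable lborel G" and \<rho>: "smooth_on UNIV \<rho>" "\<And>x. 0 \<le> \<rho> x" "\<And>x. d \<le> norm x \<Longrightarrow> \<rho> x = 0"
      "integrable lborel \<rho>" "(\<integral>x. \<rho> x \<partial>lborel) = 1"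
    and e: "\<And>y. norm y < d \<Longrightarrow> (\<integral>\<^sup>+x. ennreal ((G (x - y) - G x)\<^sup>2) \<partial>lborel) \<le> ennreal e" and "0 \<le> e"
  shows "(\<integral>\<^sup>+x. ennreal ((conv G \<rho> x - G x)\<^sup>2) \<partial>lborel) \<le> ennreal e"
proof -
  have [measurable]: "G \<in> borel_measurable borel" "\<rho> \<in> borel_measurable borel" using G \<rho> by auto
  have c\<rho>: "continuous_on UNIV \<rho>" using C1_gradD(3)[OF smooth_C1_grad[OF \<rho>(1)]] .
  have ev: "conv G \<rho> x = (\<integral>y. G (x - y) * \<rho> y \<partial>lborel)" "integrable lborel (\<lambda>y. G (x - y) * \<rho> y)" for x
  proof -
    have *: "(\<lambda>y. G y * \<rho> (x - y)) \<in> borel_measurable borel" by measurable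
    show "conv G \<rho> x = (\<integral>y. G (x - y) * \<rho> y \<partial>lborel)"
      using integral_reflect(1)[OF *, of x] by (simp add: conv_def)
    have "d < norm z \<Longrightarrow> \<rho> z = 0" for z using \<rho>(3) by simp
    from integrable_conv[OF G c\<rho> this, where x=x]
    show "integrable lborel (\<lambda>y. G (x - y) * \<rho> y)"
      using integral_reflect(2)[OF *, of x] by simp
  qed
  have "ennreal ((conv G \<rho> x - G x)\<^sup>2) \<le> (\<integral>\<^sup>+y. ennreal ((G (x - y) - G x)\<^sup>2 * \<rho> y) \<partial>lborel)" for x
  proof -
    have i: "integrable lborel (\<lambda>y. (G (x - y) - G x) * \<rho> y)"
      using ev(2)[of x] \<rho>(4) by (simp add: left_diff_distrib)
    have "conv G \<rho> x - G x = (\<integral>y. (G (x - y) - G x) * \<rho> y \<partial>lborel)"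
      using ev[of x] \<rho>(4,5) by (simp add: left_diff_distrib)
    then show ?thesis
      using weighted_mean_square_le[OF _ \<rho>(4,2,5) i] by simp
  qed
  then have "(\<integral>\<^sup>+x. ennreal ((conv G \<rho> x - G x)\<^sup>2) \<partial>lborel)
     \<le> (\<integral>\<^sup>+x. (\<integral>\<^sup>+y. ennreal ((G (x - y) - G x)\<^sup>2 * \<rho> y) \<partial>lborel) \<partial>lborel)"
    by (intro nn_integral_mono) auto
  also have "\<dots> = (\<integral>\<^sup>+y. (\<integral>\<^sup>+x. ennreal ((G (x - y) - G x)\<^sup>2 * \<rho> y) \<partial>lborel) \<partial>lborel)"
    by (rule lborel_pair.Fubini') measurable
  also have "\<dots> \<le> (\<integral>\<^sup>+y. ennreal e * ennreal (\<rho> y) \<partial>lborel)"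
  proof (rule nn_integral_mono)
    fix y
    have "(\<integral>\<^sup>+x. ennreal ((G (x - y) - G x)\<^sup>2 * \<rho> y) \<partial>lborel) = (\<integral>\<^sup>+x. ennreal ((G (x - y) - G x)\<^sup>2) \<partial>lborel) * ennreal (\<rho> y)"
      using \<rho>(2) by (subst nn_integral_multc[symmetric]) (auto simp: ennreal_mult)
    also have "\<dots> \<le> ennreal e * ennreal (\<rho> y)"
      using e[of y] \<rho>(3)[of y] by (cases "norm y < d") (auto intro: mult_right_mono)
    finally show "(\<integral>\<^sup>+x. ennreal ((G (x - y) - G x)\<^sup>2 * \<rho> y) \<partial>lborel) \<le> ennreal e * ennreal (\<rho> y)" .
  qed
  also have "\<dots> = ennreal e"
    using nn_integral_eq_integral[OF \<rho>(4)] \<rho>(2,5) by (simp add: nn_integral_cmult)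
  finally show ?thesis .
qed

lemma Ck_on_reflect: "Ck_on k UNIV f \<Longrightarrow> Ck_on k UNIV (\<lambda>y. f (x - y))" for x :: "real^'n"
proof (induction k arbitrary: f)
  case 0
  then show ?case by (auto intro!: continuous_intros elim!: continuous_on_compose2)
next
  case (Suc k)
  have D: "((\<lambda>y. f (x - y)) has_derivative (\<lambda>h. - (classical_grad f (x - y) \<bullet> h))) (at y)" for y
  proof -
    have "((\<lambda>y. x - y) has_derivative (\<lambda>h. - h)) (at y)" by (auto intro!: derivative_eq_intros)
    moreover have "(f has_derivative (\<lambda>h. classical_grad f (x - y) \<bullet> h)) (at (x - y))"
      using Suc(2) by (intro has_derivative_partial) auto
    ultimately show ?thesis using has_derivative_compose by fastforce
  qed
  have "partial_deriv i (\<lambda>y. f (x - y)) = (\<lambda>y. (-1) * partial_deriv i f (x - y))" for i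
    by (rule ext) (simp add: partial_deriv_eqI[OF D] inner_axis classical_grad_def)
  moreover have "Ck_on k UNIV (\<lambda>y. (-1) * partial_deriv i f (x - y))" for i
    using Suc(2) by (intro Ck_on_mult Ck_on_const Suc.IH) auto
  moreover have "(\<lambda>y. f (x - y)) differentiable (at y)" for y
    by (rule differentiableI[OF D])
  moreover have "continuous_on UNIV (\<lambda>y. f (x - y))"
    using Suc(2) by (auto intro!: continuous_intros elim!: continuous_on_compose2)
  ultimately show ?case by simp
qed

lemma partial_deriv_reflect:
  assumes "smooth_on UNIV f"
  shows "partial_deriv i (\<lambda>y. f (x - y)) y = - partial_deriv i f (x - y)"
proof -
  have "((\<lambda>y. x - y) has_derivative (\<lambda>h. - h)) (at y)" by (auto intro!: derivative_eq_intros)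
  then have "((\<lambda>y. f (x - y)) has_derivative (\<lambda>h. - (classical_grad f (x - y) \<bullet> h))) (at y)"
    using has_derivative_compose[OF _ C1_gradD(1)[OF smooth_C1_grad[OF assms]], of "\<lambda>y. x - y" "\<lambda>h. - h" y UNIV]
    by simp
  from partial_deriv_eqI[OF this] show ?thesis by (simp add: inner_axis classical_grad_def)
qed

lemma lebesgue_on_integral_eq_lborel:
  fixes f :: "'a::euclidean_space \<Rightarrow> real"
  assumes "S \<in> sets lebesgue" "(\<lambda>x. indicator S x * f x) \<in> borel_measurable borel"
  shows "(\<integral>x. f x \<partial>lebesgue_on S) = (\<integral>x. indicator S x * f x \<partial>lborel)"
  using assms by (subst integral_restrict_space) (auto simp: integral_completion)

text \<open>The reflected kernel \<open>\<lambda>y. \<rho> (x - y)\<close> serves as test function;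
  its derivative contributes the sign that cancels the one in the definition of a weak gradient.
  Restricting \<open>u\<close> and \<open>g\<close> to \<open>K\<close> changes nothing at
  \<open>x\<close>, since the kernel only sees \<open>cball x d\<close>.\<close>

lemma weak_gradient_conv:
  fixes u \<rho> :: "real^'n \<Rightarrow> real"
  assumes wg: "has_weak_gradient \<Omega> u g" and \<Omega>: "open \<Omega>"
    and [measurable]: "U \<in> borel_measurable borel" "g \<in> borel_measurable borel"
    and \<rho>: "smooth_on UNIV \<rho>" "\<And>x. d < norm x \<Longrightarrow> \<rho> x = 0"
    and sub: "cball x d \<subseteq> K" "K \<subseteq> \<Omega>" "closed K" and U: "\<And>y. U y = indicator K y * u y"
  shows "conv U (partial_deriv i \<rho>) x = conv (\<lambda>y. g y $ i * indicator K y) \<rho> x"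
proof -
  have [measurable]: "\<rho> \<in> borel_measurable borel"
    using C1_grad_borel(1)[OF smooth_C1_grad[OF \<rho>(1)]] .
  have [measurable]: "partial_deriv i \<rho> \<in> borel_measurable borel"
    using C1_grad_borel(1)[OF smooth_C1_grad[OF smooth_on_partial_deriv[OF \<rho>(1)]]] .
  have [measurable]: "\<Omega> \<in> sets borel" "K \<in> sets borel" using \<Omega> sub by auto
  let ?\<psi> = "\<lambda>y. \<rho> (x - y)"
  have sm: "smooth_on UNIV ?\<psi>" using \<rho>(1) by (auto simp: smooth_on_def intro: Ck_on_reflect)
  have cl: "closure {y. ?\<psi> y \<noteq> 0} \<subseteq> cball x d"
  proof (rule closure_minimal)
    show "{y. ?\<psi> y \<noteq> 0} \<subseteq> cball x d"
      using \<rho>(2) by (force simp: dist_norm not_less[symmetric])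
  qed simp
  have "bounded {y. ?\<psi> y \<noteq> 0}"
    by (rule bounded_subset[OF bounded_cball subset_trans[OF closure_subset cl]])
  then have "test_fun \<Omega> ?\<psi>"
    unfolding test_fun_def using sm cl sub(1,2) by (auto simp: compact_closure)
  then have "(\<integral>y. u y * partial_deriv i ?\<psi> y \<partial>lebesgue_on \<Omega>) = - (\<integral>y. g y $ i * ?\<psi> y \<partial>lebesgue_on \<Omega>)"
    using wg by (simp add: has_weak_gradient_def)
  moreover have "(\<integral>y. u y * partial_deriv i ?\<psi> y \<partial>lebesgue_on \<Omega>) = - conv U (partial_deriv i \<rho>) x"
  proof -
    have eq: "indicator \<Omega> y * (u y * partial_deriv i ?\<psi> y) = - (U y * partial_deriv i \<rho> (x - y))" for y
    proof (cases "y \<in> cball x d")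
      case True
      then have "y \<in> K" "y \<in> \<Omega>" using sub by auto
      then show ?thesis by (simp add: U partial_deriv_reflect[OF \<rho>(1)])
    next
      case False
      then have "partial_deriv i \<rho> (x - y) = 0"
        using C1_grad_bounded_support[OF smooth_C1_grad[OF \<rho>(1)] \<rho>(2), where x="x - y"]
        by (simp add: classical_grad_def vec_eq_iff dist_norm)
      then show ?thesis by (simp add: partial_deriv_reflect[OF \<rho>(1)])
    qed
    then show ?thesis
      by (subst lebesgue_on_integral_eq_lborel) (simp_all add: eq conv_def)
  qed
  moreover have "(\<integral>y. g y $ i * ?\<psi> y \<partial>lebesgue_on \<Omega>) = conv (\<lambda>y. g y $ i * indicator K y) \<rho> x"
  proof -
    have eq: "indicator \<Omega> y * (g y $ i * ?\<psi> y) = (g y $ i * indicator K y) * \<rho> (x - y)" for y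
    proof (cases "y \<in> cball x d")
      case True then show ?thesis using sub by (auto simp: indicator_def)
    next
      case False
      then have "\<rho> (x - y) = 0" using \<rho>(2) by (simp add: dist_norm)
      then show ?thesis by simp
    qed
    then show ?thesis
      by (subst lebesgue_on_integral_eq_lborel) (simp_all add: eq conv_def)
  qed
  ultimately show ?thesis by simp
qed

text \<open>Mollification gives uniform closeness from the continuity of \<open>u\<close>, and
  \<open>L^2\<close> closeness of gradients from the continuity of translations. The last conclusion
  controls the support: it later keeps the approximants of functions that vanish near a sphere
  inside the ball.\<close>

lemma weak_gradient_smooth_approx:
  fixes u :: "real^'n \<Rightarrow> real"
  assumes wg: "has_weak_gradient \<Omega> u g" and \<Omega>: "open \<Omega>" and u: "continuous_on \<Omega> u"
    and g[measurable]: "g \<in> borel_measurable borel" and g2: "(\<integral>\<^sup>+x\<in>\<Omega>. ennreal ((norm (g x))\<^sup>2) \<partial>lborel) < \<infinity>"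
    and K: "compact K" "K \<subseteq> \<Omega>" and e: "0 < e"
  obtains \<phi> where "smooth_on UNIV \<phi>" "\<And>x. x \<in> K \<Longrightarrow> \<bar>\<phi> x - u x\<bar> \<le> e"
    "(\<integral>\<^sup>+x\<in>K. ennreal ((norm (classical_grad \<phi> x - g x))\<^sup>2) \<partial>lborel) \<le> ennreal e"
    "\<And>x. \<phi> x \<noteq> 0 \<Longrightarrow> \<exists>y\<in>\<Omega>. u y \<noteq> 0 \<and> dist x y < e"
proof (cases "K = {}")
  case True
  have "classical_grad (\<lambda>x::real^'n. 0) = (\<lambda>x. 0)"
    by (rule C1_grad_unique) (simp add: C1_grad_def)
  with True that[of "\<lambda>x. 0"] show ?thesis by (simp add: smooth_on_def Ck_on_const)
next
  case False
  \<comment> \<open>Room between \<open>K\<close> and the complement of \<open>\<Omega>\<close>: on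
    \<open>K\<close>, mollification at a scale of at most \<open>d0\<close> involves only values on
    the larger compact set \<open>K'\<close>.\<close>
  obtain d0 where d0: "0 < d0" "{x. infdist x K \<le> d0} \<subseteq> \<Omega>"
    using compact_in_open_separated[OF False K(1) \<Omega> K(2)] by blast
  define K' where "K' = {x. infdist x K \<le> d0}"
  have K': "compact K'" "K' \<subseteq> \<Omega>"
    using compact_infdist_le[OF False K(1) d0(1)] d0(2) by (auto simp: K'_def)
  have nbhd: "cball x d0 \<subseteq> K'" if "x \<in> K" for x
    using that infdist_le[OF that] by (force simp: K'_def dist_commute intro: order_trans)
  have [measurable]: "K' \<in> sets borel" "K \<in> sets borel" "\<Omega> \<in> sets borel" using K' K \<Omega> by (auto intro: borel_compact)
  define U where "U = (\<lambda>x. indicator K' x * u x)"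
  have U: "integrable lborel U"
    unfolding U_def using borel_integrable_compact[OF K'(1) continuous_on_subset[OF u K'(2)]] by simp
  define G where "G = (\<lambda>i x. g x $ i * indicator K' x)"
  have [measurable]: "G i \<in> borel_measurable borel" for i unfolding G_def by measurable
  have G2: "(\<integral>\<^sup>+x. ennreal ((G i x)\<^sup>2) \<partial>lborel) < \<infinity>" for i
  proof (rule le_less_trans[OF nn_integral_mono g2])
    fix x
    have "(g x $ i)\<^sup>2 \<le> (norm (g x))\<^sup>2"
      using component_le_norm_cart[of "g x" i] by (simp add: abs_le_square_iff[symmetric])
    then show "ennreal ((G i x)\<^sup>2) \<le> ennreal ((norm (g x))\<^sup>2) * indicator \<Omega> x"
      using K'(2) by (auto simp: G_def indicator_def intro!: ennreal_leI)
  qed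
  have G1: "integrable lborel (G i)" for i
  proof -
    have "(\<integral>\<^sup>+x\<in>K'. ennreal ((G i x)\<^sup>2) \<partial>lborel) < \<infinity>"
      by (rule le_less_trans[OF nn_integral_mono G2[of i]]) (auto simp: indicator_def)
    then have "integrable lborel (\<lambda>x. indicator K' x * G i x)"
      by (intro integrable_of_L2 compact_imp_bounded[OF K'(1)]) measurable
    moreover have "(\<lambda>x. indicator K' x * G i x) = G i" by (auto simp: G_def indicator_def)
    ultimately show ?thesis by simp
  qed
  obtain d1 where d1: "0 < d1" "\<And>x y. x \<in> K' \<Longrightarrow> y \<in> K' \<Longrightarrow> dist y x < d1 \<Longrightarrow> \<bar>u y - u x\<bar> < e"
    using compact_uniformly_continuous[OF continuous_on_subset[OF u K'(2)] K'(1)] e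
    unfolding uniformly_continuous_on_def dist_real_def by metis
  \<comment> \<open>The squared gradient error is a sum over coordinates, and each receives an equal
    share of \<open>e\<close>.\<close>
  define \<eta> where "\<eta> = e / real CARD('n)"
  have \<eta>: "0 < \<eta>" using e by (simp add: \<eta>_def)
  have "\<exists>d>0. \<forall>y. norm y < d \<longrightarrow> (\<integral>\<^sup>+x. ennreal ((G i (x - y) - G i x)\<^sup>2) \<partial>lborel) \<le> ennreal \<eta>" for i
    using L2_translation_continuous[OF _ G2 \<eta>, of i] by (metis \<open>\<And>i. G i \<in> borel_measurable borel\<close>)
  then obtain d2 where d2: "\<And>i. 0 < d2 i"
    "\<And>i y. norm y < d2 i \<Longrightarrow> (\<integral>\<^sup>+x. ennreal ((G i (x - y) - G i x)\<^sup>2) \<partial>lborel) \<le> ennreal \<eta>"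
    by metis
  define d where "d = Min ({d0, d1, e} \<union> range d2)"
  have d: "0 < d" "d \<le> d0" "d \<le> d1" "d \<le> e" "d \<le> d2 i" for i
    using d0(1) d1(1) d2(1) e Min_le[of "{d0, d1, e} \<union> range d2"] unfolding d_def
    by (auto simp: Min_gr_iff simp del: Min_insert)
  obtain \<rho> :: "real^'n \<Rightarrow> real" where \<rho>: "smooth_on UNIV \<rho>" "\<And>x. 0 \<le> \<rho> x" "\<And>x. d \<le> norm x \<Longrightarrow> \<rho> x = 0"
      "integrable lborel \<rho>" "(\<integral>x. \<rho> x \<partial>lborel) = 1"
    using mollifier_exists[OF d(1)] by blast
  have supp: "\<And>x. d < norm x \<Longrightarrow> \<rho> x = 0" using \<rho>(3) by simp
  have [measurable]: "\<rho> \<in> borel_measurable borel" using \<rho>(4) by auto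
  define \<phi> where "\<phi> = conv U \<rho>"
  have c\<rho>: "continuous_on UNIV \<rho>" using C1_gradD(3)[OF smooth_C1_grad[OF \<rho>(1)]] .
  show ?thesis
  proof (rule that[of \<phi>])
    show "smooth_on UNIV \<phi>" unfolding \<phi>_def by (rule smooth_conv[OF U \<rho>(1) supp])
  next
    fix x assume x: "x \<in> K"
    have I: "integrable lborel (\<lambda>y. U y * \<rho> (x - y))"
      by (rule integrable_conv[OF U c\<rho> supp])
    have I1: "integrable lborel (\<lambda>y. \<rho> (x - y))" "(\<integral>y. \<rho> (x - y) \<partial>lborel) = 1"
      using integral_reflect[of \<rho> x] \<rho> by auto
    have xK: "x \<in> K'" using nbhd[OF x] d0(1) by auto
    have "\<phi> x - u x = (\<integral>y. (U y - u x) * \<rho> (x - y) \<partial>lborel)"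
      unfolding \<phi>_def conv_def left_diff_distrib using I I1 by simp
    also have "\<bar>\<dots>\<bar> \<le> (\<integral>y. e * \<rho> (x - y) \<partial>lborel)"
    proof (rule Bochner_Integration.integral_abs_bound_integral)
      show "integrable lborel (\<lambda>y. (U y - u x) * \<rho> (x - y))"
        unfolding left_diff_distrib using I I1 by simp
      show "\<bar>(U y - u x) * \<rho> (x - y)\<bar> \<le> e * \<rho> (x - y)" for y
      proof (cases "norm (x - y) < d")
        case True
        then have "y \<in> K'" using nbhd[OF x] d(2) by (auto simp: dist_norm)
        then have "\<bar>U y - u x\<bar> < e"
          using d1(2)[OF xK, of y] True d(3) by (simp add: U_def dist_norm norm_minus_commute)
        then show ?thesis using \<rho>(2)[of "x - y"] by (simp add: abs_mult mult_right_mono)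
      next
        case False then show ?thesis using \<rho>(3)[of "x - y"] by simp
      qed
    qed (use I1 in auto)
    also have "\<dots> = e" using I1 by simp
    finally show "\<bar>\<phi> x - u x\<bar> \<le> e" .
  next
    have gr: "(norm (classical_grad \<phi> x - g x))\<^sup>2 = (\<Sum>i\<in>UNIV. (conv (G i) \<rho> x - G i x)\<^sup>2)" if x: "x \<in> K" for x
    proof -
      have cb: "cball x d \<subseteq> K'" using nbhd[OF x] d(2) by force
      then have xK: "x \<in> K'" using d(1) by auto
      have eq: "partial_deriv i (conv U \<rho>) = conv U (partial_deriv i \<rho>)" for i
        by (rule partial_deriv_conv[OF U \<rho>(1) supp])
      have "classical_grad \<phi> x $ i = conv (G i) \<rho> x" for i
        unfolding classical_grad_def \<phi>_def vec_lambda_beta eq G_def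
        by (rule weak_gradient_conv[OF wg \<Omega> _ g \<rho>(1) supp cb K'(2) compact_imp_closed[OF K'(1)]])
           (use U in \<open>auto simp: U_def\<close>)
      then show ?thesis using xK
        by (simp add: norm_vec_def L2_set_def G_def sum_nonneg)
    qed
    have "(\<integral>\<^sup>+x\<in>K. ennreal ((norm (classical_grad \<phi> x - g x))\<^sup>2) \<partial>lborel)
      \<le> (\<integral>\<^sup>+x. (\<Sum>i\<in>UNIV. ennreal ((conv (G i) \<rho> x - G i x)\<^sup>2)) \<partial>lborel)"
      by (rule nn_integral_mono) (auto simp: gr indicator_def)
    also have "\<dots> = (\<Sum>i\<in>UNIV. (\<integral>\<^sup>+x. ennreal ((conv (G i) \<rho> x - G i x)\<^sup>2) \<partial>lborel))"
    proof (rule nn_integral_sum)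
      fix i
      have "conv (G i) \<rho> \<in> borel_measurable borel"
        using C1_grad_borel(1)[OF smooth_C1_grad[OF smooth_conv[OF G1 \<rho>(1) supp]]] .
      then show "(\<lambda>x. ennreal ((conv (G i) \<rho> x - G i x)\<^sup>2)) \<in> borel_measurable lborel" by measurable
    qed
    also have "\<dots> \<le> (\<Sum>i\<in>(UNIV::'n set). ennreal \<eta>)"
      using d \<eta> d2(2) by (intro sum_mono conv_L2_dist_le[OF G1 \<rho>]) (auto intro: less_le_trans)
    also have "\<dots> = ennreal e" using \<eta> e by (simp add: \<eta>_def ennreal_of_nat_eq_real_of_nat ennreal_mult[symmetric])
    finally show "(\<integral>\<^sup>+x\<in>K. ennreal ((norm (classical_grad \<phi> x - g x))\<^sup>2) \<partial>lborel) \<le> ennreal e" .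
  next
    fix x assume nz: "\<phi> x \<noteq> 0"
    show "\<exists>y\<in>\<Omega>. u y \<noteq> 0 \<and> dist x y < e"
    proof (rule ccontr)
      assume n: "\<not> (\<exists>y\<in>\<Omega>. u y \<noteq> 0 \<and> dist x y < e)"
      have "U y * \<rho> (x - y) = 0" for y
        using n K'(2) \<rho>(3)[of "x - y"] d(4) by (force simp: U_def indicator_def dist_norm not_less)
      then have "(\<lambda>y. U y * \<rho> (x - y)) = (\<lambda>y. 0)" by blast
      then have "\<phi> x = 0" by (simp only: \<phi>_def conv_def Bochner_Integration.integral_zero)
      with nz show False by simp
    qed
  qed
qed

section \<open>Functions locally approximated by \<open>C\<^sup>1\<close> functions\<close>

text \<open>Stands in for membership in \<open>H\<^sup>1\<close>. Uniform convergence of the functions, available because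
  minimizers are continuous, makes the chain rule for \<open>C\<^sup>1\<close> truncations immediate.\<close>

definition C1_approx :: "(real^'n) set \<Rightarrow> (real^'n \<Rightarrow> real) \<Rightarrow> (real^'n \<Rightarrow> real^'n) \<Rightarrow> bool" where
  "C1_approx K w g \<longleftrightarrow> (\<forall>e>0. \<exists>\<phi> D. C1_grad \<phi> D \<and> (\<forall>x\<in>K. \<bar>\<phi> x - w x\<bar> \<le> e) \<and>
     (\<integral>\<^sup>+x\<in>K. ennreal ((norm (D x - g x))\<^sup>2) \<partial>lborel) \<le> ennreal e)"

lemma C1_approxE:
  assumes "C1_approx K w g" "0 < e"
  obtains \<phi> D where "C1_grad \<phi> D" "\<And>x. x \<in> K \<Longrightarrow> \<bar>\<phi> x - w x\<bar> \<le> e"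
    "(\<integral>\<^sup>+x\<in>K. ennreal ((norm (D x - g x))\<^sup>2) \<partial>lborel) \<le> ennreal e"
  using assms unfolding C1_approx_def by blast

lemma norm_add_square_le: "(norm (a + b))\<^sup>2 \<le> 2 * (norm a)\<^sup>2 + 2 * (norm b)\<^sup>2"
  for a b :: "'a::real_normed_vector"
  by (rule order_trans[OF power_mono[OF norm_triangle_ineq] power2_add_le]) simp

lemma nn_integral_on_le_lin:
  assumes "\<And>x. x \<in> K \<Longrightarrow> f x \<le> a * p x + b * q x" and nn: "0 \<le> a" "0 \<le> b" "\<And>x. 0 \<le> p x" "\<And>x. 0 \<le> q x"
    and [measurable]: "p \<in> borel_measurable M" "q \<in> borel_measurable M" "K \<in> sets M"
  shows "(\<integral>\<^sup>+x\<in>K. ennreal (f x) \<partial>M) \<le> ennreal a * (\<integral>\<^sup>+x\<in>K. ennreal (p x) \<partial>M) + ennreal b * (\<integral>\<^sup>+x\<in>K. ennreal (q x) \<partial>M)"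
proof -
  have "(\<integral>\<^sup>+x\<in>K. ennreal (f x) \<partial>M)
    \<le> (\<integral>\<^sup>+x. ennreal a * (ennreal (p x) * indicator K x) + ennreal b * (ennreal (q x) * indicator K x) \<partial>M)"
  proof (rule nn_integral_mono)
    fix x
    have "ennreal (f x) \<le> ennreal a * ennreal (p x) + ennreal b * ennreal (q x)" if "x \<in> K"
      using ennreal_leI[OF assms(1)[OF that]] nn by (simp add: ennreal_mult)
    then show "ennreal (f x) * indicator K x
      \<le> ennreal a * (ennreal (p x) * indicator K x) + ennreal b * (ennreal (q x) * indicator K x)"
      by (auto simp: indicator_def)
  qed
  also have "\<dots> = ennreal a * (\<integral>\<^sup>+x\<in>K. ennreal (p x) \<partial>M) + ennreal b * (\<integral>\<^sup>+x\<in>K. ennreal (q x) \<partial>M)"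
    by (simp add: nn_integral_add nn_integral_cmult)
  finally show ?thesis .
qed

lemma C1_grad_compose:
  assumes f: "C1_grad f D" and F: "\<And>t. (F has_real_derivative F' t) (at t)" "continuous_on UNIV F'"
  shows "C1_grad (\<lambda>x. F (f x)) (\<lambda>x. F' (f x) *\<^sub>R D x)"
  unfolding C1_grad_def
proof
  show "\<forall>x. ((\<lambda>x. F (f x)) has_derivative (\<lambda>h. (F' (f x) *\<^sub>R D x) \<bullet> h)) (at x)"
  proof
    fix x
    have "(F has_derivative (\<lambda>h. h * F' (f x))) (at (f x))"
      using F(1) by (simp add: has_field_derivative_def mult_commute_abs)
    from has_derivative_compose[OF C1_gradD(1)[OF f] this]
    show "((\<lambda>x. F (f x)) has_derivative (\<lambda>h. (F' (f x) *\<^sub>R D x) \<bullet> h)) (at x)"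
      by (simp add: mult.commute)
  qed
  show "continuous_on UNIV (\<lambda>x. F' (f x) *\<^sub>R D x)"
    by (intro continuous_intros C1_gradD[OF f] continuous_on_compose2[OF F(2)]) auto
qed

lemma C1_grad_mult:
  assumes f: "C1_grad f D" and g: "C1_grad g E"
  shows "C1_grad (\<lambda>x. f x * g x) (\<lambda>x. f x *\<^sub>R E x + g x *\<^sub>R D x)"
  unfolding C1_grad_def
proof
  show "\<forall>x. ((\<lambda>x. f x * g x) has_derivative (\<lambda>h. (f x *\<^sub>R E x + g x *\<^sub>R D x) \<bullet> h)) (at x)"
  proof
    fix x
    show "((\<lambda>x. f x * g x) has_derivative (\<lambda>h. (f x *\<^sub>R E x + g x *\<^sub>R D x) \<bullet> h)) (at x)"
      using has_derivative_mult[OF C1_gradD(1)[OF f, of x] C1_gradD(1)[OF g, of x]]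
      by (simp add: inner_add_left mult.commute)
  qed
  show "continuous_on UNIV (\<lambda>x. f x *\<^sub>R E x + g x *\<^sub>R D x)"
    by (intro continuous_intros C1_gradD[OF f] C1_gradD[OF g])
qed

lemma C1_approx_compose:
  assumes w: "C1_approx K w g" and K: "compact K" and wc: "continuous_on K w"
    and g[measurable]: "g \<in> borel_measurable borel" and g2: "(\<integral>\<^sup>+x\<in>K. ennreal ((norm (g x))\<^sup>2) \<partial>lborel) < \<infinity>"
    and F: "\<And>t. (F has_real_derivative F' t) (at t)" "continuous_on UNIV F'"
  shows "C1_approx K (\<lambda>x. F (w x)) (\<lambda>x. F' (w x) *\<^sub>R g x)"
  unfolding C1_approx_def
proof (intro allI impI)
  fix e :: real assume e: "0 < e"
  have [measurable]: "K \<in> sets borel" using K by (rule borel_compact)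
  have Fc: "continuous_on UNIV F" using F(1) DERIV_continuous_on by blast
  obtain B where B: "\<And>x. x \<in> K \<Longrightarrow> \<bar>w x\<bar> \<le> B"
    using compact_imp_bounded[OF compact_continuous_image[OF wc K]] unfolding bounded_iff by auto
  define I where "I = cball (0::real) (B + 1)"
  have I: "compact I" by (simp add: I_def)
  obtain C where C: "C > 0" "\<And>t. t \<in> I \<Longrightarrow> \<bar>F' t\<bar> \<le> C"
    using compact_imp_bounded[OF compact_continuous_image[OF continuous_on_subset[OF F(2)] I]]
    unfolding bounded_pos by auto
  define E where "E = enn2real (\<integral>\<^sup>+x\<in>K. ennreal ((norm (g x))\<^sup>2) \<partial>lborel)"
  have E: "0 \<le> E" "(\<integral>\<^sup>+x\<in>K. ennreal ((norm (g x))\<^sup>2) \<partial>lborel) = ennreal E"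
    using g2 by (simp_all add: E_def)
  \<comment> \<open>\<open>\<eta>\<close> bounds the oscillation of \<open>F'\<close> between
    \<open>\<phi>\<close> and \<open>w\<close>, which multiplies the fixed energy \<open>E\<close>;
    the summand \<open>1\<close> covers the case \<open>E = 0\<close>.\<close>
  define \<eta> where "\<eta> = sqrt (e / (4 * (E + 1)))"
  have \<eta>: "0 < \<eta>" "2 * \<eta>\<^sup>2 * E \<le> e / 2"
  proof -
    show "0 < \<eta>" using e E by (auto simp: \<eta>_def intro!: divide_pos_pos)
    have "2 * \<eta>\<^sup>2 * E = e / 2 * (E / (E + 1))"
      using e E by (simp add: \<eta>_def divide_simps)
    also have "\<dots> \<le> e / 2 * 1" using e E by (intro mult_left_mono) auto
    finally show "2 * \<eta>\<^sup>2 * E \<le> e / 2" by simp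
  qed
  obtain d1 where d1: "0 < d1" "\<And>s t. s \<in> I \<Longrightarrow> t \<in> I \<Longrightarrow> \<bar>s - t\<bar> < d1 \<Longrightarrow> \<bar>F' s - F' t\<bar> < \<eta>"
    using compact_uniformly_continuous[OF continuous_on_subset[OF F(2)] I] \<eta>(1)
    unfolding uniformly_continuous_on_def dist_real_def by (metis subset_UNIV)
  obtain d2 where d2: "0 < d2" "\<And>s t. s \<in> I \<Longrightarrow> t \<in> I \<Longrightarrow> \<bar>s - t\<bar> < d2 \<Longrightarrow> \<bar>F s - F t\<bar> < e"
    using compact_uniformly_continuous[OF continuous_on_subset[OF Fc] I] e
    unfolding uniformly_continuous_on_def dist_real_def by (metis subset_UNIV)
  define e1 where "e1 = min (min 1 (e / (4 * C\<^sup>2))) (min (d1 / 2) (d2 / 2))"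
  have e1: "0 < e1" "e1 \<le> 1" "e1 < d1" "e1 < d2" "2 * C\<^sup>2 * e1 \<le> e / 2"
  proof -
    have "e1 \<le> e / (4 * C\<^sup>2)" by (simp add: e1_def)
    then have "2 * C\<^sup>2 * e1 \<le> 2 * C\<^sup>2 * (e / (4 * C\<^sup>2))" by (intro mult_left_mono) auto
    also have "\<dots> = e / 2" using C(1) by (simp add: field_simps)
    finally show "2 * C\<^sup>2 * e1 \<le> e / 2" .
  qed (use e C d1 d2 in \<open>auto simp: e1_def\<close>)
  obtain \<phi> D where \<phi>: "C1_grad \<phi> D" "\<And>x. x \<in> K \<Longrightarrow> \<bar>\<phi> x - w x\<bar> \<le> e1"
    "(\<integral>\<^sup>+x\<in>K. ennreal ((norm (D x - g x))\<^sup>2) \<partial>lborel) \<le> ennreal e1"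
    using C1_approxE[OF w e1(1)] by blast
  note [measurable] = C1_grad_borel[OF \<phi>(1)]
  have inI: "w x \<in> I" "\<phi> x \<in> I" if "x \<in> K" for x
    using B[OF that] \<phi>(2)[OF that] e1(2) by (auto simp: I_def)
  show "\<exists>\<phi> D. C1_grad \<phi> D \<and> (\<forall>x\<in>K. \<bar>\<phi> x - F (w x)\<bar> \<le> e) \<and>
     (\<integral>\<^sup>+x\<in>K. ennreal ((norm (D x - F' (w x) *\<^sub>R g x))\<^sup>2) \<partial>lborel) \<le> ennreal e"
  proof (intro exI conjI ballI)
    show "C1_grad (\<lambda>x. F (\<phi> x)) (\<lambda>x. F' (\<phi> x) *\<^sub>R D x)"
      by (rule C1_grad_compose[OF \<phi>(1) F])
    show "\<bar>F (\<phi> x) - F (w x)\<bar> \<le> e" if "x \<in> K" for x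
      using d2(2)[OF inI(2,1)[OF that]] \<phi>(2)[OF that] e1(4) by linarith
    have "(\<integral>\<^sup>+x\<in>K. ennreal ((norm (F' (\<phi> x) *\<^sub>R D x - F' (w x) *\<^sub>R g x))\<^sup>2) \<partial>lborel)
      \<le> ennreal (2 * C\<^sup>2) * (\<integral>\<^sup>+x\<in>K. ennreal ((norm (D x - g x))\<^sup>2) \<partial>lborel)
        + ennreal (2 * \<eta>\<^sup>2) * (\<integral>\<^sup>+x\<in>K. ennreal ((norm (g x))\<^sup>2) \<partial>lborel)"
    proof (rule nn_integral_on_le_lin)
      fix x assume x: "x \<in> K"
      \<comment> \<open>The first summand is small by the \<open>L^2\<close> closeness of the
        gradients, the second by the uniform closeness of \<open>\<phi>\<close> to \<open>w\<close>.
        With only \<open>L^2\<close> closeness of the functions, the second would call for an almost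
        everywhere convergent subsequence.\<close>
      have "F' (\<phi> x) *\<^sub>R D x - F' (w x) *\<^sub>R g x = F' (\<phi> x) *\<^sub>R (D x - g x) + (F' (\<phi> x) - F' (w x)) *\<^sub>R g x"
        by (simp add: algebra_simps)
      also have "(norm \<dots>)\<^sup>2 \<le> 2 * (norm (F' (\<phi> x) *\<^sub>R (D x - g x)))\<^sup>2 + 2 * (norm ((F' (\<phi> x) - F' (w x)) *\<^sub>R g x))\<^sup>2"
        by (rule norm_add_square_le)
      also have "\<dots> = 2 * \<bar>F' (\<phi> x)\<bar>\<^sup>2 * (norm (D x - g x))\<^sup>2 + 2 * \<bar>F' (\<phi> x) - F' (w x)\<bar>\<^sup>2 * (norm (g x))\<^sup>2"
        by (simp add: power_mult_distrib)
      also have "\<dots> \<le> 2 * C\<^sup>2 * (norm (D x - g x))\<^sup>2 + 2 * \<eta>\<^sup>2 * (norm (g x))\<^sup>2"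
        using C(2)[OF inI(2)[OF x]] d1(2)[OF inI(2,1)[OF x]] \<phi>(2)[OF x] e1(3)
        by (intro add_mono mult_right_mono mult_left_mono power_mono) auto
      finally show "(norm (F' (\<phi> x) *\<^sub>R D x - F' (w x) *\<^sub>R g x))\<^sup>2
         \<le> 2 * C\<^sup>2 * (norm (D x - g x))\<^sup>2 + 2 * \<eta>\<^sup>2 * (norm (g x))\<^sup>2" .
    qed auto
    also have "\<dots> \<le> ennreal (2 * C\<^sup>2) * ennreal e1 + ennreal (2 * \<eta>\<^sup>2) * ennreal E"
      unfolding E(2) by (intro add_mono mult_left_mono \<phi>(3)) auto
    also have "\<dots> = ennreal (2 * C\<^sup>2 * e1 + 2 * \<eta>\<^sup>2 * E)"
      using e1(1) E(1) by (simp add: ennreal_mult)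
    also have "\<dots> \<le> ennreal e" using e1(5) \<eta>(2) by (intro ennreal_leI) linarith
    finally show "(\<integral>\<^sup>+x\<in>K. ennreal ((norm (F' (\<phi> x) *\<^sub>R D x - F' (w x) *\<^sub>R g x))\<^sup>2) \<partial>lborel) \<le> ennreal e" .
  qed
qed

lemma C1_approx_mult:
  assumes w: "C1_approx K w g" and K: "compact K"
    and g[measurable]: "g \<in> borel_measurable borel" and \<zeta>: "C1_grad \<zeta> Z"
  shows "C1_approx K (\<lambda>x. \<zeta> x * w x) (\<lambda>x. \<zeta> x *\<^sub>R g x + w x *\<^sub>R Z x)"
  unfolding C1_approx_def
proof (intro allI impI)
  fix e :: real assume e: "0 < e"
  have [measurable]: "K \<in> sets borel" using K by (rule borel_compact)
  note [measurable] = C1_grad_borel[OF \<zeta>]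
  obtain B1 where B1: "\<And>x. x \<in> K \<Longrightarrow> \<bar>\<zeta> x\<bar> \<le> B1"
    using compact_imp_bounded[OF compact_continuous_image[OF continuous_on_subset[OF C1_gradD(3)[OF \<zeta>]] K]]
    unfolding bounded_iff by auto
  obtain B2 where B2: "\<And>x. x \<in> K \<Longrightarrow> norm (Z x) \<le> B2"
    using compact_imp_bounded[OF compact_continuous_image[OF continuous_on_subset[OF C1_gradD(2)[OF \<zeta>]] K]]
    unfolding bounded_iff by auto
  define B where "B = max 1 (max B1 B2)"
  have B: "1 \<le> B" "\<And>x. x \<in> K \<Longrightarrow> \<bar>\<zeta> x\<bar> \<le> B" "\<And>x. x \<in> K \<Longrightarrow> norm (Z x) \<le> B"
    using B1 B2 by (fastforce simp: B_def)+
  define m where "m = measure lborel K"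
  have m: "0 \<le> m" "emeasure lborel K = ennreal m"
    unfolding m_def using ennreal_lborel_finite_measure[OF compact_imp_bounded[OF K]] by auto
  \<comment> \<open>The three caps serve \<open>e1^2 \<le> e1\<close>, the uniform error
    \<open>B * e1\<close>, and the gradient error \<open>2 * B^2 * e1 * (1 + m)\<close>.\<close>
  define e1 where "e1 = min (min 1 (e / B)) (e / (2 * B\<^sup>2 * (m + 1)))"
  have e1: "0 < e1" "e1 \<le> 1" "B * e1 \<le> e" "2 * B\<^sup>2 * e1 + 2 * B\<^sup>2 * e1\<^sup>2 * m \<le> e"
  proof -
    show pos: "0 < e1" "e1 \<le> 1" using e B(1) m by (auto simp: e1_def intro!: divide_pos_pos mult_pos_pos)
    have "e1 \<le> e / B" by (simp add: e1_def)
    then show "B * e1 \<le> e" using B(1) by (simp add: field_simps)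
    have "e1 * (2 * B\<^sup>2 * (m + 1)) \<le> e"
    proof -
      have "e1 \<le> e / (2 * B\<^sup>2 * (m + 1))" by (simp add: e1_def)
      moreover have "0 < 2 * B\<^sup>2 * (m + 1)" using B(1) m by (intro mult_pos_pos) auto
      ultimately show ?thesis by (simp add: pos_le_divide_eq)
    qed
    moreover have "e1\<^sup>2 \<le> e1" using pos by (simp add: power2_eq_square mult_left_le_one_le)
    then have "2 * B\<^sup>2 * e1\<^sup>2 * m \<le> 2 * B\<^sup>2 * e1 * m" using m by (intro mult_right_mono mult_left_mono) auto
    ultimately show "2 * B\<^sup>2 * e1 + 2 * B\<^sup>2 * e1\<^sup>2 * m \<le> e" by (simp add: algebra_simps)
  qed
  obtain \<phi> D where \<phi>: "C1_grad \<phi> D" "\<And>x. x \<in> K \<Longrightarrow> \<bar>\<phi> x - w x\<bar> \<le> e1"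
    "(\<integral>\<^sup>+x\<in>K. ennreal ((norm (D x - g x))\<^sup>2) \<partial>lborel) \<le> ennreal e1"
    using C1_approxE[OF w e1(1)] by blast
  note [measurable] = C1_grad_borel[OF \<phi>(1)]
  show "\<exists>\<phi> D. C1_grad \<phi> D \<and> (\<forall>x\<in>K. \<bar>\<phi> x - \<zeta> x * w x\<bar> \<le> e) \<and>
     (\<integral>\<^sup>+x\<in>K. ennreal ((norm (D x - (\<zeta> x *\<^sub>R g x + w x *\<^sub>R Z x)))\<^sup>2) \<partial>lborel) \<le> ennreal e"
  proof (intro exI conjI ballI)
    show "C1_grad (\<lambda>x. \<zeta> x * \<phi> x) (\<lambda>x. \<zeta> x *\<^sub>R D x + \<phi> x *\<^sub>R Z x)"
      by (rule C1_grad_mult[OF \<zeta> \<phi>(1)])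
    show "\<bar>\<zeta> x * \<phi> x - \<zeta> x * w x\<bar> \<le> e" if "x \<in> K" for x
    proof -
      have "\<bar>\<zeta> x * \<phi> x - \<zeta> x * w x\<bar> = \<bar>\<zeta> x\<bar> * \<bar>\<phi> x - w x\<bar>"
        by (simp add: abs_mult[symmetric] right_diff_distrib)
      also have "\<dots> \<le> B * e1" using B that \<phi>(2) by (intro mult_mono) auto
      finally show ?thesis using e1(3) by linarith
    qed
    have "(\<integral>\<^sup>+x\<in>K. ennreal ((norm (\<zeta> x *\<^sub>R D x + \<phi> x *\<^sub>R Z x - (\<zeta> x *\<^sub>R g x + w x *\<^sub>R Z x)))\<^sup>2) \<partial>lborel)
      \<le> ennreal (2 * B\<^sup>2) * (\<integral>\<^sup>+x\<in>K. ennreal ((norm (D x - g x))\<^sup>2) \<partial>lborel)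
        + ennreal (2 * B\<^sup>2 * e1\<^sup>2) * (\<integral>\<^sup>+x\<in>K. ennreal 1 \<partial>lborel)"
    proof (rule nn_integral_on_le_lin)
      fix x assume x: "x \<in> K"
      have "\<zeta> x *\<^sub>R D x + \<phi> x *\<^sub>R Z x - (\<zeta> x *\<^sub>R g x + w x *\<^sub>R Z x) = \<zeta> x *\<^sub>R (D x - g x) + (\<phi> x - w x) *\<^sub>R Z x"
        by (simp add: algebra_simps)
      also have "(norm \<dots>)\<^sup>2 \<le> 2 * (norm (\<zeta> x *\<^sub>R (D x - g x)))\<^sup>2 + 2 * (norm ((\<phi> x - w x) *\<^sub>R Z x))\<^sup>2"
        by (rule norm_add_square_le)
      also have "\<dots> = 2 * \<bar>\<zeta> x\<bar>\<^sup>2 * (norm (D x - g x))\<^sup>2 + 2 * ((norm (Z x))\<^sup>2 * \<bar>\<phi> x - w x\<bar>\<^sup>2)"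
        by (simp add: power_mult_distrib)
      also have "\<dots> \<le> 2 * B\<^sup>2 * (norm (D x - g x))\<^sup>2 + 2 * (B\<^sup>2 * e1\<^sup>2)"
        using B(2,3)[OF x] \<phi>(2)[OF x]
        by (intro add_mono mult_right_mono mult_left_mono mult_mono power_mono) auto
      finally show "(norm (\<zeta> x *\<^sub>R D x + \<phi> x *\<^sub>R Z x - (\<zeta> x *\<^sub>R g x + w x *\<^sub>R Z x)))\<^sup>2
        \<le> 2 * B\<^sup>2 * (norm (D x - g x))\<^sup>2 + 2 * B\<^sup>2 * e1\<^sup>2 * 1" by simp
    qed auto
    also have "\<dots> \<le> ennreal (2 * B\<^sup>2) * ennreal e1 + ennreal (2 * B\<^sup>2 * e1\<^sup>2) * ennreal m"
      using m by (intro add_mono mult_left_mono \<phi>(3)) auto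
    also have "\<dots> = ennreal (2 * B\<^sup>2 * e1 + 2 * B\<^sup>2 * e1\<^sup>2 * m)"
      using e1(1) m by (simp add: ennreal_mult)
    also have "\<dots> \<le> ennreal e" using e1(4) by (intro ennreal_leI)
    finally show "(\<integral>\<^sup>+x\<in>K. ennreal ((norm (\<zeta> x *\<^sub>R D x + \<phi> x *\<^sub>R Z x - (\<zeta> x *\<^sub>R g x + w x *\<^sub>R Z x)))\<^sup>2) \<partial>lborel) \<le> ennreal e" .
  qed
qed

text \<open>The fundamental theorem of calculus along the segment from \<open>x\<close> to
  \<open>x + z\<close>, integrated over \<open>S\<close>; after the integrals are exchanged, each
  slice is a translate of \<open>S\<close> that stays inside \<open>K\<close>.\<close>

lemma C1_grad_translation:
  assumes \<phi>: "C1_grad \<phi> D" and [measurable]: "S \<in> sets borel" "K \<in> sets borel"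
    and SK: "\<And>x t. x \<in> S \<Longrightarrow> 0 \<le> t \<Longrightarrow> t \<le> 1 \<Longrightarrow> x + t *\<^sub>R z \<in> K"
  shows "(\<integral>\<^sup>+x\<in>S. ennreal \<bar>\<phi> (x + z) - \<phi> x\<bar> \<partial>lborel) \<le> ennreal (norm z) * (\<integral>\<^sup>+x\<in>K. ennreal (norm (D x)) \<partial>lborel)"
proof -
  note [measurable] = C1_grad_borel[OF \<phi>]
  let ?J = "{0..1::real}"
  have ptw: "ennreal \<bar>\<phi> (x + z) - \<phi> x\<bar> \<le> ennreal (norm z) * (\<integral>\<^sup>+t\<in>?J. ennreal (norm (D (x + t *\<^sub>R z))) \<partial>lborel)" for x
  proof -
    let ?f = "\<lambda>t. D (x + t *\<^sub>R z) \<bullet> z"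
    have c: "continuous_on UNIV ?f"
      by (intro continuous_intros continuous_on_compose2[OF C1_gradD(2)[OF \<phi>]]) auto
    have "(\<integral>t. indicator ?J t *\<^sub>R ?f t \<partial>lborel) = \<phi> (x + 1 *\<^sub>R z) - \<phi> (x + 0 *\<^sub>R z)"
    proof (rule integral_FTC_atLeastAtMost)
      fix t :: real
      have "((\<lambda>t. x + t *\<^sub>R z) has_derivative (\<lambda>h. h *\<^sub>R z)) (at t within ?J)"
        by (auto intro!: derivative_eq_intros)
      from has_derivative_compose[OF this C1_gradD(1)[OF \<phi>]]
      show "((\<lambda>t. \<phi> (x + t *\<^sub>R z)) has_vector_derivative ?f t) (at t within ?J)"
        by (simp add: has_vector_derivative_def)
    qed (auto intro: continuous_on_subset[OF c])
    moreover have "integrable lborel (\<lambda>t. indicator ?J t *\<^sub>R ?f t)"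
      by (rule borel_integrable_compact) (auto intro: continuous_on_subset[OF c])
    ultimately have "ennreal \<bar>\<phi> (x + z) - \<phi> x\<bar> \<le> (\<integral>\<^sup>+t. ennreal (norm (indicator ?J t *\<^sub>R ?f t)) \<partial>lborel)"
      using integral_norm_bound_ennreal[of lborel "\<lambda>t. indicator ?J t *\<^sub>R ?f t"] by simp
    also have "\<dots> \<le> (\<integral>\<^sup>+t. ennreal (norm z) * (ennreal (norm (D (x + t *\<^sub>R z))) * indicator ?J t) \<partial>lborel)"
    proof (rule nn_integral_mono)
      fix t
      have "\<bar>?f t\<bar> \<le> norm z * norm (D (x + t *\<^sub>R z))"
        using Cauchy_Schwarz_ineq2[of "D (x + t *\<^sub>R z)" z] by (simp add: mult.commute)
      then have "ennreal \<bar>?f t\<bar> \<le> ennreal (norm z) * ennreal (norm (D (x + t *\<^sub>R z)))"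
        by (simp add: ennreal_mult[symmetric] ennreal_leI)
      then show "ennreal (norm (indicator ?J t *\<^sub>R ?f t)) \<le> ennreal (norm z) * (ennreal (norm (D (x + t *\<^sub>R z))) * indicator ?J t)"
        by (simp add: indicator_def)
    qed
    also have "\<dots> = ennreal (norm z) * (\<integral>\<^sup>+t\<in>?J. ennreal (norm (D (x + t *\<^sub>R z))) \<partial>lborel)"
      by (rule nn_integral_cmult) measurable
    finally show ?thesis .
  qed
  have "(\<integral>\<^sup>+x\<in>S. ennreal \<bar>\<phi> (x + z) - \<phi> x\<bar> \<partial>lborel)
     \<le> (\<integral>\<^sup>+x. ennreal (norm z) * (\<integral>\<^sup>+t. ennreal (norm (D (x + t *\<^sub>R z))) * indicator ?J t * indicator S x \<partial>lborel) \<partial>lborel)"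
    using ptw by (intro nn_integral_mono) (auto simp: indicator_def)
  also have "\<dots> = ennreal (norm z) * (\<integral>\<^sup>+x. (\<integral>\<^sup>+t. ennreal (norm (D (x + t *\<^sub>R z))) * indicator ?J t * indicator S x \<partial>lborel) \<partial>lborel)"
    by (rule nn_integral_cmult) measurable
  also have "(\<integral>\<^sup>+x. (\<integral>\<^sup>+t. ennreal (norm (D (x + t *\<^sub>R z))) * indicator ?J t * indicator S x \<partial>lborel) \<partial>lborel)
     = (\<integral>\<^sup>+t. (\<integral>\<^sup>+x. ennreal (norm (D (x + t *\<^sub>R z))) * indicator ?J t * indicator S x \<partial>lborel) \<partial>lborel)"
    by (rule lborel_pair.Fubini') measurable
  also have "\<dots> \<le> (\<integral>\<^sup>+t. (\<integral>\<^sup>+x\<in>K. ennreal (norm (D x)) \<partial>lborel) * indicator ?J t \<partial>lborel)"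
  proof (rule nn_integral_mono)
    fix t :: real
    have "(\<integral>\<^sup>+x. ennreal (norm (D (x + t *\<^sub>R z))) * indicator ?J t * indicator S x \<partial>lborel)
      \<le> (\<integral>\<^sup>+x. (ennreal (norm (D (x + t *\<^sub>R z))) * indicator K (x + t *\<^sub>R z)) * indicator ?J t \<partial>lborel)"
      using SK by (intro nn_integral_mono) (auto simp: indicator_def)
    also have "\<dots> = (\<integral>\<^sup>+x. ennreal (norm (D (x + t *\<^sub>R z))) * indicator K (x + t *\<^sub>R z) \<partial>lborel) * indicator ?J t"
      by (rule nn_integral_multc) measurable
    also have "(\<integral>\<^sup>+x. ennreal (norm (D (x + t *\<^sub>R z))) * indicator K (x + t *\<^sub>R z) \<partial>lborel) = (\<integral>\<^sup>+x\<in>K. ennreal (norm (D x)) \<partial>lborel)"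
      by (rule nn_integral_translate) measurable
    finally show "(\<integral>\<^sup>+x. ennreal (norm (D (x + t *\<^sub>R z))) * indicator ?J t * indicator S x \<partial>lborel)
      \<le> (\<integral>\<^sup>+x\<in>K. ennreal (norm (D x)) \<partial>lborel) * indicator ?J t" .
  qed
  also have "\<dots> = (\<integral>\<^sup>+x\<in>K. ennreal (norm (D x)) \<partial>lborel)"
    by (subst nn_integral_cmult) auto
  finally show ?thesis by (simp add: mult_left_mono)
qed

text \<open>The limit needs gradients close in \<open>L^1\<close>, while the approximation is in
  \<open>L^2\<close>. On the set \<open>K\<close> of finite measure \<open>m\<close>, a squared
  error of \<open>s^2\<close> becomes an \<open>L^1\<close> error of
  \<open>s * m + s\<close>.\<close>

lemma C1_approx_translation:
  assumes w: "C1_approx K w g" and K: "compact K" and g[measurable]: "g \<in> borel_measurable borel"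
    and [measurable]: "S \<in> sets borel"
    and SK: "\<And>x t. x \<in> S \<Longrightarrow> 0 \<le> t \<Longrightarrow> t \<le> 1 \<Longrightarrow> x + t *\<^sub>R z \<in> K"
  shows "(\<integral>\<^sup>+x\<in>S. ennreal \<bar>w (x + z) - w x\<bar> \<partial>lborel) \<le> ennreal (norm z) * (\<integral>\<^sup>+x\<in>K. ennreal (norm (g x)) \<partial>lborel)"
proof (rule ennreal_le_epsilon)
  fix e :: real assume e: "0 < e"
  have [measurable]: "K \<in> sets borel" using K by (rule borel_compact)
  define m where "m = measure lborel K"
  have m: "0 \<le> m" "emeasure lborel K = ennreal m"
    unfolding m_def using ennreal_lborel_finite_measure[OF compact_imp_bounded[OF K]] by auto
  have SsubK: "S \<subseteq> K" using SK[of _ 0] by auto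
  then have mS: "emeasure lborel S \<le> ennreal m" unfolding m(2)[symmetric] by (intro emeasure_mono) auto
  \<comment> \<open>Collects the errors: \<open>2 * s^2\<close> from the values at \<open>x\<close>
    and \<open>x + z\<close>, integrated over \<open>S\<close>, and \<open>s * m + s\<close> from
    the gradients, multiplied by the length of the shift.\<close>
  define A where "A = 2 * m + norm z * (m + 1)"
  have A: "0 \<le> A" using m(1) by (simp add: A_def)
  define s where "s = min 1 (e / (A + 1))"
  have s: "0 < s" "s \<le> 1" "s * A \<le> e"
  proof -
    show pos: "0 < s" using e A by (simp add: s_def)
    have "s \<le> e / (A + 1)" by (simp add: s_def)
    then have "s * (A + 1) \<le> e" using A by (subst (asm) pos_le_divide_eq) auto
    then show "s * A \<le> e" using pos by (simp add: algebra_simps)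
  qed (simp add: s_def)
  obtain \<phi> D where \<phi>: "C1_grad \<phi> D" "\<And>x. x \<in> K \<Longrightarrow> \<bar>\<phi> x - w x\<bar> \<le> s\<^sup>2"
    "(\<integral>\<^sup>+x\<in>K. ennreal ((norm (D x - g x))\<^sup>2) \<partial>lborel) \<le> ennreal (s\<^sup>2)"
    using C1_approxE[OF w, of "s\<^sup>2"] s(1) by auto
  note [measurable] = C1_grad_borel[OF \<phi>(1)]
  have dif: "(\<integral>\<^sup>+x\<in>K. ennreal (norm (D x - g x)) \<partial>lborel) \<le> ennreal (s * m + s)"
  proof -
    have "(\<integral>\<^sup>+x\<in>K. ennreal \<bar>norm (D x - g x)\<bar> \<partial>lborel)
      \<le> ennreal s * emeasure lborel K + ennreal (1 / s) * (\<integral>\<^sup>+x\<in>K. ennreal ((norm (D x - g x))\<^sup>2) \<partial>lborel)"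
      by (rule nn_integral_abs_le_square) (use s in auto)
    also have "\<dots> \<le> ennreal s * ennreal m + ennreal (1 / s) * ennreal (s\<^sup>2)"
      unfolding m(2) by (intro add_mono mult_left_mono \<phi>(3)) auto
    also have "\<dots> = ennreal (s * m + s)"
      using s(1) m(1) by (simp add: ennreal_mult[symmetric] power2_eq_square)
    finally show ?thesis by simp
  qed
  have "(\<integral>\<^sup>+x\<in>K. ennreal (norm (D x)) \<partial>lborel)
     \<le> (\<integral>\<^sup>+x. ennreal (norm (g x)) * indicator K x + ennreal (norm (D x - g x)) * indicator K x \<partial>lborel)"
  proof (rule nn_integral_mono)
    fix x
    have "ennreal (norm (D x)) \<le> ennreal (norm (g x)) + ennreal (norm (D x - g x))"
      using norm_triangle_sub[of "D x" "g x"] by (simp add: ennreal_plus[symmetric] ennreal_leI del: ennreal_plus)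
    then show "ennreal (norm (D x)) * indicator K x \<le> ennreal (norm (g x)) * indicator K x + ennreal (norm (D x - g x)) * indicator K x"
      by (auto simp: indicator_def)
  qed
  also have "\<dots> = (\<integral>\<^sup>+x\<in>K. ennreal (norm (g x)) \<partial>lborel) + (\<integral>\<^sup>+x\<in>K. ennreal (norm (D x - g x)) \<partial>lborel)"
    by (rule nn_integral_add) measurable
  finally have D: "(\<integral>\<^sup>+x\<in>K. ennreal (norm (D x)) \<partial>lborel)
     \<le> (\<integral>\<^sup>+x\<in>K. ennreal (norm (g x)) \<partial>lborel) + ennreal (s * m + s)"
    using dif by (meson add_left_mono order_trans)
  have "(\<integral>\<^sup>+x\<in>S. ennreal \<bar>w (x + z) - w x\<bar> \<partial>lborel)
     \<le> (\<integral>\<^sup>+x. ennreal (2 * s\<^sup>2) * indicator S x + ennreal \<bar>\<phi> (x + z) - \<phi> x\<bar> * indicator S x \<partial>lborel)"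
  proof (rule nn_integral_mono)
    fix x
    have "ennreal \<bar>w (x + z) - w x\<bar> \<le> ennreal (2 * s\<^sup>2) + ennreal \<bar>\<phi> (x + z) - \<phi> x\<bar>" if "x \<in> S"
    proof -
      have "\<bar>w (x + z) - w x\<bar> \<le> 2 * s\<^sup>2 + \<bar>\<phi> (x + z) - \<phi> x\<bar>"
        using \<phi>(2)[of x] \<phi>(2)[of "x + z"] SK[OF that, of 0] SK[OF that, of 1] by simp
      then show ?thesis by (simp add: ennreal_plus[symmetric] ennreal_leI del: ennreal_plus)
    qed
    then show "ennreal \<bar>w (x + z) - w x\<bar> * indicator S x
      \<le> ennreal (2 * s\<^sup>2) * indicator S x + ennreal \<bar>\<phi> (x + z) - \<phi> x\<bar> * indicator S x"
      by (auto simp: indicator_def)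
  qed
  also have "\<dots> = ennreal (2 * s\<^sup>2) * emeasure lborel S + (\<integral>\<^sup>+x\<in>S. ennreal \<bar>\<phi> (x + z) - \<phi> x\<bar> \<partial>lborel)"
    by (subst nn_integral_add) (simp_all add: nn_integral_cmult_indicator del: nn_integral_indicator_singleton)
  also have "\<dots> \<le> ennreal (2 * s\<^sup>2) * ennreal m
      + ennreal (norm z) * ((\<integral>\<^sup>+x\<in>K. ennreal (norm (g x)) \<partial>lborel) + ennreal (s * m + s))"
    by (intro add_mono mult_left_mono mS order_trans[OF C1_grad_translation[OF \<phi>(1) _ _ SK]] D) auto
  also have "\<dots> = ennreal (norm z) * (\<integral>\<^sup>+x\<in>K. ennreal (norm (g x)) \<partial>lborel)
      + ennreal (2 * s\<^sup>2 * m + norm z * (s * m + s))"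
    using s(1) m(1) by (simp add: distrib_left ennreal_mult add_ac del: ennreal_plus add: ennreal_plus)
  also have "2 * s\<^sup>2 * m + norm z * (s * m + s) \<le> e"
  proof -
    have "s\<^sup>2 \<le> s" using s by (simp add: power2_eq_square mult_left_le_one_le)
    then have "2 * s\<^sup>2 * m \<le> 2 * s * m" using m(1) by (intro mult_right_mono mult_left_mono) auto
    then show ?thesis using s(3) by (simp add: A_def algebra_simps)
  qed
  finally show "(\<integral>\<^sup>+x\<in>S. ennreal \<bar>w (x + z) - w x\<bar> \<partial>lborel)
     \<le> ennreal (norm z) * (\<integral>\<^sup>+x\<in>K. ennreal (norm (g x)) \<partial>lborel) + ennreal e"
    by (simp add: ennreal_leI add_left_mono)
qed

section \<open>Weak gradients of limits of \<open>C^1\<close> functions\<close>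

lemma test_funE:
  assumes "test_fun S \<theta>"
  obtains K b where "compact K" "K \<subseteq> S" "\<And>x. x \<notin> K \<Longrightarrow> \<theta> x = 0" "\<And>x. x \<notin> K \<Longrightarrow> classical_grad \<theta> x = 0"
    "C1_grad \<theta> (classical_grad \<theta>)" "0 < b" "\<And>x. \<bar>\<theta> x\<bar> \<le> b" "\<And>x. norm (classical_grad \<theta> x) \<le> b"
proof -
  define K where "K = closure {x. \<theta> x \<noteq> 0}"
  have K: "compact K" "K \<subseteq> S" using assms by (auto simp: test_fun_def K_def)
  have c: "C1_grad \<theta> (classical_grad \<theta>)" using assms by (auto simp: test_fun_def intro: smooth_C1_grad)
  have 0: "\<theta> x = 0" if "x \<notin> K" for x
    using that closure_subset[of "{x. \<theta> x \<noteq> 0}"] by (auto simp: K_def)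
  have D0: "classical_grad \<theta> x = 0" if "x \<notin> K" for x
    by (rule C1_grad_zero_open[OF c, of "- K"]) (use K 0 that in \<open>auto intro: compact_imp_closed\<close>)
  obtain b1 where b1: "\<And>x. x \<in> K \<Longrightarrow> \<bar>\<theta> x\<bar> \<le> b1"
    using compact_imp_bounded[OF compact_continuous_image[OF continuous_on_subset[OF C1_gradD(3)[OF c]] K(1)]]
    unfolding bounded_iff by auto
  obtain b2 where b2: "\<And>x. x \<in> K \<Longrightarrow> norm (classical_grad \<theta> x) \<le> b2"
    using compact_imp_bounded[OF compact_continuous_image[OF continuous_on_subset[OF C1_gradD(2)[OF c]] K(1)]]
    unfolding bounded_iff by auto
  show ?thesis
  proof (rule that[OF K 0 D0 c, of "max 1 (max b1 b2)"])
    show "\<bar>\<theta> x\<bar> \<le> max 1 (max b1 b2)" for x using b1[of x] 0[of x] by (cases "x \<in> K") auto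
    show "norm (classical_grad \<theta> x) \<le> max 1 (max b1 b2)" for x using b2[of x] D0[of x] by (cases "x \<in> K") auto
  qed auto
qed

lemma integrable_lebesgue_onI:
  fixes f :: "'a::euclidean_space \<Rightarrow> real"
  assumes "S \<in> sets lebesgue" "integrable lborel (\<lambda>x. indicator S x * f x)"
  shows "integrable (lebesgue_on S) f"
  using assms by (subst integrable_restrict_space) (auto simp: integrable_completion)

lemma borel_indicator_continuous:
  fixes w :: "'a::euclidean_space \<Rightarrow> real"
  assumes "continuous_on K w" "K \<in> sets borel"
  shows "(\<lambda>x. indicator K x * w x) \<in> borel_measurable borel"
  using borel_measurable_continuous_on_indicator[OF assms(2,1)] by simp

lemma nn_integral_component_less_top:
  fixes g :: "real^'n \<Rightarrow> real^'n"
  assumes "(\<integral>\<^sup>+x\<in>K. ennreal ((norm (g x))\<^sup>2) \<partial>lborel) < \<infinity>" "K0 \<subseteq> K"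
  shows "(\<integral>\<^sup>+x\<in>K0. ennreal ((g x $ i)\<^sup>2) \<partial>lborel) < \<infinity>"
proof (rule le_less_trans[OF nn_integral_mono assms(1)])
  fix x
  have "(g x $ i)\<^sup>2 \<le> (norm (g x))\<^sup>2"
    using component_le_norm_cart[of "g x" i] by (simp add: abs_le_square_iff[symmetric])
  then show "ennreal ((g x $ i)\<^sup>2) * indicator K0 x \<le> ennreal ((norm (g x))\<^sup>2) * indicator K x"
    using assms(2) by (auto simp: indicator_def intro!: ennreal_leI)
qed

text \<open>An approximant times a test function is \<open>C^1\<close> with bounded support, so its
  partial derivatives integrate to zero. Subtracting this identity leaves a defect controlled by the
  distance of the approximant from \<open>w\<close> and \<open>g\<close>.\<close>

lemma weak_gradient_of_C1_approx:
  fixes w :: "real^'n \<Rightarrow> real"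
  assumes w: "C1_approx K w g" and K: "compact K" and S: "open S" "S \<subseteq> K" and wc: "continuous_on K w"
    and g[measurable]: "g \<in> borel_measurable borel" and g2: "(\<integral>\<^sup>+x\<in>K. ennreal ((norm (g x))\<^sup>2) \<partial>lborel) < \<infinity>"
  shows "has_weak_gradient S w g"
  unfolding has_weak_gradient_def
proof (intro conjI allI impI)
  fix K0 :: "(real^'n) set" assume K0: "compact K0 \<and> K0 \<subseteq> S"
  then have K0': "K0 \<subseteq> K" and cK0: "compact K0" using S by auto
  have [measurable]: "K0 \<in> sets borel" using cK0 by (rule borel_compact)
  have leb: "K0 \<in> sets lebesgue" by simp
  show "integrable (lebesgue_on K0) w"
    using borel_integrable_compact[OF cK0 continuous_on_subset[OF wc K0']]
    by (intro integrable_lebesgue_onI leb) simp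
  show "integrable (lebesgue_on K0) (\<lambda>x. g x $ i)" for i
    by (intro integrable_lebesgue_onI leb integrable_of_L2 nn_integral_component_less_top[OF g2 K0']
        compact_imp_bounded[OF cK0]) measurable
next
  fix \<theta> i assume \<theta>: "test_fun S \<theta>"
  obtain L b where L: "compact L" "L \<subseteq> S" "\<And>x. x \<notin> L \<Longrightarrow> \<theta> x = 0" "\<And>x. x \<notin> L \<Longrightarrow> classical_grad \<theta> x = 0"
    "C1_grad \<theta> (classical_grad \<theta>)" "0 < b" "\<And>x. \<bar>\<theta> x\<bar> \<le> b" "\<And>x. norm (classical_grad \<theta> x) \<le> b"
    using test_funE[OF \<theta>] by blast
  define X where "X = (\<lambda>x. classical_grad \<theta> x $ i)"
  have pd: "partial_deriv i \<theta> = X" by (simp add: X_def classical_grad_def)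
  have X: "\<bar>X x\<bar> \<le> b" "x \<notin> L \<Longrightarrow> X x = 0" for x
    using L(8)[of x] L(4)[of x] component_le_norm_cart[of "classical_grad \<theta> x" i] by (auto simp: X_def)
  have [measurable]: "K \<in> sets borel" "S \<in> sets borel" "L \<in> sets borel"
    using K S L by (auto intro: borel_compact)
  note [measurable] = C1_grad_borel[OF L(5)]
  have [measurable]: "X \<in> borel_measurable borel" unfolding X_def by measurable
  have [measurable]: "(\<lambda>x. indicator K x * w x) \<in> borel_measurable borel"
    by (rule borel_indicator_continuous[OF wc]) measurable
  have LK: "L \<subseteq> K" using L S by auto
  obtain M where M: "\<And>x. x \<in> K \<Longrightarrow> \<bar>w x\<bar> \<le> M"
    using compact_imp_bounded[OF compact_continuous_image[OF wc K]] unfolding bounded_iff by auto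
  have IwX: "integrable lborel (\<lambda>x. (indicator K x * w x) * X x)"
  proof (rule Bochner_Integration.integrable_bound[of _ "\<lambda>x. (M * b) * indicator K x"])
    show "integrable lborel (\<lambda>x. (M * b) * indicator K x)"
      using emeasure_bounded_finite[OF compact_imp_bounded[OF K]]
      by (intro integrable_mult_right integrable_real_indicator) auto
    show "AE x in lborel. norm ((indicator K x * w x) * X x) \<le> norm ((M * b) * indicator K x)"
      using M X L(6) by (intro AE_I2) (auto simp: indicator_def abs_mult intro!: mult_mono order_trans[OF M abs_ge_self] order_trans[OF X(1) abs_ge_self])
  qed measurable
  have Ig: "integrable lborel (\<lambda>x. indicator K x * g x $ i)"
    by (intro integrable_of_L2 nn_integral_component_less_top[OF g2] compact_imp_bounded[OF K]) auto
  have prodI: "integrable lborel (\<lambda>x. f x * \<theta> x)" if "integrable lborel f" for f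
  proof (rule Bochner_Integration.integrable_bound[OF integrable_mult_right[OF that, of b]])
    have [measurable]: "f \<in> borel_measurable borel" using that by auto
    show "(\<lambda>x. f x * \<theta> x) \<in> borel_measurable lborel" by measurable
    show "AE x in lborel. norm (f x * \<theta> x) \<le> norm (b * f x)"
      using L(6,7) by (intro AE_I2) (auto simp: abs_mult mult.commute[of b] intro!: mult_left_mono)
  qed
  have e1: "(\<integral>x. w x * partial_deriv i \<theta> x \<partial>lebesgue_on S) = (\<integral>x. (indicator K x * w x) * X x \<partial>lborel)"
  proof -
    have eq: "indicator S x * (w x * partial_deriv i \<theta> x) = (indicator K x * w x) * X x" for x
      using X(2)[of x] subsetD[OF L(2), of x] subsetD[OF LK, of x] by (cases "x \<in> L") (simp_all add: pd)
    show ?thesis using S by (subst lebesgue_on_integral_eq_lborel) (simp_all add: eq)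
  qed
  have e2: "(\<integral>x. g x $ i * \<theta> x \<partial>lebesgue_on S) = (\<integral>x. (indicator K x * g x $ i) * \<theta> x \<partial>lborel)"
  proof -
    have eq: "indicator S x * (g x $ i * \<theta> x) = (indicator K x * g x $ i) * \<theta> x" for x
      using L(3)[of x] subsetD[OF L(2), of x] subsetD[OF LK, of x] by (cases "x \<in> L") simp_all
    show ?thesis using S by (subst lebesgue_on_integral_eq_lborel) (simp_all add: eq)
  qed
  \<comment> \<open>The defect of the integration by parts formula. It does not depend on the
    approximant, and its bound tends to \<open>0\<close> with the accuracy \<open>s\<close>.\<close>
  define J where "J = (\<integral>x. (indicator K x * w x) * X x + (indicator K x * g x $ i) * \<theta> x \<partial>lborel)"
  define m where "m = measure lborel K"
  have m: "0 \<le> m" "emeasure lborel K = ennreal m"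
    unfolding m_def using ennreal_lborel_finite_measure[OF compact_imp_bounded[OF K]] by auto
  have "\<bar>J\<bar> \<le> b * (s\<^sup>2 * m + s * m + s)" if s: "0 < s" for s
  proof -
    obtain \<phi> D where \<phi>: "C1_grad \<phi> D" "\<And>x. x \<in> K \<Longrightarrow> \<bar>\<phi> x - w x\<bar> \<le> s\<^sup>2"
      "(\<integral>\<^sup>+x\<in>K. ennreal ((norm (D x - g x))\<^sup>2) \<partial>lborel) \<le> ennreal (s\<^sup>2)"
      using C1_approxE[OF w, of "s\<^sup>2"] s by auto
    note [measurable] = C1_grad_borel[OF \<phi>(1)]
    obtain r where r: "\<And>x. x \<in> L \<Longrightarrow> norm x \<le> r" using compact_imp_bounded[OF L(1)] bounded_iff by blast
    have cp: "C1_grad (\<lambda>x. \<phi> x * \<theta> x) (\<lambda>x. \<phi> x *\<^sub>R classical_grad \<theta> x + \<theta> x *\<^sub>R D x)"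
      by (rule C1_grad_mult[OF \<phi>(1) L(5)])
    have sp: "\<phi> x * \<theta> x = 0" if "r < norm x" for x
      using L(3)[of x] r[of x] that by (cases "x \<in> L") auto
    have z: "(\<integral>x. \<phi> x * X x + \<theta> x * D x $ i \<partial>lborel) = 0"
      using integral_partial_zero[OF cp sp, where i=i] by (simp add: X_def)
    have iz: "integrable lborel (\<lambda>x. \<phi> x * X x + \<theta> x * D x $ i)"
    proof (rule integrable_cont_bounded_support[of _ r])
      show "continuous_on UNIV (\<lambda>x. \<phi> x * X x + \<theta> x * D x $ i)"
        unfolding X_def by (intro continuous_intros C1_gradD[OF \<phi>(1)] C1_gradD[OF L(5)])
      show "\<phi> x * X x + \<theta> x * D x $ i = 0" if "r < norm x" for x
        using L(3)[of x] X(2)[of x] r[of x] that by (cases "x \<in> L") auto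
    qed
    let ?f = "\<lambda>x. (indicator K x * w x) * X x + (indicator K x * g x $ i) * \<theta> x"
    let ?h = "\<lambda>x. ?f x - (\<phi> x * X x + \<theta> x * D x $ i)"
    have If: "integrable lborel ?f" using IwX prodI[OF Ig] by simp
    have J: "J = (\<integral>x. ?h x \<partial>lborel)"
      unfolding J_def using z iz If by (subst Bochner_Integration.integral_diff) auto
    have hb: "ennreal (norm (?h x)) \<le> ennreal (b * s\<^sup>2) * indicator K x + ennreal b * (ennreal \<bar>norm (D x - g x)\<bar> * indicator K x)" for x
    proof (cases "x \<in> L")
      case True
      then have x: "x \<in> K" using LK by auto
      then have "?h x = (w x - \<phi> x) * X x + (g x $ i - D x $ i) * \<theta> x" by (simp add: algebra_simps)
      also have "norm \<dots> \<le> \<bar>w x - \<phi> x\<bar> * \<bar>X x\<bar> + \<bar>g x $ i - D x $ i\<bar> * \<bar>\<theta> x\<bar>"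
        by (simp add: abs_mult[symmetric])
      also have "\<dots> \<le> s\<^sup>2 * b + norm (D x - g x) * b"
        using \<phi>(2)[OF x] X(1)[of x] L(7)[of x] component_le_norm_cart[of "D x - g x" i]
        by (intro add_mono mult_mono) (auto simp: abs_minus_commute)
      finally have "norm (?h x) \<le> b * s\<^sup>2 + b * norm (D x - g x)" by (simp add: mult.commute)
      then have "ennreal (norm (?h x)) \<le> ennreal (b * s\<^sup>2 + b * norm (D x - g x))" by (rule ennreal_leI)
      also have "\<dots> = ennreal (b * s\<^sup>2) + ennreal b * ennreal (norm (D x - g x))"
        using L(6) by (simp add: ennreal_mult)
      finally show ?thesis using x by simp
    next
      case False
      then have "?h x = 0" using L(3) X(2) by simp
      then show ?thesis by (simp only: norm_zero ennreal_0 zero_le)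
    qed
    have "ennreal \<bar>J\<bar> \<le> (\<integral>\<^sup>+x. ennreal (norm (?h x)) \<partial>lborel)"
      unfolding J using integral_norm_bound_ennreal[of lborel ?h] If iz by simp
    also have "\<dots> \<le> (\<integral>\<^sup>+x. ennreal (b * s\<^sup>2) * indicator K x + ennreal b * (ennreal \<bar>norm (D x - g x)\<bar> * indicator K x) \<partial>lborel)"
      by (rule nn_integral_mono) (rule hb)
    also have "\<dots> = ennreal (b * s\<^sup>2) * ennreal m + ennreal b * (\<integral>\<^sup>+x\<in>K. ennreal \<bar>norm (D x - g x)\<bar> \<partial>lborel)"
      by (simp add: nn_integral_add nn_integral_cmult m(2)[symmetric])
    also have "\<dots> \<le> ennreal (b * s\<^sup>2) * ennreal m + ennreal b * (ennreal s * ennreal m + ennreal (1 / s) * ennreal (s\<^sup>2))"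
    proof (intro add_mono mult_left_mono order_refl)
      have "(\<integral>\<^sup>+x\<in>K. ennreal \<bar>norm (D x - g x)\<bar> \<partial>lborel)
        \<le> ennreal s * emeasure lborel K + ennreal (1 / s) * (\<integral>\<^sup>+x\<in>K. ennreal ((norm (D x - g x))\<^sup>2) \<partial>lborel)"
        by (rule nn_integral_abs_le_square) (use s in auto)
      also have "\<dots> \<le> ennreal s * ennreal m + ennreal (1 / s) * ennreal (s\<^sup>2)"
        unfolding m(2) by (intro add_mono mult_left_mono \<phi>(3)) auto
      finally show "(\<integral>\<^sup>+x\<in>K. ennreal \<bar>norm (D x - g x)\<bar> \<partial>lborel) \<le> ennreal s * ennreal m + ennreal (1 / s) * ennreal (s\<^sup>2)" .
    qed auto
    also have "\<dots> = ennreal (b * (s\<^sup>2 * m + s * m + s))"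
      using s m(1) L(6) by (simp add: ennreal_mult[symmetric] ennreal_plus[symmetric] power2_eq_square algebra_simps del: ennreal_plus)
    finally show ?thesis using s m(1) L(6) by (subst (asm) ennreal_le_iff) auto
  qed
  note bound = this
  have "((\<lambda>s. b * (s\<^sup>2 * m + s * m + s)) \<longlongrightarrow> b * (0\<^sup>2 * m + 0 * m + 0)) (at_right 0)"
    by (intro tendsto_intros)
  then have "((\<lambda>s. b * (s\<^sup>2 * m + s * m + s)) \<longlongrightarrow> 0) (at_right 0)" by simp
  then have "\<bar>J\<bar> \<le> 0"
    by (rule tendsto_lowerbound) (use bound in \<open>auto simp: eventually_at_filter\<close>)
  then have "J = 0" by simp
  then have "(\<integral>x. (indicator K x * w x) * X x \<partial>lborel) + (\<integral>x. (indicator K x * g x $ i) * \<theta> x \<partial>lborel) = 0"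
    unfolding J_def by (subst (asm) Bochner_Integration.integral_add[OF IwX prodI[OF Ig]])
  then show "(\<integral>x. w x * partial_deriv i \<theta> x \<partial>lebesgue_on S) = - (\<integral>x. g x $ i * \<theta> x \<partial>lebesgue_on S)"
    unfolding e1 e2 by linarith
qed

section \<open>Competitors in \<open>H\<^sup>1\<^sub>0\<close>\<close>

lemma borel_measurable_lebesgue_on:
  "f \<in> borel_measurable borel \<Longrightarrow> f \<in> borel_measurable (lebesgue_on S)"
  by (rule measurable_restrict_space1, rule measurable_completion) simp

lemma lebesgue_on_support:
  fixes f :: "'a::euclidean_space \<Rightarrow> real"
  assumes "L \<in> sets lebesgue" "S \<in> sets lebesgue" "L \<subseteq> S" "\<And>x. x \<notin> L \<Longrightarrow> f x = 0"
  shows "(\<integral>x. f x \<partial>lebesgue_on S) = (\<integral>x. f x \<partial>lebesgue_on L)"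
    and "integrable (lebesgue_on S) f \<longleftrightarrow> integrable (lebesgue_on L) f"
proof -
  have "indicator S x *\<^sub>R f x = indicator L x *\<^sub>R f x" for x
    using assms(3) assms(4)[of x] by (cases "x \<in> L") (auto simp: indicator_def)
  then have "(\<lambda>x. indicator S x *\<^sub>R f x) = (\<lambda>x. indicator L x *\<^sub>R f x)" by (rule ext)
  then show "(\<integral>x. f x \<partial>lebesgue_on S) = (\<integral>x. f x \<partial>lebesgue_on L)"
    "integrable (lebesgue_on S) f \<longleftrightarrow> integrable (lebesgue_on L) f"
    using assms(1,2) by (simp_all add: integral_restrict_space integrable_restrict_space del: real_scaleR_def)
qed

lemma integrable_mult_bounded_borel:
  fixes f h :: "'a::euclidean_space \<Rightarrow> real"
  assumes "integrable (lebesgue_on L) f" "h \<in> borel_measurable borel" "\<And>x. \<bar>h x\<bar> \<le> b"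
  shows "integrable (lebesgue_on L) (\<lambda>x. f x * h x)"
proof (rule Bochner_Integration.integrable_bound[OF integrable_mult_right[OF assms(1), of b]])
  have [measurable]: "f \<in> borel_measurable (lebesgue_on L)" "h \<in> borel_measurable (lebesgue_on L)"
    using assms borel_measurable_lebesgue_on by auto
  show "(\<lambda>x. f x * h x) \<in> borel_measurable (lebesgue_on L)" by measurable
  show "AE x in lebesgue_on L. norm (f x * h x) \<le> norm (b * f x)"
    by (intro AE_I2) (auto simp: abs_mult mult.commute[of b] intro!: mult_left_mono order_trans[OF assms(3) abs_ge_self])
qed

lemma test_fun_mono: "test_fun S \<theta> \<Longrightarrow> S \<subseteq> T \<Longrightarrow> test_fun T \<theta>"
  by (auto simp: test_fun_def)

text \<open>A test function on \<open>B\<close> is one on \<open>\<Omega>\<close>, so the formula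
  for \<open>u\<close> on the larger set applies. All integrals are moved to the compact set
  \<open>L\<close> carrying the test function, where the four integrands are integrable and can be
  added.\<close>

lemma has_weak_gradient_add:
  fixes u w :: "real^'n \<Rightarrow> real"
  assumes u: "has_weak_gradient \<Omega> u gu" and B: "open \<Omega>" "open B" "B \<subseteq> \<Omega>" and w: "has_weak_gradient B w gw"
  shows "has_weak_gradient B (\<lambda>x. u x + w x) (\<lambda>x. gu x + gw x)"
  unfolding has_weak_gradient_def
proof (intro conjI allI impI)
  fix K assume K: "compact K \<and> K \<subseteq> B"
  then have "integrable (lebesgue_on K) u" "\<And>i. integrable (lebesgue_on K) (\<lambda>x. gu x $ i)"
    "integrable (lebesgue_on K) w" "\<And>i. integrable (lebesgue_on K) (\<lambda>x. gw x $ i)"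
    using u w B(3) unfolding has_weak_gradient_def by (meson subset_trans)+
  then show "integrable (lebesgue_on K) (\<lambda>x. u x + w x)" "\<And>i. integrable (lebesgue_on K) (\<lambda>x. (gu x + gw x) $ i)"
    by auto
next
  fix \<theta> i assume \<theta>: "test_fun B \<theta>"
  then have \<theta>': "test_fun \<Omega> \<theta>" using B(3) test_fun_mono by blast
  obtain L b where L: "compact L" "L \<subseteq> B" "\<And>x. x \<notin> L \<Longrightarrow> \<theta> x = 0" "\<And>x. x \<notin> L \<Longrightarrow> classical_grad \<theta> x = 0"
    "C1_grad \<theta> (classical_grad \<theta>)" "0 < b" "\<And>x. \<bar>\<theta> x\<bar> \<le> b" "\<And>x. norm (classical_grad \<theta> x) \<le> b"
    using test_funE[OF \<theta>] by blast
  have pd: "partial_deriv i \<theta> x = classical_grad \<theta> x $ i" for x by (simp add: classical_grad_def)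
  have leb: "L \<in> sets lebesgue" "B \<in> sets lebesgue" "\<Omega> \<in> sets lebesgue" "L \<subseteq> \<Omega>"
    using L B by (auto intro: lmeasurable_compact fmeasurableD)
  have I: "integrable (lebesgue_on L) u" "integrable (lebesgue_on L) (\<lambda>x. gu x $ i)"
    "integrable (lebesgue_on L) w" "integrable (lebesgue_on L) (\<lambda>x. gw x $ i)"
    using u w L(1,2) leb(4) unfolding has_weak_gradient_def by blast+
  note \<theta>m = C1_grad_borel[OF L(5)]
  have pm: "partial_deriv i \<theta> \<in> borel_measurable borel"
    using borel_measurable_vec_component[OF \<theta>m(2), of i] by (simp add: classical_grad_def)
  have pb: "\<bar>partial_deriv i \<theta> x\<bar> \<le> b" "x \<notin> L \<Longrightarrow> partial_deriv i \<theta> x = 0" for x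
    using component_le_norm_cart[of "classical_grad \<theta> x" i] L(8)[of x] L(4)[of x] by (auto simp: pd)
  note J = integrable_mult_bounded_borel[OF I(1) pm pb(1)] integrable_mult_bounded_borel[OF I(3) pm pb(1)]
    integrable_mult_bounded_borel[OF I(2) \<theta>m(1) L(7)] integrable_mult_bounded_borel[OF I(4) \<theta>m(1) L(7)]
  have s: "(\<integral>x. f x * partial_deriv i \<theta> x \<partial>lebesgue_on T) = (\<integral>x. f x * partial_deriv i \<theta> x \<partial>lebesgue_on L)"
    "(\<integral>x. f x * \<theta> x \<partial>lebesgue_on T) = (\<integral>x. f x * \<theta> x \<partial>lebesgue_on L)"
    if "T \<in> sets lebesgue" "L \<subseteq> T" for f T
    by (rule lebesgue_on_support(1)[OF leb(1) that]; simp add: pb L)+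
  have eu: "(\<integral>x. u x * partial_deriv i \<theta> x \<partial>lebesgue_on L) = - (\<integral>x. gu x $ i * \<theta> x \<partial>lebesgue_on L)"
    using u \<theta>' unfolding has_weak_gradient_def s[OF leb(3,4), symmetric] by blast
  have ew: "(\<integral>x. w x * partial_deriv i \<theta> x \<partial>lebesgue_on L) = - (\<integral>x. gw x $ i * \<theta> x \<partial>lebesgue_on L)"
    using w \<theta> unfolding has_weak_gradient_def s[OF leb(2) L(2), symmetric] by blast
  show "(\<integral>x. (u x + w x) * partial_deriv i \<theta> x \<partial>lebesgue_on B) = - (\<integral>x. (gu x + gw x) $ i * \<theta> x \<partial>lebesgue_on B)"
    unfolding s[OF leb(2) L(2)] using J eu ew by (simp add: distrib_right)
qed

text \<open>\<open>H1_on\<close> supplies a Lebesgue measurable gradient on \<open>\<Omega>\<close>.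
  A Borel representative on the whole space lets the later integrals be taken over
  \<open>lborel\<close>, where translations and the exchange of integrals are at hand.\<close>

lemma borel_weak_gradient:
  fixes u :: "real^'n \<Rightarrow> real"
  assumes u: "has_weak_gradient \<Omega> u gu" and \<Omega>: "open \<Omega>" and gu: "L2vec_on \<Omega> gu"
  obtains g where "has_weak_gradient \<Omega> u g" "g \<in> borel_measurable borel"
    "(\<integral>\<^sup>+x\<in>\<Omega>. ennreal ((norm (g x))\<^sup>2) \<partial>lborel) < \<infinity>"
proof -
  have leb: "\<Omega> \<in> sets lebesgue" using \<Omega> by auto
  have gm: "gu \<in> borel_measurable (lebesgue_on \<Omega>)" using gu by (simp add: L2vec_on_def)
  have "\<exists>h\<in>borel_measurable lborel. AE x in lborel. indicator \<Omega> x *\<^sub>R (gu x $ i) = h x" for i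
  proof (rule completion_ex_borel_measurable_real)
    show "(\<lambda>x. indicator \<Omega> x *\<^sub>R (gu x $ i)) \<in> borel_measurable lebesgue"
      using borel_measurable_vec_component[OF gm, of i] leb
      by (subst (asm) borel_measurable_restrict_space_iff) auto
  qed
  then have "\<forall>i. \<exists>h. h \<in> borel_measurable borel \<and> (AE x in lborel. indicator \<Omega> x *\<^sub>R (gu x $ i) = h x)"
    by auto
  from choice[OF this]
  obtain h where h: "\<And>i. h i \<in> borel_measurable borel" "\<And>i. AE x in lborel. indicator \<Omega> x *\<^sub>R (gu x $ i) = h i x"
    by blast
  define g where "g = (\<lambda>x. \<chi> i. h i x)"
  have gi: "(\<lambda>x. g x $ i) \<in> borel_measurable borel" for i using h(1) by (simp add: g_def)
  have g: "g \<in> borel_measurable borel"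
    by (subst borel_measurable_euclidean_space) (auto simp: Basis_vec_def inner_axis gi)
  have "AE x in lborel. \<forall>i. indicator \<Omega> x *\<^sub>R (gu x $ i) = h i x" using h(2) by (simp add: AE_all_countable)
  then have AE: "AE x in lebesgue. x \<in> \<Omega> \<longrightarrow> gu x = g x"
    by (intro AE_completion) (auto simp: g_def vec_eq_iff elim!: eventually_mono)
  show ?thesis
  proof (rule that[OF _ g])
    have AE_on: "AE x in lebesgue_on S. gu x $ i = g x $ i" if "S \<in> sets lebesgue" "S \<subseteq> \<Omega>" for S i
      using AE that by (subst AE_restrict_space_iff) (auto elim!: eventually_mono)
    show "has_weak_gradient \<Omega> u g"
      unfolding has_weak_gradient_def
    proof (intro conjI allI impI)
      fix K :: "(real^'n) set" assume K: "compact K \<and> K \<subseteq> \<Omega>"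
      then show "integrable (lebesgue_on K) u" using u by (simp add: has_weak_gradient_def)
      have "integrable (lebesgue_on K) (\<lambda>x. gu x $ i)" for i using u K by (simp add: has_weak_gradient_def)
      moreover have "K \<in> sets lebesgue" using K by (auto intro: lmeasurable_compact fmeasurableD)
      ultimately show "integrable (lebesgue_on K) (\<lambda>x. g x $ i)" for i
        using AE_on[of K i] K borel_measurable_lebesgue_on[OF gi] by (subst integrable_cong_AE[of _ _ "\<lambda>x. gu x $ i"]) auto
    next
      fix \<theta> i assume \<theta>: "test_fun \<Omega> \<theta>"
      have [measurable]: "\<theta> \<in> borel_measurable (lebesgue_on \<Omega>)"
        using \<theta> by (intro borel_measurable_lebesgue_on C1_grad_borel(1)[OF smooth_C1_grad]) (simp add: test_fun_def)
      have [measurable]: "(\<lambda>x. gu x $ i) \<in> borel_measurable (lebesgue_on \<Omega>)" "(\<lambda>x. g x $ i) \<in> borel_measurable (lebesgue_on \<Omega>)"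
        using borel_measurable_vec_component[OF gm] borel_measurable_lebesgue_on[OF gi] by auto
      have "(\<integral>x. gu x $ i * \<theta> x \<partial>lebesgue_on \<Omega>) = (\<integral>x. g x $ i * \<theta> x \<partial>lebesgue_on \<Omega>)"
        by (rule integral_cong_AE) (use AE_on[OF leb, of i] in \<open>auto elim!: eventually_mono\<close>)
      then show "(\<integral>x. u x * partial_deriv i \<theta> x \<partial>lebesgue_on \<Omega>) = - (\<integral>x. g x $ i * \<theta> x \<partial>lebesgue_on \<Omega>)"
        using u \<theta> by (simp add: has_weak_gradient_def)
    qed
    have I: "integrable (lebesgue_on \<Omega>) (\<lambda>x. (norm (gu x))\<^sup>2)" using gu by (simp add: L2vec_on_def)
    have "(\<integral>\<^sup>+x\<in>\<Omega>. ennreal ((norm (g x))\<^sup>2) \<partial>lborel) = (\<integral>\<^sup>+x\<in>\<Omega>. ennreal ((norm (g x))\<^sup>2) \<partial>lebesgue)"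
      by (simp add: nn_integral_completion)
    also have "\<dots> = (\<integral>\<^sup>+x\<in>\<Omega>. ennreal ((norm (gu x))\<^sup>2) \<partial>lebesgue)"
      by (rule nn_integral_cong_AE) (use AE in \<open>auto elim!: eventually_mono simp: indicator_def\<close>)
    also have "\<dots> = (\<integral>\<^sup>+x. ennreal ((norm (gu x))\<^sup>2) \<partial>lebesgue_on \<Omega>)"
      using leb by (subst nn_integral_restrict_space) auto
    also have "\<dots> < \<infinity>" using I by (subst nn_integral_eq_integral) auto
    finally show "(\<integral>\<^sup>+x\<in>\<Omega>. ennreal ((norm (g x))\<^sup>2) \<partial>lborel) < \<infinity>" .
  qed
qed

lemma lebesgue_on_integral_le:
  fixes f :: "'a::euclidean_space \<Rightarrow> real"
  assumes "S \<in> sets lebesgue" "\<And>x. 0 \<le> f x" "0 \<le> c" "(\<integral>\<^sup>+x\<in>S. ennreal (f x) \<partial>lborel) \<le> ennreal c"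
  shows "(\<integral>x. f x \<partial>lebesgue_on S) \<le> c"
proof (cases "f \<in> borel_measurable (lebesgue_on S)")
  case True
  have "(\<integral>x. f x \<partial>lebesgue_on S) = enn2real (\<integral>\<^sup>+x. ennreal (f x) \<partial>lebesgue_on S)"
    using assms(2) True by (intro integral_eq_nn_integral) auto
  also have "(\<integral>\<^sup>+x. ennreal (f x) \<partial>lebesgue_on S) = (\<integral>\<^sup>+x\<in>S. ennreal (f x) \<partial>lborel)"
    using assms(1) by (subst nn_integral_restrict_space) (auto simp: nn_integral_completion)
  also have "enn2real \<dots> \<le> c" using assms(3,4) by (simp add: enn2real_leI)
  finally show ?thesis .
next
  \<comment> \<open>Without measurability \<open>f\<close> is not integrable, and its integral is
    \<open>0\<close> by convention.\<close>
  case False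
  then have "\<not> integrable (lebesgue_on S) f" by auto
  then show ?thesis using assms(3) by (simp add: not_integrable_integral_eq)
qed

text \<open>Since \<open>w\<close> vanishes in an annulus next to the boundary sphere,
  mollifications at a scale below the width of the annulus are test functions on the ball.\<close>

lemma H10_on_ballI:
  fixes w :: "real^'n \<Rightarrow> real"
  assumes r1: "r1 < r" and wc: "continuous_on (ball c r) w" and wg: "has_weak_gradient (ball c r) w g"
    and g[measurable]: "g \<in> borel_measurable borel"
    and g2: "(\<integral>\<^sup>+x\<in>ball c r. ennreal ((norm (g x))\<^sup>2) \<partial>lborel) < \<infinity>"
    and supp: "\<And>x. r1 < dist c x \<Longrightarrow> dist c x < r \<Longrightarrow> w x = 0 \<and> g x = 0"
  shows "H10_on (ball c r) w"
proof -
  let ?B = "ball c r"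
  have leb: "?B \<in> sets lebesgue" by simp
  \<comment> \<open>The inner half of the annulus takes up the spread of the mollifier, the outer
    half keeps the supports compact in the ball.\<close>
  define r2 where "r2 = (r1 + r) / 2"
  have r2: "r1 < r2" "r2 < r" using r1 by (auto simp: r2_def)
  define m where "m = measure lborel ?B"
  have m: "0 \<le> m" "emeasure lborel ?B = ennreal m"
    unfolding m_def using ennreal_lborel_finite_measure[of ?B] by auto
  define e where "e = (\<lambda>k::nat. min (1 / real (Suc k)) (r2 - r1))"
  have e: "0 < e k" "e k \<le> 1 / real (Suc k)" "e k \<le> r2 - r1" for k using r2 by (auto simp: e_def)
  have wM: "(\<lambda>x. indicator ?B x * w x) \<in> borel_measurable borel"
    by (rule borel_indicator_continuous[OF wc]) measurable
  have e0: "e \<longlonglongrightarrow> 0"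
    by (rule tendsto_sandwich[OF _ _ tendsto_const LIMSEQ_Suc[OF lim_1_over_n]])
       (use e in \<open>auto intro!: always_eventually intro: less_imp_le\<close>)
  have "\<exists>\<phi>. test_fun ?B \<phi> \<and> (\<integral>x. (\<phi> x - w x)\<^sup>2 \<partial>lebesgue_on ?B) \<le> (e k)\<^sup>2 * m \<and>
      (\<integral>x. (norm (classical_grad \<phi> x - g x))\<^sup>2 \<partial>lebesgue_on ?B) \<le> e k" for k
  proof -
    have K: "compact (cball c r2)" "cball c r2 \<subseteq> ?B" using r2 by auto
    obtain \<phi> where \<phi>: "smooth_on UNIV \<phi>" "\<And>x. x \<in> cball c r2 \<Longrightarrow> \<bar>\<phi> x - w x\<bar> \<le> e k"
      "(\<integral>\<^sup>+x\<in>cball c r2. ennreal ((norm (classical_grad \<phi> x - g x))\<^sup>2) \<partial>lborel) \<le> ennreal (e k)"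
      "\<And>x. \<phi> x \<noteq> 0 \<Longrightarrow> \<exists>y\<in>?B. w y \<noteq> 0 \<and> dist x y < e k"
      by (rule weak_gradient_smooth_approx[OF wg open_ball wc g g2 K e(1)[of k]]) rule
    have \<phi>0: "\<phi> x = 0" if "x \<notin> cball c r2" for x
    proof (rule ccontr)
      assume "\<phi> x \<noteq> 0"
      then obtain y where y: "y \<in> ?B" "w y \<noteq> 0" "dist x y < e k" using \<phi>(4) by blast
      then have "dist c y \<le> r1" using supp[of y] by force
      then have "dist c x < r1 + e k" using y(3) dist_triangle[of c x y] by (simp add: dist_commute)
      then show False using that e(3)[of k] by simp
    qed
    have D0: "classical_grad \<phi> x = 0" if "x \<notin> cball c r2" for x
      by (rule C1_grad_zero_open[OF smooth_C1_grad[OF \<phi>(1)], of "- cball c r2"]) (use \<phi>0 that in auto)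
    have cl: "closure {x. \<phi> x \<noteq> 0} \<subseteq> cball c r2" using \<phi>0 by (intro closure_minimal) blast+
    have bd: "bounded {x. \<phi> x \<noteq> 0}"
      by (rule bounded_subset[OF bounded_cball subset_trans[OF closure_subset cl]])
    have "test_fun ?B \<phi>"
      unfolding test_fun_def using \<phi>(1) cl K(2) bd by (auto simp: compact_closure)
    moreover have "(\<integral>x. (\<phi> x - w x)\<^sup>2 \<partial>lebesgue_on ?B) \<le> (e k)\<^sup>2 * m"
    proof (rule lebesgue_on_integral_le[OF leb])
      have le: "(\<phi> x - w x)\<^sup>2 \<le> (e k)\<^sup>2" if "x \<in> ?B" for x
      proof (cases "x \<in> cball c r2")
        case True
        then have "\<bar>\<phi> x - w x\<bar> \<le> \<bar>e k\<bar>" using \<phi>(2) e(1)[of k] by fastforce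
        then show ?thesis by (simp only: abs_le_square_iff)
      next
        case False
        then show ?thesis using \<phi>0[of x] supp[of x] r2 that by auto
      qed
      have "(\<integral>\<^sup>+x\<in>?B. ennreal ((\<phi> x - w x)\<^sup>2) \<partial>lborel) \<le> (\<integral>\<^sup>+x. ennreal ((e k)\<^sup>2) * indicator ?B x \<partial>lborel)"
        using le by (intro nn_integral_mono) (auto simp: indicator_def intro!: ennreal_leI)
      also have "\<dots> = ennreal ((e k)\<^sup>2 * m)"
        using m(1) by (simp add: nn_integral_cmult_indicator m(2) ennreal_mult del: nn_integral_indicator_singleton)
      finally show "(\<integral>\<^sup>+x\<in>?B. ennreal ((\<phi> x - w x)\<^sup>2) \<partial>lborel) \<le> ennreal ((e k)\<^sup>2 * m)" .
    qed (use m(1) in auto)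
    moreover have "(\<integral>x. (norm (classical_grad \<phi> x - g x))\<^sup>2 \<partial>lebesgue_on ?B) \<le> e k"
    proof (rule lebesgue_on_integral_le[OF leb])
      have "(\<integral>\<^sup>+x\<in>?B. ennreal ((norm (classical_grad \<phi> x - g x))\<^sup>2) \<partial>lborel)
          \<le> (\<integral>\<^sup>+x\<in>cball c r2. ennreal ((norm (classical_grad \<phi> x - g x))\<^sup>2) \<partial>lborel)"
      proof (rule nn_integral_mono)
        fix x
        have "classical_grad \<phi> x = 0 \<and> g x = 0" if "x \<in> ?B" "x \<notin> cball c r2"
          using D0[OF that(2)] supp[of x] that r2 by auto
        then show "ennreal ((norm (classical_grad \<phi> x - g x))\<^sup>2) * indicator ?B x
          \<le> ennreal ((norm (classical_grad \<phi> x - g x))\<^sup>2) * indicator (cball c r2) x"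
          by (auto simp: indicator_def)
      qed
      also note \<phi>(3)
      finally show "(\<integral>\<^sup>+x\<in>?B. ennreal ((norm (classical_grad \<phi> x - g x))\<^sup>2) \<partial>lborel) \<le> ennreal (e k)" .
    qed (use e(1)[of k] in auto)
    ultimately show ?thesis by blast
  qed
  then obtain \<phi> where \<phi>: "\<And>k. test_fun ?B (\<phi> k)" "\<And>k. (\<integral>x. (\<phi> k x - w x)\<^sup>2 \<partial>lebesgue_on ?B) \<le> (e k)\<^sup>2 * m"
      "\<And>k. (\<integral>x. (norm (classical_grad (\<phi> k) x - g x))\<^sup>2 \<partial>lebesgue_on ?B) \<le> e k"
    by (meson choice_iff)
  have l1: "(\<lambda>k. \<integral>x. (\<phi> k x - w x)\<^sup>2 \<partial>lebesgue_on ?B) \<longlonglongrightarrow> 0"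
  proof (rule tendsto_sandwich[OF _ _ tendsto_const])
    show "(\<lambda>k. (e k)\<^sup>2 * m) \<longlonglongrightarrow> 0" using tendsto_mult[OF tendsto_power[OF e0, of 2] tendsto_const, of m] by simp
  qed (use \<phi> in auto)
  have l2: "(\<lambda>k. \<integral>x. (norm (classical_grad (\<phi> k) x - g x))\<^sup>2 \<partial>lebesgue_on ?B) \<longlonglongrightarrow> 0"
    by (rule tendsto_sandwich[OF _ _ tendsto_const e0]) (use \<phi> in auto)
  have "L2vec_on ?B g"
    unfolding L2vec_on_def
  proof
    show "g \<in> borel_measurable (lebesgue_on ?B)" by (rule borel_measurable_lebesgue_on[OF g])
    have "integrable lborel (\<lambda>x. indicator ?B x * (norm (g x))\<^sup>2)"
    proof (rule integrableI_nonneg)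
      have "(\<integral>\<^sup>+x. ennreal (indicator ?B x * (norm (g x))\<^sup>2) \<partial>lborel) = (\<integral>\<^sup>+x\<in>?B. ennreal ((norm (g x))\<^sup>2) \<partial>lborel)"
        by (rule nn_integral_cong) (auto simp: indicator_def)
      then show "(\<integral>\<^sup>+x. ennreal (indicator ?B x * (norm (g x))\<^sup>2) \<partial>lborel) < \<infinity>" using g2 by simp
    qed auto
    then show "integrable (lebesgue_on ?B) (\<lambda>x. (norm (g x))\<^sup>2)" by (rule integrable_lebesgue_onI[OF leb])
  qed
  moreover have "L2_on ?B w"
    unfolding L2_on_def
  proof
    show "w \<in> borel_measurable (lebesgue_on ?B)"
      using continuous_imp_measurable_on_sets_lebesgue[OF wc leb] .
    have sub: "cball c r2 \<subseteq> ?B" using r2(2) by auto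
    have "bounded (w ` cball c r2)"
      by (rule compact_imp_bounded[OF compact_continuous_image[OF continuous_on_subset[OF wc sub] compact_cball]])
    then obtain M where "\<forall>y\<in>w ` cball c r2. norm y \<le> M" unfolding bounded_iff by blast
    then have M: "\<bar>w x\<bar> \<le> M" if "x \<in> cball c r2" for x using that by auto
    have "integrable lborel (\<lambda>x. (indicator ?B x * w x)\<^sup>2)"
    proof (rule Bochner_Integration.integrable_bound[of _ "\<lambda>x. M\<^sup>2 * indicator ?B x"])
      show "integrable lborel (\<lambda>x. M\<^sup>2 * indicator ?B x :: real)"
        using emeasure_bounded_finite[of ?B] by (intro integrable_mult_right integrable_real_indicator) auto
      show "AE x in lborel. norm ((indicator ?B x * w x)\<^sup>2) \<le> norm (M\<^sup>2 * indicator ?B x)"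
      proof (rule AE_I2)
        fix x
        have "(w x)\<^sup>2 \<le> M\<^sup>2" if "x \<in> ?B"
        proof (cases "x \<in> cball c r2")
          case True
          then have "\<bar>w x\<bar> \<le> \<bar>M\<bar>" using M by fastforce
          then show ?thesis by (simp only: abs_le_square_iff)
        next
          case False
          then show ?thesis using supp[of x] r2 that by auto
        qed
        then show "norm ((indicator ?B x * w x)\<^sup>2) \<le> norm (M\<^sup>2 * indicator ?B x)" by (auto simp: indicator_def)
      qed
    qed (use wM in measurable)
    then have "integrable lborel (\<lambda>x. indicator ?B x * (w x)\<^sup>2)"
      by (rule Bochner_Integration.integrable_cong[THEN iffD1, rotated -1]) (auto simp: indicator_def)
    then show "integrable (lebesgue_on ?B) (\<lambda>x. (w x)\<^sup>2)" by (rule integrable_lebesgue_onI[OF leb])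
  qed
  ultimately show ?thesis unfolding H10_on_def using wg \<phi>(1) l1 l2 by blast
qed

section \<open>The Caccioppoli inequality for minimizers\<close>

text \<open>An exponent of at least \<open>2\<close> removes the corner of \<open>max 0\<close>: at
  \<open>0\<close> the difference quotient is itself a positive power of \<open>max 0 h\<close> and
  tends to \<open>0\<close>.\<close>

lemma max0_power_deriv:
  "((\<lambda>t::real. (max 0 t) ^ Suc (Suc k)) has_real_derivative real (Suc (Suc k)) * (max 0 t) ^ Suc k) (at t)"
proof -
  consider "t > 0" | "t < 0" | "t = 0" by linarith
  then show ?thesis
  proof cases
    case 1
    have "((\<lambda>t. t ^ Suc (Suc k)) has_real_derivative real (Suc (Suc k)) * (max 0 t) ^ Suc k) (at t)"
      using 1 DERIV_pow[of "Suc (Suc k)" t] by simp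
    then show ?thesis
      by (rule has_field_derivative_transform_within_open[of _ _ _ "{0<..}"]) (use 1 in auto)
  next
    case 2
    have "((\<lambda>t. 0) has_real_derivative real (Suc (Suc k)) * (max 0 t) ^ Suc k) (at t)"
      using 2 by simp
    then show ?thesis
      by (rule has_field_derivative_transform_within_open[of _ _ _ "{..<0}"]) (use 2 in auto)
  next
    case 3
    have "((\<lambda>h::real. (max 0 h) ^ Suc k) \<longlongrightarrow> (max 0 0) ^ Suc k) (at 0)"
      by (intro tendsto_intros)
    then have "((\<lambda>h::real. (max 0 h) ^ Suc k) \<longlongrightarrow> 0) (at 0)" by simp
    moreover have "((max 0 (0 + h)) ^ Suc (Suc k) - (max 0 (0::real)) ^ Suc (Suc k)) / h = (max 0 h) ^ Suc k" if "h \<noteq> 0" for h :: real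
      using that by (cases "h > 0") auto
    then have "\<forall>\<^sub>F h in at 0. (max 0 h) ^ Suc k = ((max 0 (0 + h)) ^ Suc (Suc k) - (max 0 (0::real)) ^ Suc (Suc k)) / h"
      by (auto simp: eventually_at_filter)
    ultimately have "((\<lambda>h. ((max 0 (0 + h)) ^ Suc (Suc k) - (max 0 (0::real)) ^ Suc (Suc k)) / h) \<longlongrightarrow> 0) (at 0)"
      by (rule Lim_transform_eventually)
    then show ?thesis using 3 by (simp add: DERIV_def)
  qed
qed

text \<open>The gap between the two sides is \<open>s * (1 - s)\<close> times the form at
  \<open>y - z\<close>.\<close>

lemma quadratic_form_convex:
  fixes A :: "real^'n^'n" and y z :: "real^'n"
  assumes pos: "\<And>z. 0 \<le> z \<bullet> (A *v z)" and s: "0 \<le> s" "s \<le> 1"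
  shows "(A *v ((1 - s) *\<^sub>R y + s *\<^sub>R z)) \<bullet> ((1 - s) *\<^sub>R y + s *\<^sub>R z)
    \<le> (1 - s) * ((A *v y) \<bullet> y) + s * ((A *v z) \<bullet> z)"
proof -
  have "0 \<le> (A *v (y - z)) \<bullet> (y - z)" using pos[of "y - z"] by (simp add: inner_commute)
  then have "0 \<le> s * (1 - s) * ((A *v (y - z)) \<bullet> (y - z))" using s by (intro mult_nonneg_nonneg) auto
  then show ?thesis
    by (simp add: matrix_vector_right_distrib matrix_vector_mult_diff_distrib matrix_vector_mult_scaleR
        inner_add_left inner_add_right inner_diff_left inner_diff_right algebra_simps)
qed

text \<open>\<open>v\<close> is the convex combination of \<open>y\<close> and a vector
  \<open>X\<close> with weights \<open>1 - s\<close> and \<open>s\<close>. The vector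
  \<open>X\<close> carries a factor \<open>1 / \<zeta>\<close>, whose square is paid for by the
  \<open>\<zeta>^2\<close> in \<open>s\<close>, so convexity replaces any estimate of cross terms
  between gradient and cutoff.\<close>

lemma competitor_energy_pointwise:
  fixes A :: "real^'n^'n" and y Z :: "real^'n"
  assumes ell: "\<And>z. 0 \<le> z \<bullet> (A *v z)" "\<And>z. z \<bullet> (A *v z) \<le> Lam * (norm z)\<^sup>2"
    and \<zeta>: "0 \<le> \<zeta>" "\<zeta> \<le> 1" and m: "0 \<le> m" "m \<le> \<kappa>" "0 < \<kappa>" and L: "0 \<le> Lam" and \<sigma>: "\<bar>\<sigma>\<bar> = 1"
    and v: "v = (1 - \<zeta>\<^sup>2 * m\<^sup>2 / \<kappa>\<^sup>2) *\<^sub>R y + (\<sigma> * (m ^ 3 / (3 * \<kappa>\<^sup>2)) * (2 * \<zeta>)) *\<^sub>R Z"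
  shows "(A *v v) \<bullet> v \<le> (1 - \<zeta>\<^sup>2 * m\<^sup>2 / \<kappa>\<^sup>2) * ((A *v y) \<bullet> y) + Lam * (m ^ 4 / \<kappa>\<^sup>2) * (norm Z)\<^sup>2"
proof -
  define s where "s = \<zeta>\<^sup>2 * m\<^sup>2 / \<kappa>\<^sup>2"
  have "\<zeta> * m \<le> 1 * \<kappa>" using \<zeta> m by (intro mult_mono) auto
  then have "(\<zeta> * m)\<^sup>2 \<le> \<kappa>\<^sup>2" using \<zeta> m by (intro power_mono) auto
  then have s: "0 \<le> s" "s \<le> 1" using m by (auto simp: s_def power_mult_distrib divide_le_eq)
  have T: "0 \<le> Lam * (m ^ 4 / \<kappa>\<^sup>2) * (norm Z)\<^sup>2" using L by simp
  show ?thesis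
  proof (cases "s = 0")
    case True
    then have "\<zeta> = 0 \<or> m = 0" using m by (auto simp: s_def)
    then have "v = y" using v by auto
    then have "(A *v v) \<bullet> v = (1 - s) * ((A *v y) \<bullet> y)" using True by simp
    then show ?thesis using T unfolding s_def by linarith
  next
    case False
    then have nz: "\<zeta> \<noteq> 0" "m \<noteq> 0" by (auto simp: s_def)
    \<comment> \<open>Chosen so that \<open>s\<close> times this vector is the cutoff part of
      \<open>v\<close>. Dividing by \<open>\<zeta>\<close> is legitimate because the case
      \<open>s = 0\<close> has been split off.\<close>
    define X where "X = (\<sigma> * (2 * m / (3 * \<zeta>))) *\<^sub>R Z"
    have "s * (\<sigma> * (2 * m / (3 * \<zeta>))) = \<sigma> * (m ^ 3 / (3 * \<kappa>\<^sup>2)) * (2 * \<zeta>)"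
      using nz m by (simp add: s_def field_simps power2_eq_square power3_eq_cube)
    then have vs: "v = (1 - s) *\<^sub>R y + s *\<^sub>R X" by (simp add: v s_def X_def)
    have "(A *v v) \<bullet> v \<le> (1 - s) * ((A *v y) \<bullet> y) + s * ((A *v X) \<bullet> X)"
      unfolding vs by (rule quadratic_form_convex[OF ell(1) s])
    also have "s * ((A *v X) \<bullet> X) \<le> s * (Lam * (norm X)\<^sup>2)"
      using ell(2)[of X] s by (intro mult_left_mono) (auto simp: inner_commute)
    also have "s * (Lam * (norm X)\<^sup>2) = (4 / 9) * (Lam * (m ^ 4 / \<kappa>\<^sup>2) * (norm Z)\<^sup>2)"
      using nz m \<sigma> by (simp add: s_def X_def power_mult_distrib abs_mult field_simps power2_eq_square power4_eq_xxxx)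
    also have "\<dots> \<le> Lam * (m ^ 4 / \<kappa>\<^sup>2) * (norm Z)\<^sup>2" using T by simp
    finally show ?thesis by (simp add: s_def)
  qed
qed

lemma indicator_lborel_lebesgue_on:
  assumes "B \<in> sets lebesgue"
  shows "(\<integral>\<^sup>+x. f x \<partial>lebesgue_on B) = (\<integral>\<^sup>+x\<in>B. f x \<partial>lborel)"
  using assms by (subst nn_integral_restrict_space) (auto simp: nn_integral_completion)

text \<open>\<open>g\<close> is one fixed Borel representative of the gradient. As
  \<open>local_min\<close> compares energies for every choice of weak gradients, \<open>g\<close>
  may be inserted there.\<close>

locale minimizer =
  fixes \<Omega> :: "(real^'n) set" and A :: "real^'n \<Rightarrow> real^'n^'n" and u :: "real^'n \<Rightarrow> real" and g :: "real^'n \<Rightarrow> real^'n"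
    and lam Lam :: real
  assumes lam: "0 < lam" "lam \<le> Lam"
    and open_dom: "open \<Omega>"
    and elliptic: "elliptic_coeffs lam Lam \<Omega> A"
    and minimal: "local_min A \<Omega> u"
    and cont: "continuous_on \<Omega> u"
    and nonneg: "\<And>x. x \<in> \<Omega> \<Longrightarrow> 0 \<le> u x"
    and weak_grad: "has_weak_gradient \<Omega> u g"
    and g_borel [measurable]: "g \<in> borel_measurable borel"
    and g_L2: "(\<integral>\<^sup>+x\<in>\<Omega>. ennreal ((norm (g x))\<^sup>2) \<partial>lborel) < \<infinity>"
begin

lemma C1_approx_u:
  assumes "compact K" "K \<subseteq> \<Omega>"
  shows "C1_approx K u g"
  unfolding C1_approx_def
proof (intro allI impI)
  fix e :: real assume e: "0 < e"
  obtain \<phi> where "smooth_on UNIV \<phi>" "\<And>x. x \<in> K \<Longrightarrow> \<bar>\<phi> x - u x\<bar> \<le> e"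
    "(\<integral>\<^sup>+x\<in>K. ennreal ((norm (classical_grad \<phi> x - g x))\<^sup>2) \<partial>lborel) \<le> ennreal e"
    by (rule weak_gradient_smooth_approx[OF weak_grad open_dom cont g_borel g_L2 assms e]) rule
  then show "\<exists>\<phi> D. C1_grad \<phi> D \<and> (\<forall>x\<in>K. \<bar>\<phi> x - u x\<bar> \<le> e) \<and>
     (\<integral>\<^sup>+x\<in>K. ennreal ((norm (D x - g x))\<^sup>2) \<partial>lborel) \<le> ennreal e"
    using smooth_C1_grad by blast
qed

lemma g_L2_on:
  assumes "K \<subseteq> \<Omega>"
  shows "(\<integral>\<^sup>+x\<in>K. ennreal ((norm (g x))\<^sup>2) \<partial>lborel) < \<infinity>"
  by (rule le_less_trans[OF nn_integral_mono g_L2]) (use assms in \<open>auto simp: indicator_def\<close>)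

lemma u_restrict_borel:
  assumes "compact K" "K \<subseteq> \<Omega>"
  shows "(\<lambda>x. indicator K x * u x) \<in> borel_measurable borel"
  by (rule borel_indicator_continuous[OF continuous_on_subset[OF cont assms(2)] borel_compact[OF assms(1)]])

text \<open>The indicator changes nothing on \<open>K\<close> but makes the inner function Borel on
  the whole space, so that compositions can enter integrals over \<open>lborel\<close>.\<close>

lemma C1_approx_compose_u:
  assumes K: "compact K" "K \<subseteq> \<Omega>" and F: "\<And>t. (F has_real_derivative F' t) (at t)" "continuous_on UNIV F'"
  shows "C1_approx K (\<lambda>x. F (indicator K x * u x)) (\<lambda>x. F' (indicator K x * u x) *\<^sub>R g x)"
proof (rule C1_approx_compose[OF _ K(1) _ g_borel g_L2_on[OF K(2)] F])
  show "C1_approx K (\<lambda>x. indicator K x * u x) g"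
    using C1_approx_u[OF K] by (simp add: C1_approx_def)
  show "continuous_on K (\<lambda>x. indicator K x * u x)"
    using continuous_on_subset[OF cont K(2)] by (rule continuous_on_eq) simp
qed

text \<open>With \<open>m\<close> the positive part of \<open>\<sigma> (u - k)\<close>, the competitor is \<open>u - \<sigma> \<zeta>\<^sup>2 m\<^sup>3 / (3 \<kappa>\<^sup>2)\<close>:
  its gradient is a convex combination of \<open>g\<close> and a multiple of \<open>\<nabla>\<zeta>\<close>, with weight
  \<open>\<zeta>\<^sup>2 m\<^sup>2 / \<kappa>\<^sup>2\<close>. The cubic power keeps the truncation continuously differentiable.\<close>

lemma caccioppoli:
  assumes r: "cball \<xi> r \<subseteq> \<Omega>" "r1 < r" "0 < r" and \<sigma>: "\<sigma> = 1 \<or> \<sigma> = -1" and \<kappa>: "0 < \<kappa>"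
    and bd: "\<And>x. x \<in> ball \<xi> r \<Longrightarrow> \<sigma> * (u x - k) \<le> \<kappa>"
    and \<zeta>: "C1_grad \<zeta> Z" "\<And>x. 0 \<le> \<zeta> x" "\<And>x. \<zeta> x \<le> 1"
      "\<And>x. r1 < dist \<xi> x \<Longrightarrow> \<zeta> x = 0 \<and> Z x = 0"
  shows "ennreal lam * (\<integral>\<^sup>+x\<in>ball \<xi> r. ennreal ((\<zeta> x)\<^sup>2 * (max 0 (\<sigma> * (u x - k)))\<^sup>2 * (norm (g x))\<^sup>2) \<partial>lborel)
    \<le> ennreal Lam * (\<integral>\<^sup>+x\<in>ball \<xi> r. ennreal ((max 0 (\<sigma> * (u x - k))) ^ 4 * (norm (Z x))\<^sup>2) \<partial>lborel)
      + ennreal (2 * \<kappa>\<^sup>2) * emeasure lborel {x \<in> ball \<xi> r. 0 < \<sigma> * (u x - k) \<and> \<zeta> x \<noteq> 0}"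
proof -
  let ?B = "ball \<xi> r" and ?M = "lebesgue_on (ball \<xi> r)"
  define m where "m = (\<lambda>x. max 0 (\<sigma> * (u x - k)))"
  have BO: "?B \<subseteq> \<Omega>" "cball \<xi> r \<subseteq> \<Omega>" using r by auto
  have \<sigma>2: "\<sigma> * \<sigma> = 1" "\<bar>\<sigma>\<bar> = 1" using \<sigma> by auto
  \<comment> \<open>The exponent \<open>Suc (Suc 1)\<close> is \<open>3\<close>. The factor
    \<open>1 / (3 * \<kappa>^2)\<close> normalises \<open>F'\<close> to
    \<open>-(m / \<kappa>)^2\<close>, which lies in \<open>[-1, 0]\<close> on the ball because
    \<open>m \<le> \<kappa>\<close> there.\<close>
  define F where "F = (\<lambda>t. - \<sigma> / (3 * \<kappa>\<^sup>2) * (max 0 (\<sigma> * (t - k))) ^ Suc (Suc 1))"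
  define F' where "F' = (\<lambda>t. - ((max 0 (\<sigma> * (t - k)))\<^sup>2 / \<kappa>\<^sup>2))"
  have F: "(F has_real_derivative F' t) (at t)" for t
  proof -
    have "((\<lambda>t. \<sigma> * (t - k)) has_real_derivative \<sigma>) (at t)"
      by (auto intro!: derivative_eq_intros)
    from DERIV_cmult[OF DERIV_chain2[OF max0_power_deriv[of 1] this], of "- \<sigma> / (3 * \<kappa>\<^sup>2)"]
    have "(F has_real_derivative - \<sigma> / (3 * \<kappa>\<^sup>2) * (real (Suc (Suc 1)) * max 0 (\<sigma> * (t - k)) ^ Suc 1 * \<sigma>)) (at t)"
      by (simp only: F_def)
    also have "- \<sigma> / (3 * \<kappa>\<^sup>2) * (real (Suc (Suc 1)) * max 0 (\<sigma> * (t - k)) ^ Suc 1 * \<sigma>) = (- (\<sigma> * \<sigma>) * (max 0 (\<sigma> * (t - k)))\<^sup>2) / \<kappa>\<^sup>2"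
      by (simp add: field_simps power2_eq_square)
    also have "\<dots> = F' t" by (simp add: \<sigma>2 F'_def)
    finally show ?thesis .
  qed
  have F'c: "continuous_on UNIV F'"
    unfolding F'_def by (intro continuous_intros) (use \<kappa> in auto)
  define w where "w = (\<lambda>x. (\<zeta> x * \<zeta> x) * F (u x))"
  define gw where "gw = (\<lambda>x. (\<zeta> x * \<zeta> x) *\<^sub>R (F' (u x) *\<^sub>R g x) + F (u x) *\<^sub>R (\<zeta> x *\<^sub>R Z x + \<zeta> x *\<^sub>R Z x))"
  have ucK: "continuous_on (cball \<xi> r) u" using cont BO continuous_on_subset by blast
  have \<zeta>\<zeta>: "C1_grad (\<lambda>x. \<zeta> x * \<zeta> x) (\<lambda>x. \<zeta> x *\<^sub>R Z x + \<zeta> x *\<^sub>R Z x)"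
    by (rule C1_grad_mult[OF \<zeta>(1) \<zeta>(1)])
  note [measurable] = C1_grad_borel[OF \<zeta>(1)]
  have Fcont: "continuous_on UNIV F" using F DERIV_continuous_on by blast
  have [measurable]: "F \<in> borel_measurable borel" "F' \<in> borel_measurable borel"
    using Fcont F'c borel_measurable_continuous_onI by auto
  define u' where "u' = (\<lambda>x. indicator (cball \<xi> r) x * u x)"
  have u'm[measurable]: "u' \<in> borel_measurable borel"
    unfolding u'_def by (rule u_restrict_borel[OF compact_cball BO(2)])
  define gw' where "gw' = (\<lambda>x. (\<zeta> x * \<zeta> x) *\<^sub>R (F' (u' x) *\<^sub>R g x) + F (u' x) *\<^sub>R (\<zeta> x *\<^sub>R Z x + \<zeta> x *\<^sub>R Z x))"
  have u'u: "u' x = u x" if "x \<in> cball \<xi> r" for x using that by (simp add: u'_def)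
  have gw'[measurable]: "gw' \<in> borel_measurable borel" unfolding gw'_def by measurable
  have ap: "C1_approx (cball \<xi> r) w gw'"
  proof -
    have 1: "C1_approx (cball \<xi> r) (\<lambda>x. F (u' x)) (\<lambda>x. F' (u' x) *\<^sub>R g x)"
      unfolding u'_def by (rule C1_approx_compose_u[OF compact_cball BO(2) F F'c])
    have "C1_approx (cball \<xi> r) (\<lambda>x. (\<zeta> x * \<zeta> x) * F (u' x)) gw'"
      unfolding gw'_def by (rule C1_approx_mult[OF 1 compact_cball _ \<zeta>\<zeta>]) measurable
    then show ?thesis by (simp add: C1_approx_def w_def u'u)
  qed
  have wc: "continuous_on (cball \<xi> r) w"
    unfolding w_def
    by (intro continuous_intros continuous_on_subset[OF C1_gradD(3)[OF \<zeta>(1)]] continuous_on_compose2[OF Fcont ucK]) auto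
  obtain b0 where b0: "0 < b0" "\<And>x. x \<in> cball \<xi> r \<Longrightarrow> \<bar>F (u x)\<bar> \<le> b0 \<and> norm (Z x) \<le> b0 \<and> \<bar>F' (u x)\<bar> \<le> b0"
  proof -
    have "bounded ((\<lambda>x. F (u x)) ` cball \<xi> r)"
      by (intro compact_imp_bounded compact_continuous_image compact_cball continuous_on_compose2[OF Fcont ucK]) auto
    moreover have "bounded ((\<lambda>x. F' (u x)) ` cball \<xi> r)"
      by (intro compact_imp_bounded compact_continuous_image compact_cball continuous_on_compose2[OF F'c ucK]) auto
    moreover have "bounded (Z ` cball \<xi> r)"
      by (intro compact_imp_bounded compact_continuous_image compact_cball continuous_on_subset[OF C1_gradD(2)[OF \<zeta>(1)]]) auto
    ultimately obtain b1 b2 b3 where "\<forall>x\<in>cball \<xi> r. norm (F (u x)) \<le> b1" "\<forall>x\<in>cball \<xi> r. norm (F' (u x)) \<le> b2" "\<forall>x\<in>cball \<xi> r. norm (Z x) \<le> b3"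
      unfolding bounded_iff by (metis image_eqI)
    then show ?thesis by (intro that[of "max 1 (max b1 (max b2 b3))"]) (auto simp: le_max_iff_disj)
  qed
  have gw2: "(\<integral>\<^sup>+x\<in>cball \<xi> r. ennreal ((norm (gw' x))\<^sup>2) \<partial>lborel) < \<infinity>"
  proof -
    have "(\<integral>\<^sup>+x\<in>cball \<xi> r. ennreal ((norm (gw' x))\<^sup>2) \<partial>lborel)
      \<le> ennreal (2 * b0\<^sup>2) * (\<integral>\<^sup>+x\<in>cball \<xi> r. ennreal ((norm (g x))\<^sup>2) \<partial>lborel) + ennreal (8 * b0 ^ 4) * (\<integral>\<^sup>+x\<in>cball \<xi> r. ennreal 1 \<partial>lborel)"
    proof (rule nn_integral_on_le_lin)
      fix x assume x: "x \<in> cball \<xi> r"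
      have z1: "\<zeta> x * \<zeta> x \<le> 1" "0 \<le> \<zeta> x * \<zeta> x" "\<bar>\<zeta> x\<bar> \<le> 1" using \<zeta>(2,3)[of x] by (auto intro: mult_le_one)
      have "(norm (gw' x))\<^sup>2 \<le> 2 * (norm ((\<zeta> x * \<zeta> x) *\<^sub>R (F' (u' x) *\<^sub>R g x)))\<^sup>2 + 2 * (norm (F (u' x) *\<^sub>R (\<zeta> x *\<^sub>R Z x + \<zeta> x *\<^sub>R Z x)))\<^sup>2"
        unfolding gw'_def by (rule norm_add_square_le)
      moreover have n1: "norm ((\<zeta> x * \<zeta> x) *\<^sub>R (F' (u' x) *\<^sub>R g x)) \<le> 1 * (b0 * norm (g x))"
        unfolding norm_scaleR using z1 b0(2)[OF x] u'u[OF x] by (intro mult_mono) auto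
      moreover have n2: "norm (F (u' x) *\<^sub>R (\<zeta> x *\<^sub>R Z x + \<zeta> x *\<^sub>R Z x)) \<le> b0 * (1 * b0 + 1 * b0)"
        unfolding norm_scaleR using z1 b0 x u'u[OF x]
        by (intro mult_mono order_trans[OF norm_triangle_ineq] add_mono) (auto simp: mult_le_one intro!: mult_mono[of "\<bar>\<zeta> x\<bar>" 1, simplified])
      ultimately have "(norm (gw' x))\<^sup>2 \<le> 2 * (1 * (b0 * norm (g x)))\<^sup>2 + 2 * (b0 * (1 * b0 + 1 * b0))\<^sup>2"
        using power_mono[OF n1 norm_ge_zero, of 2] power_mono[OF n2 norm_ge_zero, of 2] by linarith
      then show "(norm (gw' x))\<^sup>2 \<le> 2 * b0\<^sup>2 * (norm (g x))\<^sup>2 + 8 * b0 ^ 4 * 1"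
        by (simp add: power2_eq_square power4_eq_xxxx algebra_simps)
    qed auto
    also have "\<dots> < \<infinity>"
      using g_L2_on[OF BO(2)] emeasure_bounded_finite[of "cball \<xi> r"] by (simp add: ennreal_mult_less_top)
    finally show ?thesis .
  qed
  have wgw: "has_weak_gradient ?B w gw'"
    by (rule weak_gradient_of_C1_approx[OF ap compact_cball open_ball ball_subset_cball wc gw' gw2])
  have H10: "H10_on ?B w"
  proof (rule H10_on_ballI[OF r(2) continuous_on_subset[OF wc ball_subset_cball] wgw gw'])
    show "(\<integral>\<^sup>+x\<in>?B. ennreal ((norm (gw' x))\<^sup>2) \<partial>lborel) < \<infinity>"
      by (rule le_less_trans[OF nn_integral_mono gw2]) (auto simp: indicator_def)
    show "w x = 0 \<and> gw' x = 0" if "r1 < dist \<xi> x" for x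
      using \<zeta>(4)[OF that] by (simp add: w_def gw'_def)
  qed
  have wv: "has_weak_gradient ?B (\<lambda>x. u x + w x) (\<lambda>x. g x + gw' x)"
    by (rule has_weak_gradient_add[OF weak_grad open_dom open_ball BO(1) wgw])
  have E: "energy A ?B u g \<le> energy A ?B (\<lambda>x. u x + w x) (\<lambda>x. g x + gw' x)"
  proof -
    have h: "H10_on ?B (\<lambda>x. (u x + w x) - u x)" using H10 by simp
    have lm: "\<And>v gv. H10_on ?B (\<lambda>x. v x - u x) \<Longrightarrow> has_weak_gradient ?B v gv \<Longrightarrow>
        energy A ?B u g \<le> energy A ?B v gv"
      using minimal r(1,3) weak_grad by (simp add: local_min_def)
    show ?thesis by (rule lm[OF h wv])
  qed
  have leb: "?B \<in> sets lebesgue" by simp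
  define s where "s = (\<lambda>x. (\<zeta> x)\<^sup>2 * (m x)\<^sup>2 / \<kappa>\<^sup>2)"
  define Q where "Q = (\<lambda>x. (A x *v g x) \<bullet> g x)"
  define N where "N = {x. 0 < \<sigma> * (u x - k) \<and> \<zeta> x \<noteq> 0}"
  \<comment> \<open>\<open>P\<close> is the part of the energy density of \<open>u\<close> that
    survives in the bound for the competitor. Its integral is finite, so it cancels from the
    comparison and leaves \<open>s * Q / 2\<close> against \<open>T\<close>.\<close>
  define P where "P = (\<lambda>x. (1/2) * ((1 - s x) * Q x) + indicator {Y. u Y > 0} x)"
  define T where "T = (\<lambda>x. (1/2) * (Lam * (m x ^ 4 / \<kappa>\<^sup>2) * (norm (Z x))\<^sup>2) + indicator N x)"
  have ell: "AE x in ?M. x \<in> ?B \<and> (\<forall>z. lam * (norm z)\<^sup>2 \<le> z \<bullet> (A x *v z) \<and> z \<bullet> (A x *v z) \<le> Lam * (norm z)\<^sup>2)"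
  proof -
    have "AE x in lebesgue_on \<Omega>. transpose (A x) = A x \<and>
        (\<forall>z. lam * (norm z)\<^sup>2 \<le> z \<bullet> (A x *v z) \<and> z \<bullet> (A x *v z) \<le> Lam * (norm z)\<^sup>2)"
      using elliptic by (simp add: elliptic_coeffs_def)
    then show ?thesis
      using open_dom BO(1) by (subst (asm) AE_restrict_space_iff, simp, subst AE_restrict_space_iff, simp) (auto elim!: eventually_mono)
  qed
  have [measurable]: "u \<in> borel_measurable ?M"
    by (rule continuous_imp_measurable_on_sets_lebesgue[OF continuous_on_subset[OF ucK ball_subset_cball] leb])
  have Aij: "(\<lambda>x. A x $ i $ j) \<in> borel_measurable ?M" for i j
    using elliptic BO(1) measurable_restrict_mono unfolding elliptic_coeffs_def by blast
  have [measurable]: "\<zeta> \<in> borel_measurable ?M" "Z \<in> borel_measurable ?M" "g \<in> borel_measurable ?M"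
    by (auto intro!: borel_measurable_lebesgue_on)
  have [measurable]: "Q \<in> borel_measurable ?M"
    unfolding Q_def inner_vec_def matrix_vector_mult_def inner_real_def
    by (auto intro!: borel_measurable_sum borel_measurable_times Aij borel_measurable_vec_component)
  have [measurable]: "m \<in> borel_measurable ?M" unfolding m_def by measurable
  have [measurable]: "s \<in> borel_measurable ?M" unfolding s_def by measurable
  have Nm: "N \<inter> ?B = ?B \<inter> {x. 0 < \<sigma> * (u' x - k) \<and> \<zeta> x \<noteq> 0}"
    using u'u by (auto simp: N_def)
  have "{x. 0 < \<sigma> * (u' x - k) \<and> \<zeta> x \<noteq> 0} \<in> sets borel" by measurable
  then have NB: "N \<inter> ?B \<in> sets borel" unfolding Nm by auto
  have iN[measurable]: "(indicator N :: _ \<Rightarrow> real) \<in> borel_measurable ?M"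
  proof -
    have "{x \<in> space ?M. 0 < \<sigma> * (u x - k) \<and> \<zeta> x \<noteq> 0} \<in> sets ?M" by measurable
    moreover have "{x \<in> space ?M. 0 < \<sigma> * (u x - k) \<and> \<zeta> x \<noteq> 0} = N \<inter> space ?M" by (auto simp: N_def)
    ultimately show ?thesis by (simp add: borel_measurable_indicator_iff)
  qed
  have iU[measurable]: "(indicator {Y. u Y > 0} :: _ \<Rightarrow> real) \<in> borel_measurable ?M"
  proof -
    have "{x \<in> space ?M. u x > 0} \<in> sets ?M" by measurable
    moreover have "{x \<in> space ?M. u x > 0} = {Y. u Y > 0} \<inter> space ?M" by auto
    ultimately show ?thesis by (simp add: borel_measurable_indicator_iff)
  qed
  have [measurable]: "P \<in> borel_measurable ?M" unfolding P_def by measurable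
  have [measurable]: "T \<in> borel_measurable ?M" unfolding T_def by measurable
  have m: "0 \<le> m x" "m x \<le> \<kappa>" if "x \<in> ?B" for x
    using bd[OF that] \<kappa> by (auto simp: m_def)
  have s01: "0 \<le> s x" "s x \<le> 1" if "x \<in> ?B" for x
  proof -
    have "\<zeta> x * m x \<le> 1 * \<kappa>" using \<zeta>(2,3) m[OF that] by (intro mult_mono) auto
    then have "(\<zeta> x * m x)\<^sup>2 \<le> \<kappa>\<^sup>2" using \<zeta>(2) m[OF that] by (intro power_mono) auto
    then show "s x \<le> 1" using \<kappa> by (simp add: s_def power_mult_distrib divide_le_eq)
    show "0 \<le> s x" by (simp add: s_def)
  qed
  have L0: "0 \<le> Lam" using lam by linarith
  have Tnn: "0 \<le> T x" for x using L0 by (simp add: T_def)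
  have Eu: "energy A ?B u g = (\<integral>\<^sup>+x. ennreal (P x) \<partial>?M) + (\<integral>\<^sup>+x. ennreal ((1/2) * (s x * Q x)) \<partial>?M)"
  proof -
    have "energy A ?B u g = (\<integral>\<^sup>+x. ennreal (P x) + ennreal ((1/2) * (s x * Q x)) \<partial>?M)"
      unfolding energy_def
    proof (rule nn_integral_cong_AE)
      show "AE x in ?M. ennreal (1/2 * ((A x *v g x) \<bullet> g x) + indicator {Y. 0 < u Y} x)
         = ennreal (P x) + ennreal ((1/2) * (s x * Q x))"
        using ell
      proof eventually_elim
        case (elim x)
        have "0 \<le> lam * (norm (g x))\<^sup>2" using lam by simp
        also have "\<dots> \<le> Q x" using elim by (simp add: Q_def inner_commute)
        finally have Q0: "0 \<le> Q x" .
        have "0 \<le> P x" "0 \<le> (1/2) * (s x * Q x)" using s01[of x] elim Q0 by (auto simp: P_def)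
        then have "ennreal (P x) + ennreal ((1/2) * (s x * Q x)) = ennreal (P x + (1/2) * (s x * Q x))"
          by (rule ennreal_plus[symmetric])
        also have "P x + (1/2) * (s x * Q x) = 1/2 * ((A x *v g x) \<bullet> g x) + indicator {Y. 0 < u Y} x"
          by (simp add: P_def Q_def algebra_simps)
        finally show ?case by simp
      qed
    qed
    then show ?thesis by (simp add: nn_integral_add)
  qed
  have Ev: "energy A ?B (\<lambda>x. u x + w x) (\<lambda>x. g x + gw' x) \<le> (\<integral>\<^sup>+x. ennreal (P x) \<partial>?M) + (\<integral>\<^sup>+x. ennreal (T x) \<partial>?M)"
  proof -
    have "energy A ?B (\<lambda>x. u x + w x) (\<lambda>x. g x + gw' x) \<le> (\<integral>\<^sup>+x. ennreal (P x) + ennreal (T x) \<partial>?M)"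
      unfolding energy_def
    proof (rule nn_integral_mono_AE)
      show "AE x in ?M. ennreal (1/2 * ((A x *v (g x + gw' x)) \<bullet> (g x + gw' x)) + indicator {Y. 0 < u Y + w Y} x)
         \<le> ennreal (P x) + ennreal (T x)"
        using ell
      proof eventually_elim
        case (elim x)
        then have x: "x \<in> ?B" and el: "\<And>z. lam * (norm z)\<^sup>2 \<le> z \<bullet> (A x *v z)" "\<And>z. z \<bullet> (A x *v z) \<le> Lam * (norm z)\<^sup>2"
          by auto
        have el0: "0 \<le> z \<bullet> (A x *v z)" for z
          using order_trans[OF _ el(1)[of z], of 0] lam by simp
        have xc: "x \<in> cball \<xi> r" using x by auto
        have gv: "g x + gw' x = (1 - (\<zeta> x)\<^sup>2 * (m x)\<^sup>2 / \<kappa>\<^sup>2) *\<^sub>R g x + ((- \<sigma>) * (m x ^ 3 / (3 * \<kappa>\<^sup>2)) * (2 * \<zeta> x)) *\<^sub>R Z x"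
        proof -
          have "F (u' x) = (- \<sigma>) * (m x ^ 3 / (3 * \<kappa>\<^sup>2))" "F' (u' x) = - ((m x)\<^sup>2 / \<kappa>\<^sup>2)"
            using u'u[OF xc] by (simp_all add: F_def F'_def m_def numeral_3_eq_3)
          then show ?thesis
            by (simp add: gw'_def scaleR_add_left[symmetric] scaleR_diff_left power2_eq_square algebra_simps)
        qed
        have "(A x *v (g x + gw' x)) \<bullet> (g x + gw' x) \<le> (1 - s x) * Q x + Lam * (m x ^ 4 / \<kappa>\<^sup>2) * (norm (Z x))\<^sup>2"
          unfolding s_def Q_def
          by (rule competitor_energy_pointwise[OF el0 el(2) \<zeta>(2,3) m[OF x] \<kappa> L0 _ gv]) (use \<sigma>2 in simp)
        \<comment> \<open>The competitor differs from \<open>u\<close> only on \<open>N\<close>, so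
          the positivity set can grow only there. The same crude bound serves truncations from above
          and from below.\<close>
        moreover have "indicator {Y. 0 < u Y + w Y} x \<le> (indicator {Y. 0 < u Y} x + indicator N x :: real)"
        proof (cases "x \<in> N")
          case False
          then have "w x = 0" by (auto simp: N_def w_def F_def max_def)
          then show ?thesis by (simp add: indicator_def)
        qed (auto simp: indicator_def)
        ultimately have "1/2 * ((A x *v (g x + gw' x)) \<bullet> (g x + gw' x)) + indicator {Y. 0 < u Y + w Y} x \<le> P x + T x"
          by (simp add: P_def T_def)
        moreover have "0 \<le> P x"
          using s01[OF x] el0[of "g x"] by (auto simp: P_def Q_def inner_commute)
        ultimately show ?case using Tnn[of x] by (simp add: ennreal_plus[symmetric] ennreal_leI del: ennreal_plus)
      qed
    qed
    then show ?thesis by (simp add: nn_integral_add)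
  qed
  have Pfin: "(\<integral>\<^sup>+x. ennreal (P x) \<partial>?M) \<noteq> top"
  proof -
    have "(\<integral>\<^sup>+x. ennreal (P x) \<partial>?M) \<le> (\<integral>\<^sup>+x. ennreal Lam * ennreal ((norm (g x))\<^sup>2) + 1 \<partial>?M)"
    proof (rule nn_integral_mono_AE)
      show "AE x in ?M. ennreal (P x) \<le> ennreal Lam * ennreal ((norm (g x))\<^sup>2) + 1"
        using ell
      proof eventually_elim
        case (elim x)
        then have "Q x \<le> Lam * (norm (g x))\<^sup>2" by (simp add: Q_def inner_commute)
        moreover have "0 \<le> lam * (norm (g x))\<^sup>2" using lam by simp
        moreover have "lam * (norm (g x))\<^sup>2 \<le> Q x" using elim by (simp add: Q_def inner_commute)
        ultimately have q: "0 \<le> Q x" "Q x \<le> Lam * (norm (g x))\<^sup>2" by linarith+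
        then have "(1 - s x) * Q x \<le> 1 * Q x" using s01[of x] elim by (intro mult_right_mono) auto
        then have "P x \<le> Lam * (norm (g x))\<^sup>2 + 1"
          using q by (auto simp: P_def indicator_def)
        then have "ennreal (P x) \<le> ennreal (Lam * (norm (g x))\<^sup>2 + 1)" by (rule ennreal_leI)
        then show ?case using L0 by (simp add: ennreal_mult)
      qed
    qed
    also have "\<dots> = ennreal Lam * (\<integral>\<^sup>+x. ennreal ((norm (g x))\<^sup>2) \<partial>?M) + emeasure ?M (space ?M)"
      by (simp add: nn_integral_add nn_integral_cmult)
    also have "\<dots> < top"
      using g_L2_on[OF BO(1)] emeasure_bounded_finite[of ?B]
      by (simp add: indicator_lborel_lebesgue_on[OF leb] emeasure_restrict_space ennreal_mult_less_top)
    finally show ?thesis by simp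
  qed
  have R: "(\<integral>\<^sup>+x. ennreal ((1/2) * (s x * Q x)) \<partial>?M) \<le> (\<integral>\<^sup>+x. ennreal (T x) \<partial>?M)"
    using order_trans[OF E[unfolded Eu] Ev] Pfin by (simp add: ennreal_add_left_cancel_le)
  have "ennreal lam * (\<integral>\<^sup>+x\<in>?B. ennreal ((\<zeta> x)\<^sup>2 * (m x)\<^sup>2 * (norm (g x))\<^sup>2) \<partial>lborel)
     = (\<integral>\<^sup>+x. ennreal lam * ennreal ((\<zeta> x)\<^sup>2 * (m x)\<^sup>2 * (norm (g x))\<^sup>2) \<partial>?M)"
    by (simp add: indicator_lborel_lebesgue_on[OF leb, symmetric] nn_integral_cmult)
  also have "\<dots> \<le> (\<integral>\<^sup>+x. ennreal (2 * \<kappa>\<^sup>2) * ennreal ((1/2) * (s x * Q x)) \<partial>?M)"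
  proof (rule nn_integral_mono_AE)
    show "AE x in ?M. ennreal lam * ennreal ((\<zeta> x)\<^sup>2 * (m x)\<^sup>2 * (norm (g x))\<^sup>2) \<le> ennreal (2 * \<kappa>\<^sup>2) * ennreal ((1/2) * (s x * Q x))"
      using ell
    proof eventually_elim
      case (elim x)
      then have q: "lam * (norm (g x))\<^sup>2 \<le> Q x" by (simp add: Q_def inner_commute)
      have sk: "(\<zeta> x)\<^sup>2 * (m x)\<^sup>2 = s x * \<kappa>\<^sup>2" using \<kappa> by (simp add: s_def)
      have "lam * ((\<zeta> x)\<^sup>2 * (m x)\<^sup>2 * (norm (g x))\<^sup>2) = (s x * \<kappa>\<^sup>2) * (lam * (norm (g x))\<^sup>2)"
        unfolding sk by (simp add: algebra_simps)
      also have "\<dots> \<le> (s x * \<kappa>\<^sup>2) * Q x" using q s01[of x] elim by (intro mult_left_mono) auto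
      also have "\<dots> = (2 * \<kappa>\<^sup>2) * ((1/2) * (s x * Q x))" by simp
      finally show ?case using lam
        by (simp only: ennreal_mult'[symmetric] less_imp_le zero_le_power2 mult_nonneg_nonneg zero_le_numeral ennreal_leI)
    qed
  qed
  also have "\<dots> = ennreal (2 * \<kappa>\<^sup>2) * (\<integral>\<^sup>+x. ennreal ((1/2) * (s x * Q x)) \<partial>?M)"
    by (rule nn_integral_cmult) measurable
  also have "\<dots> \<le> ennreal (2 * \<kappa>\<^sup>2) * (\<integral>\<^sup>+x. ennreal (T x) \<partial>?M)"
    by (intro mult_left_mono R) auto
  also have "\<dots> = (\<integral>\<^sup>+x. ennreal (2 * \<kappa>\<^sup>2) * ennreal (T x) \<partial>?M)"
    by (rule nn_integral_cmult[symmetric]) measurable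
  also have "\<dots> = (\<integral>\<^sup>+x. ennreal Lam * ennreal (m x ^ 4 * (norm (Z x))\<^sup>2) + ennreal (2 * \<kappa>\<^sup>2) * indicator N x \<partial>?M)"
  proof (rule nn_integral_cong)
    fix x
    have "ennreal (2 * \<kappa>\<^sup>2) * ennreal (T x) = ennreal (2 * \<kappa>\<^sup>2 * T x)"
      using Tnn[of x] by (simp add: ennreal_mult)
    also have "2 * \<kappa>\<^sup>2 * T x = Lam * (m x ^ 4 * (norm (Z x))\<^sup>2) + 2 * \<kappa>\<^sup>2 * indicator N x"
      using \<kappa> by (simp add: T_def field_simps)
    also have "ennreal \<dots> = ennreal Lam * ennreal (m x ^ 4 * (norm (Z x))\<^sup>2) + ennreal (2 * \<kappa>\<^sup>2) * indicator N x"
      using L0 by (cases "x \<in> N") (auto simp: ennreal_mult)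
    finally show "ennreal (2 * \<kappa>\<^sup>2) * ennreal (T x) = ennreal Lam * ennreal (m x ^ 4 * (norm (Z x))\<^sup>2) + ennreal (2 * \<kappa>\<^sup>2) * indicator N x" .
  qed
  also have "\<dots> = ennreal Lam * (\<integral>\<^sup>+x. ennreal (m x ^ 4 * (norm (Z x))\<^sup>2) \<partial>?M) + ennreal (2 * \<kappa>\<^sup>2) * (\<integral>\<^sup>+x. indicator N x \<partial>?M)"
  proof -
    have [measurable]: "(indicator N :: _ \<Rightarrow> ennreal) \<in> borel_measurable ?M"
      using iN by (simp add: borel_measurable_indicator_iff)
    show ?thesis by (simp add: nn_integral_add nn_integral_cmult del: nn_integral_indicator)
  qed
  also have "(\<integral>\<^sup>+x. indicator N x \<partial>?M) = emeasure lborel (N \<inter> ?B)"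
  proof -
    have "(\<integral>\<^sup>+x. indicator N x \<partial>?M) = (\<integral>\<^sup>+x. indicator (N \<inter> ?B) x \<partial>lborel)"
      unfolding indicator_lborel_lebesgue_on[OF leb] by (rule nn_integral_cong) (auto simp: indicator_def)
    then show ?thesis using NB by simp
  qed
  also have "N \<inter> ?B = {x \<in> ?B. 0 < \<sigma> * (u x - k) \<and> \<zeta> x \<noteq> 0}" by (auto simp: N_def)
  also have "(\<integral>\<^sup>+x. ennreal (m x ^ 4 * (norm (Z x))\<^sup>2) \<partial>?M) = (\<integral>\<^sup>+x\<in>?B. ennreal (m x ^ 4 * (norm (Z x))\<^sup>2) \<partial>lborel)"
    by (rule indicator_lborel_lebesgue_on[OF leb])
  finally show ?thesis unfolding m_def .
qed

end

section \<open>Tools for the De Giorgi iteration\<close>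

definition ramp :: "real \<Rightarrow> real" where
  "ramp t = (max 0 (1 - (max 0 t)\<^sup>2))\<^sup>2"

definition ramp' :: "real \<Rightarrow> real" where
  "ramp' t = - 4 * max 0 (1 - (max 0 t)\<^sup>2) * max 0 t"

lemma ramp_deriv: "(ramp has_real_derivative ramp' t) (at t)"
proof -
  have p: "((\<lambda>t. (max 0 t)\<^sup>2) has_real_derivative 2 * max 0 t) (at t)" for t :: real
    using max0_power_deriv[of 0 t] by (simp add: numeral_2_eq_2)
  have "((\<lambda>t. 1 - (max 0 t)\<^sup>2) has_real_derivative (0 - 2 * max 0 t)) (at t)"
    by (rule DERIV_diff[OF DERIV_const p])
  from DERIV_chain2[OF p this] show ?thesis
    by (simp add: ramp_def[abs_def] ramp'_def mult.assoc)
qed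

lemma ramp'_cont: "continuous_on UNIV ramp'"
  unfolding ramp'_def by (intro continuous_intros)

lemma ramp_values: "t \<le> 0 \<Longrightarrow> ramp t = 1" "1 \<le> t \<Longrightarrow> ramp t = 0" "1 \<le> t \<Longrightarrow> ramp' t = 0" "t \<le> 0 \<Longrightarrow> ramp' t = 0"
  "0 \<le> ramp t" "ramp t \<le> 1" "\<bar>ramp' t\<bar> \<le> 4"
proof -
  show "ramp t = 1" if "t \<le> 0" using that by (simp add: ramp_def)
  show "ramp' t = 0" if "t \<le> 0" using that by (simp add: ramp'_def)
  have 1: "1 - (max 0 t)\<^sup>2 \<le> 0" if "1 \<le> t" using that power_mono[of 1 t 2] by simp
  show "ramp t = 0" if "1 \<le> t" using 1[OF that] by (simp add: ramp_def)
  show s1: "ramp' t = 0" if "1 \<le> t" using 1[OF that] by (simp add: ramp'_def)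
  show "0 \<le> ramp t" by (simp add: ramp_def)
  have q: "0 \<le> max 0 (1 - (max 0 t)\<^sup>2)" "max 0 (1 - (max 0 t)\<^sup>2) \<le> 1" by auto
  show "ramp t \<le> 1" unfolding ramp_def using q by (simp add: power_le_one)
  show "\<bar>ramp' t\<bar> \<le> 4"
  proof (cases "1 \<le> t")
    case False
    have "\<bar>ramp' t\<bar> = 4 * (max 0 (1 - (max 0 t)\<^sup>2) * max 0 t)" by (simp add: ramp'_def abs_mult)
    also have "\<dots> \<le> 4 * (1 * 1)" using q False by (intro mult_left_mono mult_mono) auto
    finally show ?thesis by simp
  qed (simp add: s1)
qed

lemma C1_grad_dist_square: "0 < b \<Longrightarrow> C1_grad (\<lambda>x::real^'n. ((x - \<xi>) \<bullet> (x - \<xi>) - a) / b) (\<lambda>x. (2 / b) *\<^sub>R (x - \<xi>))"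
  unfolding C1_grad_def
proof
  assume b: "0 < b"
  have "((\<lambda>x::real^'n. ((x - \<xi>) \<bullet> (x - \<xi>) - a) / b) has_derivative (\<lambda>h. ((x - \<xi>) \<bullet> h + h \<bullet> (x - \<xi>)) / b)) (at x)" for x
    using b by (auto intro!: derivative_eq_intros)
  then show "\<forall>x. ((\<lambda>x::real^'n. ((x - \<xi>) \<bullet> (x - \<xi>) - a) / b) has_derivative (\<lambda>h. ((2 / b) *\<^sub>R (x - \<xi>)) \<bullet> h)) (at x)"
    by (simp add: inner_commute)
  show "continuous_on UNIV (\<lambda>x. (2 / b) *\<^sub>R (x - \<xi>))" by (intro continuous_intros)
qed

text \<open>The profile is built from squared positive parts, hence is \<open>C^1\<close>, and its
  argument is the squared distance, so the composition is differentiable at the centre too. The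
  cutoff vanishes already from the midpoint radius on, which leaves the annulus that competitors
  need.\<close>

lemma cutoff_exists:
  fixes \<xi> :: "real^'n"
  assumes \<rho>: "0 < \<rho>" "\<rho> < r"
  obtains \<zeta> Z where "C1_grad \<zeta> Z" "\<And>x. 0 \<le> \<zeta> x" "\<And>x. \<zeta> x \<le> 1" "\<And>x. dist \<xi> x \<le> \<rho> \<Longrightarrow> \<zeta> x = 1 \<and> Z x = 0"
    "\<And>x. (\<rho> + r) / 2 < dist \<xi> x \<Longrightarrow> \<zeta> x = 0 \<and> Z x = 0" "\<And>x. norm (Z x) \<le> 16 / (r - \<rho>)"
proof -
  define r1 where "r1 = (\<rho> + r) / 2"
  have r1: "\<rho> < r1" "r1 < r" "r - \<rho> = 2 * (r1 - \<rho>)" using \<rho> by (auto simp: r1_def)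
  define b where "b = r1\<^sup>2 - \<rho>\<^sup>2"
  have b: "0 < b" using \<rho> r1 by (simp add: b_def power_strict_mono)
  define q where "q = (\<lambda>x. ((x - \<xi>) \<bullet> (x - \<xi>) - \<rho>\<^sup>2) / b)"
  have q: "q x = ((dist \<xi> x)\<^sup>2 - \<rho>\<^sup>2) / b" for x
  proof -
    have "dist \<xi> x = norm (x - \<xi>)" by (simp add: dist_norm norm_minus_commute)
    then show ?thesis by (simp add: q_def power2_norm_eq_inner)
  qed
  have q0: "q x \<le> 0" if "dist \<xi> x \<le> \<rho>" for x
    using that b power_mono[OF that, of 2] by (simp add: q divide_le_0_iff)
  have q1: "1 \<le> q x" if "r1 \<le> dist \<xi> x" for x
    using power_mono[OF that, of 2] r1 \<rho> b by (simp add: q b_def)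
  show ?thesis
  proof (rule that[of "\<lambda>x. ramp (q x)" "\<lambda>x. ramp' (q x) *\<^sub>R ((2 / b) *\<^sub>R (x - \<xi>))"])
    show "C1_grad (\<lambda>x. ramp (q x)) (\<lambda>x. ramp' (q x) *\<^sub>R ((2 / b) *\<^sub>R (x - \<xi>)))"
      unfolding q_def by (rule C1_grad_compose[OF C1_grad_dist_square[OF b] ramp_deriv ramp'_cont])
    show "ramp (q x) = 1 \<and> ramp' (q x) *\<^sub>R ((2 / b) *\<^sub>R (x - \<xi>)) = 0" if "dist \<xi> x \<le> \<rho>" for x
      using ramp_values[of "q x"] q0[OF that] by simp
    show "ramp (q x) = 0 \<and> ramp' (q x) *\<^sub>R ((2 / b) *\<^sub>R (x - \<xi>)) = 0" if "(\<rho> + r) / 2 < dist \<xi> x" for x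
      using ramp_values[of "q x"] q1[of x] that by (simp add: r1_def)
    show "norm (ramp' (q x) *\<^sub>R ((2 / b) *\<^sub>R (x - \<xi>))) \<le> 16 / (r - \<rho>)" for x
    proof (cases "r1 \<le> dist \<xi> x")
      case True
      then show ?thesis using ramp_values(3)[OF q1[OF True]] \<rho> by simp
    next
      case False
      have "norm (ramp' (q x) *\<^sub>R ((2 / b) *\<^sub>R (x - \<xi>))) = \<bar>ramp' (q x)\<bar> * (2 / b * dist \<xi> x)"
        using b by (simp add: dist_norm norm_minus_commute abs_mult)
      also have "\<dots> \<le> 4 * (2 / b * r1)"
        using ramp_values(7)[of "q x"] False b by (intro mult_mono) auto
      also have "\<dots> \<le> 4 * (2 / (r1 - \<rho>))"
      proof -
        \<comment> \<open>\<open>b\<close> factors as \<open>(r1 - \<rho>) * (r1 + \<rho>)\<close>.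
          The final \<open>16\<close> is \<open>4\<close> from \<open>ramp'\<close>,
          \<open>2\<close> from the squared distance, and \<open>2\<close> because
          \<open>r1 - \<rho>\<close> is half of \<open>r - \<rho>\<close>.\<close>
        have "r1 * (r1 - \<rho>) \<le> b" using \<rho> r1 by (simp add: b_def power2_eq_square algebra_simps mult_right_mono)
        then have "r1 / b \<le> 1 / (r1 - \<rho>)" using b r1 by (simp add: field_simps)
        then show ?thesis by simp
      qed
      also have "\<dots> = 16 / (r - \<rho>)" unfolding r1(3) using r1(1) by (simp add: field_simps)
      finally show ?thesis .
    qed
  qed (use ramp_values in auto)
qed

text \<open>Averaging the translation bound over a ball whose volume is at least twice that of the support
  of \<open>V\<close> replaces the Sobolev inequality.\<close>

lemma faber_krahn_L1:
  fixes V :: "real^'n \<Rightarrow> real"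
  assumes [measurable]: "V \<in> borel_measurable borel" "S \<in> sets borel" and V0: "\<And>x. 0 \<le> V x"
    and Vfin: "(\<integral>\<^sup>+x. ennreal (V x) \<partial>lborel) < \<infinity>" and supp: "\<And>x. V x \<noteq> 0 \<Longrightarrow> x \<in> S" and h: "0 < h"
    and vol: "2 * emeasure lborel {x. V x \<noteq> 0} \<le> emeasure lborel (ball (0::real^'n) h)"
    and tr: "\<And>z. norm z < h \<Longrightarrow> (\<integral>\<^sup>+x\<in>S. ennreal \<bar>V (x + z) - V x\<bar> \<partial>lborel) \<le> ennreal (norm z) * G"
  shows "(\<integral>\<^sup>+x. ennreal (V x) \<partial>lborel) \<le> ennreal (2 * h) * G"
proof (cases "G = top")
  case True
  then show ?thesis using h by (simp add: ennreal_mult_top)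
next
  case False
  define I where "I = (\<integral>\<^sup>+x. ennreal (V x) \<partial>lborel)"
  define S0 where "S0 = {x. V x \<noteq> 0}"
  have [measurable]: "S0 \<in> sets borel" unfolding S0_def by measurable
  define b where "b = emeasure lborel (ball (0::real^'n) h)"
  have b: "0 < b" "b < top"
    using h emeasure_bounded_finite[of "ball (0::real^'n) h"] by (auto simp: b_def emeasure_ball)
  \<comment> \<open>Where \<open>V\<close> does not vanish, its value is recovered from a translate
    plus the translation error.\<close>
  have ptw: "I \<le> ennreal h * G + (\<integral>\<^sup>+x\<in>S0. ennreal (V (x + z)) \<partial>lborel)" if z: "norm z < h" for z
  proof -
    have "I \<le> (\<integral>\<^sup>+x. ennreal \<bar>V (x + z) - V x\<bar> * indicator S x + ennreal (V (x + z)) * indicator S0 x \<partial>lborel)"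
      unfolding I_def
    proof (rule nn_integral_mono)
      fix x
      show "ennreal (V x) \<le> ennreal \<bar>V (x + z) - V x\<bar> * indicator S x + ennreal (V (x + z)) * indicator S0 x"
      proof (cases "V x = 0")
        case False
        have "ennreal (V x) \<le> ennreal (\<bar>V (x + z) - V x\<bar> + V (x + z))" by (intro ennreal_leI) linarith
        then show ?thesis using False supp[of x] V0[of "x + z"] by (simp add: S0_def)
      qed simp
    qed
    also have "\<dots> = (\<integral>\<^sup>+x\<in>S. ennreal \<bar>V (x + z) - V x\<bar> \<partial>lborel) + (\<integral>\<^sup>+x\<in>S0. ennreal (V (x + z)) \<partial>lborel)"
      by (rule nn_integral_add) measurable
    also have "\<dots> \<le> ennreal h * G + (\<integral>\<^sup>+x\<in>S0. ennreal (V (x + z)) \<partial>lborel)"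
      using z by (intro add_mono order_trans[OF tr[OF z]] mult_right_mono ennreal_leI) auto
    finally show ?thesis .
  qed
  have "I * b = (\<integral>\<^sup>+z. I * indicator (ball 0 h) z \<partial>(lborel :: (real^'n) measure))"
    by (simp add: nn_integral_cmult_indicator b_def)
  also have "\<dots> \<le> (\<integral>\<^sup>+z. ennreal h * G * indicator (ball 0 h) z + (\<integral>\<^sup>+x\<in>S0. ennreal (V (x + z)) \<partial>lborel) \<partial>lborel)"
    using ptw by (intro nn_integral_mono) (auto simp: indicator_def)
  also have "\<dots> = ennreal h * G * b + (\<integral>\<^sup>+z. (\<integral>\<^sup>+x\<in>S0. ennreal (V (x + z)) \<partial>lborel) \<partial>lborel)"
    by (subst nn_integral_add) (simp_all add: nn_integral_cmult_indicator b_def)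
  also have "(\<integral>\<^sup>+z. (\<integral>\<^sup>+x\<in>S0. ennreal (V (x + z)) \<partial>lborel) \<partial>lborel) = (\<integral>\<^sup>+x. (\<integral>\<^sup>+z. ennreal (V (x + z)) * indicator S0 x \<partial>lborel) \<partial>lborel)"
    by (rule lborel_pair.Fubini') measurable
  \<comment> \<open>With the shifts extended from the ball to the whole space, the inner integral is
    exactly \<open>I\<close>. The volume condition makes the total at most half of
    \<open>I * b\<close>, so that it can be absorbed, \<open>I\<close> being finite.\<close>
  also have "\<dots> = (\<integral>\<^sup>+x. I * indicator S0 x \<partial>lborel)"
  proof (rule nn_integral_cong)
    fix x
    have "(\<integral>\<^sup>+z. ennreal (V (x + z)) * indicator S0 x \<partial>lborel) = (\<integral>\<^sup>+z. ennreal (V (z + x)) \<partial>lborel) * indicator S0 x"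
      by (subst nn_integral_multc) (simp_all add: add.commute)
    then show "(\<integral>\<^sup>+z. ennreal (V (x + z)) * indicator S0 x \<partial>lborel) = I * indicator S0 x"
      unfolding I_def using nn_integral_translate[of "\<lambda>x. ennreal (V x)" x] by simp
  qed
  also have "\<dots> = I * emeasure lborel S0" by (simp add: nn_integral_cmult_indicator)
  finally have main: "I * b \<le> ennreal h * G * b + I * emeasure lborel S0" .
  define i where "i = enn2real I"
  define c where "c = enn2real G"
  define \<beta> where "\<beta> = enn2real b"
  have I: "I = ennreal i" "0 \<le> i" using Vfin by (simp_all add: i_def I_def)
  have G: "G = ennreal c" "0 \<le> c" using False by (simp_all add: c_def less_top)
  have \<beta>: "b = ennreal \<beta>" "0 < \<beta>" using b by (simp_all add: \<beta>_def enn2real_positive_iff)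
  have "2 * emeasure lborel S0 \<le> ennreal \<beta>" using vol unfolding \<beta>(1)[symmetric] by (simp add: S0_def b_def)
  moreover define a where "a = enn2real (emeasure lborel S0)"
  moreover have "emeasure lborel S0 \<noteq> top"
    using calculation(1) by (auto simp: ennreal_mult_top top_unique)
  ultimately have a: "emeasure lborel S0 = ennreal a" "0 \<le> a" by (simp_all add: less_top)
  have a2: "2 * a \<le> \<beta>" using \<open>2 * emeasure lborel S0 \<le> ennreal \<beta>\<close> a \<beta>
    by (simp add: two_ennreal)
  have "ennreal (i * \<beta>) \<le> ennreal (h * c * \<beta> + i * a)"
    using main I G \<beta> a h by (simp add: ennreal_mult)
  then have "i * \<beta> \<le> h * c * \<beta> + i * a"
    using I G \<beta> a h by (subst (asm) ennreal_le_iff) auto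
  also have "i * a \<le> i * (\<beta> / 2)" using a2 I by (intro mult_left_mono) auto
  finally have "\<beta> * i \<le> \<beta> * (2 * h * c)" by (simp add: algebra_simps)
  then have "i \<le> 2 * h * c" using \<beta> by simp
  then show ?thesis
    unfolding I_def[symmetric] I G using h G(2) by (simp add: ennreal_mult[symmetric] ennreal_leI)
qed

text \<open>The decay \<open>x j \<le> x 0 / b^(n j)\<close> reproduces itself: its
  \<open>n\<close>-th root yields \<open>b^(-j)\<close>, which cancels the growing factor, and the
  smallness of \<open>x 0\<close> leaves the ratio \<open>1 / b^n\<close>. The recursion is assumed
  only while \<open>x j \<le> x 0\<close>, since the measure estimate behind it holds only below a
  volume threshold.\<close>

lemma fast_geometric_convergence:
  fixes x :: "nat \<Rightarrow> real" and n :: nat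
  assumes n: "0 < n" and x: "\<And>j. 0 \<le> x j" and C: "0 < C" and b: "1 < b"
    and step: "\<And>j. x j \<le> x 0 \<Longrightarrow> x (Suc j) \<le> C * b ^ j * x j * root n (x j)"
    and x0: "x 0 \<le> 1 / (C ^ n * b ^ (n * n))"
  shows "x \<longlonglongrightarrow> 0"
proof -
  have r0: "root n (x 0) \<le> 1 / (C * b ^ n)"
  proof -
    have "root n (x 0) \<le> root n ((1 / (C * b ^ n)) ^ n)"
      using x0 n by (simp add: power_divide power_mult_distrib power_mult[symmetric])
    also have "\<dots> = 1 / (C * b ^ n)" using n C b by (intro real_root_power_cancel) auto
    finally show ?thesis .
  qed
  have B: "x j \<le> x 0 * (1 / b ^ n) ^ j" for j
  proof (induction j)
    case (Suc j)
    have bn: "(1 / b ^ n) ^ j \<le> 1" using b by (intro power_le_one) (auto simp: one_le_power)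
    have le: "x j \<le> x 0" using Suc mult_left_mono[OF bn x[of 0]] by simp
    have "root n (x j) \<le> root n (x 0 * (1 / b ^ n) ^ j)" using Suc n by simp
    also have "(1 / b ^ n) ^ j = (1 / b ^ j) ^ n"
      by (simp add: power_divide power_mult[symmetric] mult.commute)
    also have "root n (x 0 * (1 / b ^ j) ^ n) = root n (x 0) * root n ((1 / b ^ j) ^ n)"
      by (rule real_root_mult)
    also have "root n ((1 / b ^ j) ^ n) = 1 / b ^ j" using n b by (intro real_root_power_cancel) auto
    also have "root n (x 0) * (1 / b ^ j) \<le> 1 / (C * b ^ n) * (1 / b ^ j)"
      using r0 b by (intro mult_right_mono) auto
    finally have r: "root n (x j) \<le> 1 / (C * b ^ n) * (1 / b ^ j)" .
    have "x (Suc j) \<le> C * b ^ j * x j * root n (x j)" by (rule step[OF le])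
    also have "\<dots> \<le> C * b ^ j * x j * (1 / (C * b ^ n) * (1 / b ^ j))"
      using r C b x by (intro mult_left_mono) auto
    also have "\<dots> = x j * (1 / b ^ n)" using C b by simp
    also have "\<dots> \<le> x 0 * (1 / b ^ n) ^ j * (1 / b ^ n)" using Suc b by (intro mult_right_mono) auto
    finally show ?case by (simp add: mult_ac)
  qed simp
  have "1 < b ^ n" using b n by simp
  then have "(\<lambda>j. x 0 * (1 / b ^ n) ^ j) \<longlonglongrightarrow> x 0 * 0"
    by (intro tendsto_mult tendsto_const LIMSEQ_power_zero) (use b in \<open>auto simp: field_simps\<close>)
  then have lim: "(\<lambda>j. x 0 * (1 / b ^ n) ^ j) \<longlonglongrightarrow> 0" by simp
  show ?thesis
    by (rule real_tendsto_sandwich[OF _ _ tendsto_const lim]; rule always_eventually; use x B in blast)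
qed

section \<open>The De Giorgi lemma for minimizers\<close>

lemma ennreal_mult_le_imp:
  assumes "0 < l" "0 \<le> X" "ennreal l * J \<le> ennreal X"
  shows "J \<le> ennreal (X / l)"
proof -
  have "J \<noteq> top" using assms by (auto simp: ennreal_mult_top top_unique)
  then obtain j where j: "J = ennreal j" "0 \<le> j" by (metis enn2real_nonneg ennreal_enn2real less_top)
  then have "l * j \<le> X" using assms by (simp add: ennreal_mult[symmetric])
  then show ?thesis using assms(1) j by (simp add: ennreal_leI pos_le_divide_eq mult.commute)
qed

lemma ennreal_lin_comb:
  "0 \<le> p \<Longrightarrow> 0 \<le> q \<Longrightarrow> 0 \<le> r \<Longrightarrow> 0 \<le> s \<Longrightarrow>
    ennreal p * ennreal q + ennreal r * ennreal s = ennreal (p * q + r * s)"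
  by (simp add: ennreal_mult)

text \<open>In the gradient bound for \<open>\<zeta>^2 m^4\<close>, the \<open>34\<close> is
  \<open>2\<close> from Young's inequality plus \<open>2 * 16\<close> from the cutoff. The quotient
  is the Caccioppoli constant, with \<open>256 = 16^2\<close> from the squared cutoff gradient, and
  its factor \<open>2\<close> is again Young's.\<close>

definition dg_const :: "real \<Rightarrow> real \<Rightarrow> real" where
  "dg_const lam Lam = 34 + 2 * (256 * Lam + 2) / lam"

text \<open>The threshold comes from \<open>fast_geometric_convergence\<close> with ratio \<open>32\<close>:
  each step loses \<open>2\<^sup>j\<close> from the cutoff and \<open>16\<^sup>j\<close> from the level gap to the fourth power.\<close>

definition dg_threshold :: "real \<Rightarrow> real \<Rightarrow> real \<Rightarrow> nat \<Rightarrow> real" where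
  "dg_threshold lam Lam N n = min (1/2) (1 / ((256 * dg_const lam Lam * N ^ 4) ^ n * 32 ^ (n * n)))"

context minimizer
begin

lemma open_superlevel:
  assumes "ball \<xi> r \<subseteq> \<Omega>"
  shows "open {x \<in> ball \<xi> r. t < \<sigma> * (u x - k)}"
proof -
  have "continuous_on (ball \<xi> r) (\<lambda>x. \<sigma> * (u x - k))"
    using continuous_on_subset[OF cont assms] by (intro continuous_intros)
  then have "open (ball \<xi> r \<inter> (\<lambda>x. \<sigma> * (u x - k)) -` {t<..})"
    by (intro continuous_open_preimage) auto
  moreover have "ball \<xi> r \<inter> (\<lambda>x. \<sigma> * (u x - k)) -` {t<..} = {x \<in> ball \<xi> r. t < \<sigma> * (u x - k)}" by auto
  ultimately show ?thesis by simp
qed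

text \<open>Here the measure term becomes lower order: as
  \<open>r - \<rho> \<le> R \<le> \<kappa>\<close>, its contribution \<open>2 * \<kappa>^2\<close>
  is at most \<open>2 * \<kappa>^4 / (r - \<rho>)^2\<close>, the size of the cutoff term.\<close>

lemma caccioppoli_bound:
  assumes R: "0 < R" "cball \<xi> r \<subseteq> \<Omega>" and \<rho>: "0 < \<rho>" "\<rho> < r" "r \<le> R" and \<sigma>: "\<sigma> = 1 \<or> \<sigma> = -1" and \<kappa>: "R \<le> \<kappa>"
    and bd: "\<And>x. x \<in> ball \<xi> r \<Longrightarrow> \<sigma> * (u x - k) \<le> \<kappa>"
    and \<zeta>: "C1_grad \<zeta> Z" "\<And>x. 0 \<le> \<zeta> x" "\<And>x. \<zeta> x \<le> 1" "\<And>x. (\<rho> + r) / 2 < dist \<xi> x \<Longrightarrow> \<zeta> x = 0 \<and> Z x = 0"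
      "\<And>x. norm (Z x) \<le> 16 / (r - \<rho>)"
  shows "(\<integral>\<^sup>+x\<in>ball \<xi> r. ennreal ((\<zeta> x)\<^sup>2 * (max 0 (\<sigma> * (u x - k)))\<^sup>2 * (norm (g x))\<^sup>2) \<partial>lborel)
    \<le> ennreal ((256 * Lam + 2) * (\<kappa> ^ 4 / (r - \<rho>)\<^sup>2) * measure lborel {x \<in> ball \<xi> r. 0 < \<sigma> * (u x - k)} / lam)"
proof -
  define d where "d = r - \<rho>"
  have d: "0 < d" "d \<le> R" using \<rho> by (auto simp: d_def)
  have \<kappa>0: "0 < \<kappa>" using R \<kappa> by simp
  have L0: "0 \<le> Lam" using lam by linarith
  define S where "S = {x \<in> ball \<xi> r. 0 < \<sigma> * (u x - k)}"
  define a where "a = measure lborel S"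
  have brO: "ball \<xi> r \<subseteq> \<Omega>" using R(2) by auto
  have Sm[measurable]: "S \<in> sets borel" using open_superlevel[OF brO, of 0 \<sigma> k] by (simp add: S_def)
  have Sb: "bounded S" by (rule bounded_subset[OF bounded_ball[of \<xi> r]]) (auto simp: S_def)
  have a: "emeasure lborel S = ennreal a" "0 \<le> a" using ennreal_lborel_finite_measure[OF Sb] by (simp_all add: a_def)
  have r1: "(\<rho> + r) / 2 < r" using \<rho> by simp
  have "(\<integral>\<^sup>+x\<in>ball \<xi> r. ennreal ((max 0 (\<sigma> * (u x - k))) ^ 4 * (norm (Z x))\<^sup>2) \<partial>lborel)
     \<le> (\<integral>\<^sup>+x. ennreal (\<kappa> ^ 4 * (16 / d)\<^sup>2) * indicator S x \<partial>lborel)"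
  proof (rule nn_integral_mono)
    fix x
    show "ennreal ((max 0 (\<sigma> * (u x - k))) ^ 4 * (norm (Z x))\<^sup>2) * indicator (ball \<xi> r) x
        \<le> ennreal (\<kappa> ^ 4 * (16 / d)\<^sup>2) * indicator S x"
    proof (cases "x \<in> S")
      case True
      then have "(max 0 (\<sigma> * (u x - k))) ^ 4 * (norm (Z x))\<^sup>2 \<le> \<kappa> ^ 4 * (16 / d)\<^sup>2"
        using bd[of x] \<zeta>(5)[of x] \<kappa>0 by (intro mult_mono power_mono) (auto simp: S_def d_def)
      then show ?thesis using True by (auto simp: S_def intro: ennreal_leI)
    qed (auto simp: S_def indicator_def)
  qed
  also have "\<dots> = ennreal (\<kappa> ^ 4 * (16 / d)\<^sup>2 * a)"
    using a \<kappa>0 by (simp add: nn_integral_cmult_indicator ennreal_mult)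
  finally have 1: "(\<integral>\<^sup>+x\<in>ball \<xi> r. ennreal ((max 0 (\<sigma> * (u x - k))) ^ 4 * (norm (Z x))\<^sup>2) \<partial>lborel)
    \<le> ennreal (\<kappa> ^ 4 * (16 / d)\<^sup>2 * a)" .
  have 2: "emeasure lborel {x \<in> ball \<xi> r. 0 < \<sigma> * (u x - k) \<and> \<zeta> x \<noteq> 0} \<le> ennreal a"
    unfolding a(1)[symmetric]
  proof (rule emeasure_mono)
    show "{x \<in> ball \<xi> r. 0 < \<sigma> * (u x - k) \<and> \<zeta> x \<noteq> 0} \<subseteq> S" by (auto simp: S_def)
  qed measurable
  have "ennreal lam * (\<integral>\<^sup>+x\<in>ball \<xi> r. ennreal ((\<zeta> x)\<^sup>2 * (max 0 (\<sigma> * (u x - k)))\<^sup>2 * (norm (g x))\<^sup>2) \<partial>lborel)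
    \<le> ennreal Lam * (\<integral>\<^sup>+x\<in>ball \<xi> r. ennreal ((max 0 (\<sigma> * (u x - k))) ^ 4 * (norm (Z x))\<^sup>2) \<partial>lborel)
      + ennreal (2 * \<kappa>\<^sup>2) * emeasure lborel {x \<in> ball \<xi> r. 0 < \<sigma> * (u x - k) \<and> \<zeta> x \<noteq> 0}"
    by (rule caccioppoli[OF R(2) r1 _ \<sigma> \<kappa>0 bd \<zeta>(1-4)]) (use \<rho> in auto)
  also have "\<dots> \<le> ennreal Lam * ennreal (\<kappa> ^ 4 * (16 / d)\<^sup>2 * a) + ennreal (2 * \<kappa>\<^sup>2) * ennreal a"
    by (intro add_mono mult_left_mono 1 2) auto
  also have "\<dots> = ennreal (Lam * (\<kappa> ^ 4 * (16 / d)\<^sup>2 * a) + 2 * \<kappa>\<^sup>2 * a)"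
    using a(2) L0 \<kappa>0 by (simp add: ennreal_mult)
  also have "\<dots> \<le> ennreal ((256 * Lam + 2) * (\<kappa> ^ 4 / d\<^sup>2) * a)"
  proof (rule ennreal_leI)
    have "d\<^sup>2 \<le> \<kappa>\<^sup>2" using d \<kappa> by (intro power_mono) auto
    then have "\<kappa>\<^sup>2 * d\<^sup>2 \<le> \<kappa>\<^sup>2 * \<kappa>\<^sup>2" by (intro mult_left_mono) auto
    then have "\<kappa>\<^sup>2 \<le> \<kappa> ^ 4 / d\<^sup>2" using d by (simp add: field_simps power4_eq_xxxx power2_eq_square)
    then have "2 * \<kappa>\<^sup>2 * a \<le> 2 * (\<kappa> ^ 4 / d\<^sup>2) * a" using a(2) by (intro mult_right_mono mult_left_mono) auto
    then show "Lam * (\<kappa> ^ 4 * (16 / d)\<^sup>2 * a) + 2 * \<kappa>\<^sup>2 * a \<le> (256 * Lam + 2) * (\<kappa> ^ 4 / d\<^sup>2) * a"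
      by (simp add: power_divide algebra_simps)
  qed
  finally have "ennreal lam * (\<integral>\<^sup>+x\<in>ball \<xi> r. ennreal ((\<zeta> x)\<^sup>2 * (max 0 (\<sigma> * (u x - k)))\<^sup>2 * (norm (g x))\<^sup>2) \<partial>lborel)
    \<le> ennreal ((256 * Lam + 2) * (\<kappa> ^ 4 / d\<^sup>2) * a)" .
  from ennreal_mult_le_imp[OF lam(1) _ this]
  show ?thesis using L0 a(2) \<kappa>0 d by (simp add: d_def a_def S_def)
qed

text \<open>The function \<open>V = \<zeta>^2 m^4\<close> has an \<open>L^1\<close> gradient
  controlled by the weighted energy. It is supported in a set of measure \<open>a\<close>, so the
  translation argument gains a length of order \<open>a^(1/n)\<close>, the superlinear factor of the
  iteration. Chebyshev's inequality at height \<open>t^4\<close> concludes.\<close>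

lemma de_giorgi_step:
  assumes R: "0 < R" "cball \<xi> (2 * R) \<subseteq> \<Omega>" and \<rho>: "0 < \<rho>" "\<rho> < r" "r \<le> R" and \<sigma>: "\<sigma> = 1 \<or> \<sigma> = -1" and \<kappa>: "R \<le> \<kappa>"
    and bd: "\<And>x. x \<in> ball \<xi> r \<Longrightarrow> \<sigma> * (u x - k) \<le> \<kappa>" and t: "0 < t"
    and a_def: "a = measure lborel {x \<in> ball \<xi> r. 0 < \<sigma> * (u x - k)}"
    and a2: "2 * a \<le> unit_ball_vol (real CARD('n)) * R ^ CARD('n)"
  shows "measure lborel {x \<in> ball \<xi> \<rho>. t < \<sigma> * (u x - k)} * t ^ 4
    \<le> 2 * root CARD('n) (2 * a / unit_ball_vol (real CARD('n))) * dg_const lam Lam * \<kappa> ^ 4 * a / (r - \<rho>)"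
proof -
  define \<omega> where "\<omega> = unit_ball_vol (real CARD('n))"
  have \<omega>: "0 < \<omega>" by (simp add: \<omega>_def)
  define d where "d = r - \<rho>"
  have d: "0 < d" "d \<le> R" using \<rho> by (auto simp: d_def)
  have \<kappa>0: "0 < \<kappa>" using R \<kappa> by simp
  have L0: "0 \<le> Lam" using lam by linarith
  define S where "S = {x \<in> ball \<xi> r. 0 < \<sigma> * (u x - k)}"
  define E where "E = {x \<in> ball \<xi> \<rho>. t < \<sigma> * (u x - k)}"
  have b2: "ball \<xi> s \<subseteq> \<Omega>" "cball \<xi> s \<subseteq> \<Omega>" if "s \<le> R" for s
  proof -
    have "cball \<xi> s \<subseteq> cball \<xi> (2 * R)" using that R by (intro subset_cball) auto
    then show "cball \<xi> s \<subseteq> \<Omega>" using R by blast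
    then show "ball \<xi> s \<subseteq> \<Omega>" using ball_subset_cball by blast
  qed
  have [measurable]: "S \<in> sets borel" "E \<in> sets borel"
    using open_superlevel[OF b2(1), of r 0 \<sigma> k] open_superlevel[OF b2(1), of \<rho> t \<sigma> k] \<rho> by (auto simp: S_def E_def)
  have bS: "bounded S" "bounded E" by (rule bounded_subset[OF bounded_ball[of \<xi> R]]; use \<rho> in \<open>force simp: S_def E_def\<close>)+
  have a: "emeasure lborel S = ennreal a" "0 \<le> a" using ennreal_lborel_finite_measure[OF bS(1)] by (simp_all add: a_def S_def)
  have mE: "emeasure lborel E = ennreal (measure lborel E)" by (rule ennreal_lborel_finite_measure[OF bS(2)])
  have ES: "E \<subseteq> S" using \<rho> t by (force simp: E_def S_def)
  define C where "C = dg_const lam Lam"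
  have C: "0 < C" using lam L0 by (simp add: C_def dg_const_def add_pos_nonneg)
  \<comment> \<open>The ball of radius \<open>h\<close> has exactly the measure
    \<open>2 * a\<close>. The hypothesis on \<open>2 * a\<close> gives \<open>h \<le> R\<close>, so
    shifts shorter than \<open>h\<close> lead from \<open>ball \<xi> r\<close> into
    \<open>cball \<xi> (2 * R)\<close>.\<close>
  define h where "h = root CARD('n) (2 * a / \<omega>)"
  show ?thesis
  proof (cases "a = 0")
    case True
    have "emeasure lborel E \<le> emeasure lborel S" using ES by (intro emeasure_mono) auto
    then have "measure lborel E = 0" using a mE True by (simp add: ennreal_eq_0_iff measure_le_0_iff)
    then show ?thesis using True by (simp add: E_def)
  next
    case False
    then have a0: "0 < a" using a by simp
    have h: "0 < h" using a0 \<omega> by (simp add: h_def)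
    have hn: "\<omega> * h ^ CARD('n) = 2 * a"
      using a0 \<omega> by (simp add: h_def real_root_pow_pos2)
    have hR: "h \<le> R"
    proof -
      have "2 * a / \<omega> \<le> R ^ CARD('n)" using a2 \<omega> by (simp add: \<omega>_def field_simps)
      then have "h \<le> root CARD('n) (R ^ CARD('n))" unfolding h_def by (intro real_root_le_mono) auto
      then show ?thesis using R by (simp add: real_root_power_cancel)
    qed
    obtain \<zeta> Z where \<zeta>: "C1_grad \<zeta> Z" "\<And>x. 0 \<le> \<zeta> x" "\<And>x. \<zeta> x \<le> 1" "\<And>x. dist \<xi> x \<le> \<rho> \<Longrightarrow> \<zeta> x = 1 \<and> Z x = 0"
      "\<And>x. (\<rho> + r) / 2 < dist \<xi> x \<Longrightarrow> \<zeta> x = 0 \<and> Z x = 0" "\<And>x. norm (Z x) \<le> 16 / (r - \<rho>)"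
      by (rule cutoff_exists[OF \<rho>(1,2), of \<xi>]) rule
    note [measurable] = C1_grad_borel[OF \<zeta>(1)]
    define K where "K = cball \<xi> (2 * R)"
    have K: "compact K" "K \<subseteq> \<Omega>" using R(2) by (auto simp: K_def)
    have [measurable]: "K \<in> sets borel" by (simp add: K_def)
    define m where "m = (\<lambda>s. max 0 (\<sigma> * (s - k)))"
    define F where "F = (\<lambda>s. (m s) ^ Suc (Suc 2))"
    define F' where "F' = (\<lambda>s. 4 * \<sigma> * (m s) ^ 3)"
    have F: "(F has_real_derivative F' s) (at s)" for s
    proof -
      have "((\<lambda>t. \<sigma> * (t - k)) has_real_derivative \<sigma>) (at s)"
        by (auto intro!: derivative_eq_intros)
      from DERIV_chain2[OF max0_power_deriv[of 2] this]
      show ?thesis by (simp add: F_def F'_def m_def numeral_3_eq_3 numeral_2_eq_2 mult_ac)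
    qed
    have mc: "continuous_on UNIV m" unfolding m_def by (intro continuous_intros)
    have F'c: "continuous_on UNIV F'" unfolding F'_def by (intro continuous_intros mc)
    have [measurable]: "m \<in> borel_measurable borel" using mc borel_measurable_continuous_onI by blast
    have [measurable]: "F \<in> borel_measurable borel" "F' \<in> borel_measurable borel"
      unfolding F_def F'_def by measurable
    define u' where "u' = (\<lambda>x. indicator K x * u x)"
    have u'u: "u' x = u x" if "x \<in> K" for x using that by (simp add: u'_def)
    have [measurable]: "u' \<in> borel_measurable borel"
      unfolding u'_def by (rule u_restrict_borel[OF K])
    define V where "V = (\<lambda>x. (\<zeta> x * \<zeta> x) * F (u' x))"
    define gV where "gV = (\<lambda>x. (\<zeta> x * \<zeta> x) *\<^sub>R (F' (u' x) *\<^sub>R g x) + F (u' x) *\<^sub>R (\<zeta> x *\<^sub>R Z x + \<zeta> x *\<^sub>R Z x))"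
    have [measurable]: "V \<in> borel_measurable borel" "gV \<in> borel_measurable borel"
      unfolding V_def gV_def by measurable
    have ap: "C1_approx K V gV"
    proof -
      have "C1_approx K (\<lambda>x. F (u' x)) (\<lambda>x. F' (u' x) *\<^sub>R g x)"
        unfolding u'_def by (rule C1_approx_compose_u[OF K F F'c])
      then show ?thesis unfolding V_def gV_def
        by (rule C1_approx_mult[OF _ K(1) _ C1_grad_mult[OF \<zeta>(1) \<zeta>(1)]]) measurable
    qed
    have inr: "x \<in> ball \<xi> r \<and> x \<in> K" if "\<zeta> x \<noteq> 0" for x
    proof -
      have "dist \<xi> x \<le> (\<rho> + r) / 2" using \<zeta>(5)[of x] that by fastforce
      then show ?thesis using \<rho> R by (auto simp: K_def)
    qed
    have m0: "0 \<le> m s" for s by (simp add: m_def)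
    have V0: "0 \<le> V x" for x using m0 by (simp add: V_def F_def)
    have Vs: "x \<in> S" if "V x \<noteq> 0" for x
    proof -
      have z: "\<zeta> x \<noteq> 0" "m (u' x) \<noteq> 0" using that by (auto simp: V_def F_def)
      then have "0 < m (u x)" using inr[OF z(1)] u'u[of x] m0[of "u x"] by (simp add: order_less_le)
      then have "0 < \<sigma> * (u x - k)" by (simp add: m_def less_max_iff_disj)
      then show ?thesis using inr[OF z(1)] by (simp add: S_def)
    qed
    have mk: "m (u x) \<le> \<kappa>" if "x \<in> ball \<xi> r" for x using bd[OF that] \<kappa>0 by (simp add: m_def)
    have z1: "\<zeta> x * \<zeta> x \<le> 1" "0 \<le> \<zeta> x * \<zeta> x" for x using \<zeta>(2,3)[of x] by (auto intro: mult_le_one)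
    have Vk: "V x \<le> \<kappa> ^ 4 * indicator S x" for x
    proof (cases "V x = 0")
      case False
      note x = Vs[OF False]
      have xK: "x \<in> K" using False inr by (auto simp: V_def)
      have F4: "F (u' x) = (m (u x)) ^ 4" using xK by (simp add: F_def u'u numeral_eq_Suc)
      have "(m (u x)) ^ 4 \<le> \<kappa> ^ 4" using mk[of x] x m0 by (intro power_mono) (auto simp: S_def)
      then have "V x \<le> 1 * \<kappa> ^ 4"
        unfolding V_def F4 using z1[of x] m0 by (intro mult_mono) auto
      then show ?thesis using x by simp
    qed (use \<kappa>0 in \<open>auto simp: indicator_def\<close>)
    have Vfin: "(\<integral>\<^sup>+x. ennreal (V x) \<partial>lborel) < \<infinity>"
    proof (rule le_less_trans[OF nn_integral_mono])
      show "ennreal (V x) \<le> ennreal (\<kappa> ^ 4) * indicator S x" for x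
        using ennreal_leI[OF Vk[of x]] by (auto simp: indicator_def ennreal_neg split: if_splits)
      show "(\<integral>\<^sup>+x. ennreal (\<kappa> ^ 4) * indicator S x \<partial>lborel) < \<infinity>"
        using a by (simp add: nn_integral_cmult_indicator ennreal_mult_less_top)
    qed
    have vol: "2 * emeasure lborel {x. V x \<noteq> 0} \<le> emeasure lborel (ball (0::real^'n) h)"
    proof -
      have "emeasure lborel {x. V x \<noteq> 0} \<le> emeasure lborel S" using Vs by (intro emeasure_mono) auto
      then have "2 * emeasure lborel {x. V x \<noteq> 0} \<le> 2 * ennreal a" unfolding a(1) by (rule mult_left_mono) simp
      also have "\<dots> = emeasure lborel (ball (0::real^'n) h)"
        using a(2) h by (simp add: two_ennreal emeasure_ball hn[symmetric] \<omega>_def)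
      finally show ?thesis .
    qed
    have tr: "(\<integral>\<^sup>+x\<in>ball \<xi> r. ennreal \<bar>V (x + z) - V x\<bar> \<partial>lborel) \<le> ennreal (norm z) * (\<integral>\<^sup>+x\<in>K. ennreal (norm (gV x)) \<partial>lborel)"
      if z: "norm z < h" for z
    proof (rule C1_approx_translation[OF ap K(1)])
      fix x and s :: real assume x: "x \<in> ball \<xi> r" and s: "0 \<le> s" "s \<le> 1"
      have "dist \<xi> (x + s *\<^sub>R z) \<le> dist \<xi> x + dist x (x + s *\<^sub>R z)" by (rule dist_triangle)
      also have "dist x (x + s *\<^sub>R z) = s * norm z" using s by (simp add: dist_norm)
      also have "\<dots> \<le> 1 * R" using s z hR by (intro mult_mono) auto
      finally show "x + s *\<^sub>R z \<in> K" using x \<rho> by (simp add: K_def)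
    qed measurable
    have fk: "(\<integral>\<^sup>+x. ennreal (V x) \<partial>lborel) \<le> ennreal (2 * h) * (\<integral>\<^sup>+x\<in>K. ennreal (norm (gV x)) \<partial>lborel)"
      by (rule faber_krahn_L1[where S="ball \<xi> r", OF _ _ V0 Vfin _ h vol tr]) (use Vs in \<open>auto simp: S_def\<close>)
    define J where "J = (\<integral>\<^sup>+x\<in>ball \<xi> r. ennreal ((\<zeta> x)\<^sup>2 * (max 0 (\<sigma> * (u x - k)))\<^sup>2 * (norm (g x))\<^sup>2) \<partial>lborel)"
    have J: "J \<le> ennreal ((256 * Lam + 2) * (\<kappa> ^ 4 / d\<^sup>2) * a / lam)"
      unfolding J_def d_def a_def
      by (rule caccioppoli_bound[OF R(1) b2(2)[OF \<rho>(3)] \<rho> \<sigma> \<kappa> bd \<zeta>(1-3,5,6)])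
    have J': "J = (\<integral>\<^sup>+x\<in>ball \<xi> r. ennreal ((\<zeta> x)\<^sup>2 * (m (u' x))\<^sup>2 * (norm (g x))\<^sup>2) \<partial>lborel)"
      unfolding J_def
    proof (rule nn_integral_cong)
      fix x
      show "ennreal ((\<zeta> x)\<^sup>2 * (max 0 (\<sigma> * (u x - k)))\<^sup>2 * (norm (g x))\<^sup>2) * indicator (ball \<xi> r) x
         = ennreal ((\<zeta> x)\<^sup>2 * (m (u' x))\<^sup>2 * (norm (g x))\<^sup>2) * indicator (ball \<xi> r) x"
        using inr[of x] u'u[of x] by (cases "\<zeta> x = 0") (simp_all add: m_def)
    qed
    have ptw: "norm (gV x) \<le> 34 * \<kappa> ^ 4 / d * indicator S x + 2 * d * ((\<zeta> x)\<^sup>2 * (m (u' x))\<^sup>2 * (norm (g x))\<^sup>2 * indicator (ball \<xi> r) x)" for x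
    proof (cases "\<zeta> x = 0 \<or> m (u' x) = 0")
      case True
      then have "gV x = 0" by (auto simp: gV_def F_def F'_def)
      moreover have "0 \<le> 34 * \<kappa> ^ 4 / d * indicator S x + 2 * d * ((\<zeta> x)\<^sup>2 * (m (u' x))\<^sup>2 * (norm (g x))\<^sup>2 * indicator (ball \<xi> r) x)"
        using d \<kappa>0 by (intro add_nonneg_nonneg mult_nonneg_nonneg) auto
      ultimately show ?thesis by simp
    next
      case False
      define M where "M = m (u' x)"
      have x: "x \<in> ball \<xi> r" "x \<in> K" "x \<in> S" using False inr[of x] Vs[of x] by (auto simp: V_def F_def)
      have M: "0 \<le> M" "M \<le> \<kappa>" using mk[OF x(1)] m0 u'u[OF x(2)] by (auto simp: M_def)
      have M4: "M ^ 4 \<le> \<kappa> ^ 4" using M by (intro power_mono) auto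
      have s1: "\<bar>\<sigma>\<bar> = 1" using \<sigma> by auto
      have "norm (gV x) \<le> norm ((\<zeta> x * \<zeta> x) *\<^sub>R (F' (u' x) *\<^sub>R g x)) + norm (F (u' x) *\<^sub>R (\<zeta> x *\<^sub>R Z x + \<zeta> x *\<^sub>R Z x))"
        unfolding gV_def by (rule norm_triangle_ineq)
      also have "norm ((\<zeta> x * \<zeta> x) *\<^sub>R (F' (u' x) *\<^sub>R g x)) = 2 * (2 * (\<zeta> x * M\<^sup>2) * (\<zeta> x * M * norm (g x)))"
        using s1 M(1) \<zeta>(2)[of x] by (simp add: F'_def M_def[symmetric] abs_mult power2_eq_square power3_eq_cube)
      \<comment> \<open>Young's inequality with weight \<open>d = r - \<rho>\<close> balances
        \<open>\<kappa>^4 / d\<close> against a weighted energy of order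
        \<open>\<kappa>^4 / d^2\<close>.\<close>
      also have "2 * (\<zeta> x * M\<^sup>2) * (\<zeta> x * M * norm (g x)) \<le> (\<zeta> x * M\<^sup>2)\<^sup>2 / d + d * (\<zeta> x * M * norm (g x))\<^sup>2"
      proof -
        have "0 \<le> ((\<zeta> x * M\<^sup>2) - d * (\<zeta> x * M * norm (g x)))\<^sup>2 / d" using d by simp
        also have "\<dots> = (\<zeta> x * M\<^sup>2)\<^sup>2 / d + d * (\<zeta> x * M * norm (g x))\<^sup>2 - 2 * (\<zeta> x * M\<^sup>2) * (\<zeta> x * M * norm (g x))"
          using d by (simp add: field_simps power2_eq_square)
        finally show ?thesis by simp
      qed
      also have "(\<zeta> x * M\<^sup>2)\<^sup>2 / d \<le> \<kappa> ^ 4 / d"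
      proof (rule divide_right_mono)
        have "(\<zeta> x * M\<^sup>2)\<^sup>2 = (\<zeta> x * \<zeta> x) * M ^ 4" by (simp add: power2_eq_square power4_eq_xxxx)
        also have "\<dots> \<le> 1 * \<kappa> ^ 4" using z1[of x] M4 by (intro mult_mono) auto
        finally show "(\<zeta> x * M\<^sup>2)\<^sup>2 \<le> \<kappa> ^ 4" by simp
      qed (use d in simp)
      also have "norm (F (u' x) *\<^sub>R (\<zeta> x *\<^sub>R Z x + \<zeta> x *\<^sub>R Z x)) \<le> \<kappa> ^ 4 * (2 * (16 / d))"
      proof -
        have "norm (\<zeta> x *\<^sub>R Z x + \<zeta> x *\<^sub>R Z x) \<le> \<zeta> x * norm (Z x) + \<zeta> x * norm (Z x)"
          using norm_triangle_ineq[of "\<zeta> x *\<^sub>R Z x" "\<zeta> x *\<^sub>R Z x"] \<zeta>(2)[of x] by simp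
        also have "\<dots> \<le> 2 * (1 * (16 / d))"
          using \<zeta>(3)[of x] \<zeta>(2)[of x] \<zeta>(6)[of x] mult_mono[of "\<zeta> x" 1 "norm (Z x)" "16 / d"] by (simp add: d_def)
        finally have "norm (\<zeta> x *\<^sub>R Z x + \<zeta> x *\<^sub>R Z x) \<le> 2 * (16 / d)" by simp
        moreover have "\<bar>F (u' x)\<bar> \<le> \<kappa> ^ 4" using M4 M(1) by (simp add: F_def M_def[symmetric] numeral_eq_Suc)
        ultimately show ?thesis unfolding norm_scaleR using \<kappa>0 by (intro mult_mono) auto
      qed
      finally have "norm (gV x) \<le> 2 * (\<kappa> ^ 4 / d + d * (\<zeta> x * M * norm (g x))\<^sup>2) + \<kappa> ^ 4 * (2 * (16 / d))"
        by simp
      then show ?thesis using x by (simp add: M_def power_mult_distrib algebra_simps)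
    qed
    have G: "(\<integral>\<^sup>+x\<in>K. ennreal (norm (gV x)) \<partial>lborel) \<le> ennreal (C * \<kappa> ^ 4 * a / d)"
    proof -
      have "(\<integral>\<^sup>+x\<in>K. ennreal (norm (gV x)) \<partial>lborel)
        \<le> (\<integral>\<^sup>+x. ennreal (34 * \<kappa> ^ 4 / d) * indicator S x + ennreal (2 * d) * (ennreal ((\<zeta> x)\<^sup>2 * (m (u' x))\<^sup>2 * (norm (g x))\<^sup>2) * indicator (ball \<xi> r) x) \<partial>lborel)"
      proof (rule nn_integral_mono)
        fix x
        have "ennreal (norm (gV x)) * indicator K x \<le> ennreal (norm (gV x))" by (simp add: indicator_def)
        also have "\<dots> \<le> ennreal (34 * \<kappa> ^ 4 / d * indicator S x + 2 * d * ((\<zeta> x)\<^sup>2 * (m (u' x))\<^sup>2 * (norm (g x))\<^sup>2 * indicator (ball \<xi> r) x))"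
          by (rule ennreal_leI[OF ptw])
        also have "\<dots> = ennreal (34 * \<kappa> ^ 4 / d * indicator S x) + ennreal (2 * d * ((\<zeta> x)\<^sup>2 * (m (u' x))\<^sup>2 * (norm (g x))\<^sup>2 * indicator (ball \<xi> r) x))"
          using d \<kappa>0 by (intro ennreal_plus mult_nonneg_nonneg) auto
        also have "\<dots> = ennreal (34 * \<kappa> ^ 4 / d) * indicator S x + ennreal (2 * d) * (ennreal ((\<zeta> x)\<^sup>2 * (m (u' x))\<^sup>2 * (norm (g x))\<^sup>2) * indicator (ball \<xi> r) x)"
          using d by (auto simp: indicator_def ennreal_mult)
        finally show "ennreal (norm (gV x)) * indicator K x \<le> ennreal (34 * \<kappa> ^ 4 / d) * indicator S x + ennreal (2 * d) * (ennreal ((\<zeta> x)\<^sup>2 * (m (u' x))\<^sup>2 * (norm (g x))\<^sup>2) * indicator (ball \<xi> r) x)" .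
      qed
      also have "\<dots> = ennreal (34 * \<kappa> ^ 4 / d) * ennreal a + ennreal (2 * d) * J"
        unfolding J' by (simp add: nn_integral_add nn_integral_cmult nn_integral_cmult_indicator a(1))
      also have "\<dots> \<le> ennreal (34 * \<kappa> ^ 4 / d) * ennreal a + ennreal (2 * d) * ennreal ((256 * Lam + 2) * (\<kappa> ^ 4 / d\<^sup>2) * a / lam)"
        by (intro add_mono mult_left_mono J) auto
      also have "\<dots> = ennreal (34 * \<kappa> ^ 4 / d * a + 2 * d * ((256 * Lam + 2) * (\<kappa> ^ 4 / d\<^sup>2) * a / lam))"
        by (rule ennreal_lin_comb) (use d \<kappa>0 a(2) L0 lam in auto)
      also have "34 * \<kappa> ^ 4 / d * a + 2 * d * ((256 * Lam + 2) * (\<kappa> ^ 4 / d\<^sup>2) * a / lam) = C * \<kappa> ^ 4 * a / d"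
        using d lam by (simp add: C_def dg_const_def field_simps power2_eq_square)
      finally show ?thesis .
    qed
    have "ennreal (measure lborel E * t ^ 4) = (\<integral>\<^sup>+x. ennreal (t ^ 4) * indicator E x \<partial>lborel)"
      using t by (subst nn_integral_cmult_indicator) (simp_all add: mE ennreal_mult mult.commute)
    also have "\<dots> \<le> (\<integral>\<^sup>+x. ennreal (V x) \<partial>lborel)"
    proof (rule nn_integral_mono)
      fix x
      show "ennreal (t ^ 4) * indicator E x \<le> ennreal (V x)"
      proof (cases "x \<in> E")
        case True
        then have "\<zeta> x = 1" "x \<in> K" using \<zeta>(4)[of x] \<rho> R by (auto simp: E_def K_def)
        then have "V x = (m (u x)) ^ 4" by (simp add: V_def F_def u'u numeral_eq_Suc)
        moreover have "t ^ 4 \<le> (m (u x)) ^ 4" using True t by (intro power_mono) (auto simp: E_def m_def)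
        ultimately show ?thesis using True by (simp add: ennreal_leI)
      qed simp
    qed
    also have "\<dots> \<le> ennreal (2 * h) * ennreal (C * \<kappa> ^ 4 * a / d)"
      by (rule order_trans[OF fk mult_left_mono[OF G]]) simp
    also have "\<dots> = ennreal (2 * h * C * \<kappa> ^ 4 * a / d)"
      using h C \<kappa>0 a(2) d by (simp add: ennreal_mult[symmetric] mult_ac)
    finally have "measure lborel E * t ^ 4 \<le> 2 * h * C * \<kappa> ^ 4 * a / d"
      using h C \<kappa>0 a(2) d by (subst (asm) ennreal_le_iff) auto
    then show ?thesis by (simp add: E_def h_def C_def d_def \<omega>_def)
  qed
qed

text \<open>Radii shrink from \<open>R\<close> to \<open>R / 2\<close> while levels rise from
  \<open>0\<close> to \<open>H\<close>, the remaining distance being halved each time. After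
  scaling, only the bound \<open>N\<close> on \<open>\<kappa> / H\<close> is left of the data, so
  the threshold depends on \<open>N\<close>, the ellipticity and the dimension alone.\<close>

lemma de_giorgi:
  assumes R: "0 < R" "cball \<xi> (2 * R) \<subseteq> \<Omega>" and \<sigma>: "\<sigma> = 1 \<or> \<sigma> = -1" and \<kappa>: "R \<le> \<kappa>" "\<kappa> \<le> N * H"
    and H: "0 < H" and bd: "\<And>x. x \<in> ball \<xi> R \<Longrightarrow> \<sigma> * (u x - k) \<le> \<kappa>"
    and small: "measure lborel {x \<in> ball \<xi> R. 0 < \<sigma> * (u x - k)}
      \<le> dg_threshold lam Lam N CARD('n) * (unit_ball_vol (real CARD('n)) * R ^ CARD('n))"
    and x: "x \<in> ball \<xi> (R / 2)"
  shows "\<sigma> * (u x - k) \<le> H"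
proof -
  let ?n = "CARD('n)"
  define \<omega> where "\<omega> = unit_ball_vol (real ?n) * R ^ ?n"
  have \<omega>: "0 < \<omega>" using R by (simp add: \<omega>_def)
  have \<kappa>0: "0 < \<kappa>" using R \<kappa> by simp
  have N: "0 < N" using \<kappa>0 \<kappa>(2) H by (metis less_le_trans zero_less_mult_pos2)
  have L0: "0 \<le> Lam" using lam by linarith
  define C where "C = dg_const lam Lam"
  have C: "0 < C" using lam L0 by (simp add: C_def dg_const_def add_pos_nonneg)
  define D where "D = 256 * C * N ^ 4"
  have D: "0 < D" using C N by (simp add: D_def)
  define t where "t = (\<lambda>j::nat. H * (1 - 1 / 2 ^ j))"
  define r where "r = (\<lambda>j::nat. R / 2 * (1 + 1 / 2 ^ j))"
  define S where "S = (\<lambda>j. {x \<in> ball \<xi> (r j). t j < \<sigma> * (u x - k)})"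
  define a where "a = (\<lambda>j. measure lborel (S j))"
  define \<alpha> where "\<alpha> = (\<lambda>j. a j / \<omega>)"
  have half: "(1::real) / 2 ^ j \<le> 1" for j by simp
  have t: "0 \<le> t j" "t j \<le> H" "t (Suc j) = t j + H / 2 ^ Suc j" for j
    using H half[of j] by (auto simp: t_def field_simps)
  have r: "0 < r j" "r j \<le> R" "R / 2 \<le> r j" "r (Suc j) < r j" "r j - r (Suc j) = R / 2 ^ (j + 2)" for j
  proof -
    show "0 < r j" using R by (auto simp: r_def intro!: mult_pos_pos add_pos_pos)
  qed (use R half[of j] in \<open>auto simp: r_def field_simps\<close>)
  have \<alpha>0: "0 \<le> \<alpha> j" for j using \<omega> by (simp add: \<alpha>_def a_def)
  have thr: "\<alpha> 0 \<le> dg_threshold lam Lam N ?n"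
  proof -
    have "S 0 = {x \<in> ball \<xi> R. 0 < \<sigma> * (u x - k)}" by (simp add: S_def r_def t_def)
    then show ?thesis using small \<omega> by (simp add: \<alpha>_def a_def \<omega>_def divide_le_eq)
  qed
  \<comment> \<open>A rising level is absorbed into the base level, which moves in the direction of
    \<open>\<sigma>\<close>; because \<open>\<sigma> * \<sigma> = 1\<close>, both signs share one
    step.\<close>
  have lvl: "\<sigma> * (u y - (k + \<sigma> * s)) = \<sigma> * (u y - k) - s" for y s
  proof -
    have "\<sigma> * \<sigma> = 1" using \<sigma> by auto
    then show ?thesis by (simp add: algebra_simps mult.assoc[symmetric])
  qed
  have rt2: "root ?n 2 \<le> 2"
    using real_root_le_mono[of ?n 2 "2 ^ ?n"] self_le_power[of "2::real" ?n] by (simp add: real_root_power_cancel)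
  have stp: "\<alpha> (Suc j) \<le> D * 32 ^ j * \<alpha> j * root ?n (\<alpha> j)" if le: "\<alpha> j \<le> \<alpha> 0" for j
  proof -
    define h where "h = H / 2 ^ Suc j"
    have h: "0 < h" using H by (simp add: h_def)
    \<comment> \<open>This is where the cap \<open>1/2\<close> in the threshold and the restriction
      to \<open>\<alpha> j \<le> \<alpha> 0\<close> enter.\<close>
    have a2: "2 * a j \<le> \<omega>"
    proof -
      have "\<alpha> j \<le> 1 / 2" using le thr by (simp add: dg_threshold_def)
      then show ?thesis using \<omega> by (simp add: \<alpha>_def field_simps)
    qed
    have Sj: "S j = {x \<in> ball \<xi> (r j). 0 < \<sigma> * (u x - (k + \<sigma> * t j))}" by (simp add: S_def lvl)
    have Sj1: "S (Suc j) = {x \<in> ball \<xi> (r (Suc j)). h < \<sigma> * (u x - (k + \<sigma> * t j))}"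
      by (auto simp: S_def lvl t(3) h_def)
    have "a (Suc j) * h ^ 4 \<le> 2 * root ?n (2 * a j / unit_ball_vol (real ?n)) * C * \<kappa> ^ 4 * a j / (r j - r (Suc j))"
      unfolding C_def a_def Sj1
    proof (rule de_giorgi_step[OF R r(1) r(4) r(2) \<sigma> \<kappa>(1) _ h])
      show "\<sigma> * (u y - (k + \<sigma> * t j)) \<le> \<kappa>" if "y \<in> ball \<xi> (r j)" for y
        using bd[of y] that r(2)[of j] t(1)[of j] by (simp add: lvl)
      show "measure lborel (S j) = measure lborel {x \<in> ball \<xi> (r j). 0 < \<sigma> * (u x - (k + \<sigma> * t j))}" by (simp add: Sj)
      show "2 * measure lborel (S j) \<le> unit_ball_vol (real ?n) * R ^ ?n" using a2 by (simp add: a_def \<omega>_def)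
    qed
    also have "2 * a j / unit_ball_vol (real ?n) = 2 * \<alpha> j * R ^ ?n"
      using R by (simp add: \<alpha>_def \<omega>_def)
    also have "root ?n (2 * \<alpha> j * R ^ ?n) = root ?n 2 * root ?n (\<alpha> j) * R"
      using R by (simp add: real_root_mult real_root_power_cancel)
    also have "2 * (root ?n 2 * root ?n (\<alpha> j) * R) * C * \<kappa> ^ 4 * a j / (r j - r (Suc j))
       \<le> 2 * (2 * root ?n (\<alpha> j) * R) * C * (N * H) ^ 4 * a j / (r j - r (Suc j))"
      using rt2 \<alpha>0[of j] R C \<kappa> \<kappa>0 r(4)[of j]
      by (intro divide_right_mono mult_mono mult_left_mono mult_right_mono power_mono) (auto simp: a_def intro!: mult_nonneg_nonneg)
    also have "\<dots> = (2 * (2 * root ?n (\<alpha> j)) * C * N ^ 4 * a j * 2 ^ (j + 2)) * H ^ 4"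
      unfolding r(5) using R by (simp add: power_mult_distrib)
    also have "\<dots> = (2 * (2 * root ?n (\<alpha> j)) * C * N ^ 4 * a j * 2 ^ (j + 2) * 16 ^ Suc j) * h ^ 4"
    proof -
      have "((2::real) ^ Suc j) ^ 4 = (2 ^ 4) ^ Suc j" by (metis mult.commute power_mult)
      then have "H ^ 4 = 16 ^ Suc j * h ^ 4" by (simp only: h_def power_divide) simp
      then show ?thesis by simp
    qed
    finally have "a (Suc j) \<le> 2 * (2 * root ?n (\<alpha> j)) * C * N ^ 4 * a j * 2 ^ (j + 2) * 16 ^ Suc j"
      using h by simp
    \<comment> \<open>\<open>256 = 2 * 2 * 4 * 16\<close>: the translation argument, the bound for
      the root of \<open>2\<close>, the constant in the gap between radii, and the off-by-one in
      \<open>16 ^ Suc j\<close> from the level gap.\<close>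
    also have "\<dots> = D * (2 ^ j * 16 ^ j) * a j * root ?n (\<alpha> j)" by (simp add: D_def)
    also have "2 ^ j * 16 ^ j = (32::real) ^ j" by (simp add: power_mult_distrib[symmetric])
    finally show ?thesis using \<omega> by (simp add: \<alpha>_def field_simps)
  qed
  have lim: "\<alpha> \<longlonglongrightarrow> 0"
  proof (rule fast_geometric_convergence[where n="?n" and C=D and b=32])
    show "\<alpha> 0 \<le> 1 / (D ^ ?n * 32 ^ (?n * ?n))" using thr by (simp add: dg_threshold_def D_def C_def)
  qed (use D \<alpha>0 stp in auto)
  \<comment> \<open>The limit only shows that \<open>E\<close> is null. Being open by the continuity
    of \<open>u\<close>, it is empty, so the bound holds at every point; later it is evaluated at
    the single point \<open>\<xi>\<close>.\<close>
  define E where "E = {x \<in> ball \<xi> (R / 2). H < \<sigma> * (u x - k)}"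
  have bO: "ball \<xi> s \<subseteq> \<Omega>" if "s \<le> R" for s
  proof -
    have "ball \<xi> s \<subseteq> cball \<xi> (2 * R)" using that R by auto
    then show ?thesis using R by blast
  qed
  have Eo: "open E" unfolding E_def by (rule open_superlevel[OF bO]) (use R in simp)
  have "measure lborel E / \<omega> \<le> \<alpha> j" for j
    unfolding \<alpha>_def a_def
  proof (rule divide_right_mono[OF measure_mono_fmeasurable])
    show "E \<subseteq> S j" using r(3)[of j] t(2)[of j] by (auto simp: E_def S_def)
    show "E \<in> sets lborel" using Eo by simp
    have "open (S j)" unfolding S_def by (rule open_superlevel[OF bO[OF r(2)]])
    moreover have "bounded (S j)" by (rule bounded_subset[OF bounded_ball[of \<xi> "r j"]]) (auto simp: S_def)
    ultimately show "S j \<in> fmeasurable lborel"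
      using emeasure_bounded_finite[of "S j"] by (auto simp: fmeasurable_def)
  qed (use \<omega> in simp)
  then have "measure lborel E / \<omega> \<le> 0" by (intro LIMSEQ_le_const[OF lim]) auto
  then have "measure lborel E = 0" using \<omega> by (simp add: divide_le_0_iff measure_le_0_iff)
  moreover have "bounded E" by (rule bounded_subset[OF bounded_ball[of \<xi> "R / 2"]]) (auto simp: E_def)
  ultimately have "emeasure lborel E = 0" by (simp add: ennreal_lborel_finite_measure)
  then have "E \<in> null_sets lborel" using Eo by (simp add: null_sets_def)
  then have "negligible E" by (simp add: negligible_iff_null_sets null_sets_completionI)
  then have "E = {}" using Eo open_not_negligible by blast
  then have "\<not> (x \<in> ball \<xi> (R / 2) \<and> H < \<sigma> * (u x - k))" unfolding E_def by blast
  with x show ?thesis by (simp add: not_less)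
qed

end

section \<open>Decay at a zero and linear growth\<close>

text \<open>The \<open>16\<close> is \<open>(2 k)^4 / k^4\<close>, from truncating at twice the
  level, and \<open>4 ^ n\<close> is the volume ratio of the balls of radii \<open>4 R\<close> and
  \<open>R\<close>.\<close>

definition energy_const :: "real \<Rightarrow> real \<Rightarrow> nat \<Rightarrow> real" where
  "energy_const lam Lam n = 16 * 4 ^ n * (256 * Lam + 2) / lam"

text \<open>With \<open>B\<close> the energy constant, the choice
  \<open>\<tau> = c / (24 * 2^n * B)\<close> makes the energy term half of the lower bound for the
  product of measures. Solving for the measure of the strip leaves
  \<open>(c / (24 * 2^n))^2 / B\<close>.\<close>

definition gap_const :: "real \<Rightarrow> real \<Rightarrow> nat \<Rightarrow> real \<Rightarrow> real" where
  "gap_const lam Lam n c = (c / (24 * 2 ^ n))\<^sup>2 / energy_const lam Lam n"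

text \<open>The product of the measures is the double integral of
  \<open>indicator P x * indicator Q (x + z)\<close>. Only shifts shorter than \<open>2 * R\<close>
  contribute, as both sets lie in one ball, and each contributing pair forces \<open>W\<close> to
  jump by \<open>1\<close>.\<close>

lemma measure_prod_le_translations:
  fixes W :: "real^'n \<Rightarrow> real"
  assumes [measurable]: "W \<in> borel_measurable borel" "P \<in> sets borel" "Q \<in> sets borel"
    and sub: "P \<subseteq> ball \<xi> R" "Q \<subseteq> ball \<xi> R" and W: "\<And>x. x \<in> P \<Longrightarrow> W x = 1" "\<And>x. x \<in> Q \<Longrightarrow> W x = 0"
    and tr: "\<And>z. norm z < 2 * R \<Longrightarrow> (\<integral>\<^sup>+x\<in>ball \<xi> R. ennreal \<bar>W (x + z) - W x\<bar> \<partial>lborel) \<le> ennreal (2 * R) * G"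
  shows "emeasure lborel P * emeasure lborel Q \<le> emeasure lborel (ball (0::real^'n) (2 * R)) * (ennreal (2 * R) * G)"
proof -
  have "emeasure lborel P * emeasure lborel Q = (\<integral>\<^sup>+x. indicator P x * emeasure lborel Q \<partial>lborel)"
    by (subst nn_integral_multc) simp_all
  also have "\<dots> = (\<integral>\<^sup>+x. (\<integral>\<^sup>+z. indicator P x * indicator Q (x + z) \<partial>lborel) \<partial>lborel)"
  proof (rule nn_integral_cong)
    fix x
    have "emeasure lborel Q = (\<integral>\<^sup>+z. indicator Q (z + x) \<partial>lborel)"
      by (subst nn_integral_translate[of "indicator Q" x]) simp_all
    also have "indicator P x * \<dots> = (\<integral>\<^sup>+z. indicator P x * indicator Q (x + z) \<partial>lborel)"
      by (subst nn_integral_cmult) (simp_all add: add.commute)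
    finally show "indicator P x * emeasure lborel Q = (\<integral>\<^sup>+z. indicator P x * indicator Q (x + z) \<partial>lborel)" .
  qed
  also have "\<dots> = (\<integral>\<^sup>+z. (\<integral>\<^sup>+x. indicator P x * indicator Q (x + z) \<partial>lborel) \<partial>lborel)"
    by (rule lborel_pair.Fubini') measurable
  also have "\<dots> \<le> (\<integral>\<^sup>+z. (ennreal (2 * R) * G) * indicator (ball (0::real^'n) (2 * R)) z \<partial>lborel)"
  proof (rule nn_integral_mono)
    fix z :: "real^'n"
    show "(\<integral>\<^sup>+x. indicator P x * indicator Q (x + z) \<partial>lborel) \<le> (ennreal (2 * R) * G) * indicator (ball 0 (2 * R)) z"
    proof (cases "norm z < 2 * R")
      case True
      have "(\<integral>\<^sup>+x. indicator P x * indicator Q (x + z) \<partial>lborel) \<le> (\<integral>\<^sup>+x\<in>ball \<xi> R. ennreal \<bar>W (x + z) - W x\<bar> \<partial>lborel)"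
      proof (rule nn_integral_mono)
        fix x
        show "indicator P x * indicator Q (x + z) \<le> ennreal \<bar>W (x + z) - W x\<bar> * indicator (ball \<xi> R) x"
        proof (cases "x \<in> P \<and> x + z \<in> Q")
          case True
          then show ?thesis using W(1)[of x] W(2)[of "x + z"] sub by auto
        qed (auto simp: indicator_def)
      qed
      also note tr[OF True]
      finally show ?thesis using True by simp
    next
      case False
      have "indicator P x * indicator Q (x + z) = (0::ennreal)" for x
      proof (rule ccontr)
        assume "indicator P x * indicator Q (x + z) \<noteq> (0::ennreal)"
        then have "x \<in> ball \<xi> R" "x + z \<in> ball \<xi> R" using sub by (auto simp: indicator_def split: if_splits)
        then have "dist x (x + z) < R + R" using dist_triangle3[of x "x + z" \<xi>] by simp
        then show False using False by (simp add: dist_norm)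
      qed
      then have "(\<lambda>x. indicator P x * indicator Q (x + z)) = (\<lambda>x. 0::ennreal)" by (rule ext)
      then show ?thesis by (simp only: nn_integral_const mult_zero_left zero_le)
    qed
  qed
  also have "\<dots> = emeasure lborel (ball (0::real^'n) (2 * R)) * (ennreal (2 * R) * G)"
    by (subst nn_integral_cmult_indicator) (simp_all add: mult.commute)
  finally show ?thesis .
qed

context minimizer
begin

text \<open>Truncating at \<open>2 * k\<close> makes the weight \<open>(2 * k - u)^2\<close> at
  least \<open>k^2\<close> on \<open>{u \<le> k}\<close>, so the weighted inequality yields an
  unweighted energy. It is applied at radius \<open>4 * R\<close> with the bound
  \<open>2 * k\<close>, which rests on \<open>u \<ge> 0\<close>; its requirement
  \<open>4 * R \<le> 2 * k\<close> is the hypothesis on \<open>k\<close>.\<close>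

lemma gradient_energy_below_level:
  assumes R: "0 < R" "cball \<xi> (4 * R) \<subseteq> \<Omega>" and k: "2 * R \<le> k"
    and [measurable]: "D \<in> sets borel" and D: "D \<subseteq> cball \<xi> (3 * R)" "\<And>x. x \<in> D \<Longrightarrow> u x \<le> k"
  shows "(\<integral>\<^sup>+x\<in>D. ennreal ((norm (g x))\<^sup>2) \<partial>lborel)
    \<le> ennreal (energy_const lam Lam CARD('n) * (k\<^sup>2 / R\<^sup>2) * (unit_ball_vol (real CARD('n)) * R ^ CARD('n)))"
proof -
  let ?n = "CARD('n)"
  have k0: "0 < k" using R k by simp
  have L0: "0 \<le> Lam" using lam by linarith
  have b4: "ball \<xi> (4 * R) \<subseteq> \<Omega>" using R ball_subset_cball by blast
  obtain \<zeta> Z where \<zeta>: "C1_grad \<zeta> Z" "\<And>x. 0 \<le> \<zeta> x" "\<And>x. \<zeta> x \<le> 1" "\<And>x. dist \<xi> x \<le> 3 * R \<Longrightarrow> \<zeta> x = 1 \<and> Z x = 0"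
    "\<And>x. (3 * R + 4 * R) / 2 < dist \<xi> x \<Longrightarrow> \<zeta> x = 0 \<and> Z x = 0" "\<And>x. norm (Z x) \<le> 16 / (4 * R - 3 * R)"
    by (rule cutoff_exists[of "3 * R" "4 * R" \<xi>]) (use R in auto)
  define a where "a = measure lborel {x \<in> ball \<xi> (4 * R). 0 < (-1) * (u x - 2 * k)}"
  define J where "J = (\<integral>\<^sup>+x\<in>ball \<xi> (4 * R). ennreal ((\<zeta> x)\<^sup>2 * (max 0 ((-1) * (u x - 2 * k)))\<^sup>2 * (norm (g x))\<^sup>2) \<partial>lborel)"
  have J: "J \<le> ennreal ((256 * Lam + 2) * ((2 * k) ^ 4 / (4 * R - 3 * R)\<^sup>2) * a / lam)"
    unfolding J_def a_def
    by (rule caccioppoli_bound[where R="4 * R" and \<rho>="3 * R", OF _ R(2) _ _ _ _ _ _ \<zeta>(1-3,5,6)])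
       (use R k nonneg subsetD[OF b4] in auto)
  have aw: "a \<le> 4 ^ ?n * (unit_ball_vol (real ?n) * R ^ ?n)"
  proof -
    have "a \<le> measure lborel (ball \<xi> (4 * R))"
      unfolding a_def
    proof (rule measure_mono_fmeasurable)
      show "{x \<in> ball \<xi> (4 * R). 0 < (-1) * (u x - 2 * k)} \<in> sets lborel"
        using open_superlevel[OF b4, of 0 "-1" "2 * k"] by simp
      show "ball \<xi> (4 * R) \<in> fmeasurable lborel"
        using emeasure_bounded_finite[of "ball \<xi> (4 * R)"] by (auto simp: fmeasurable_def)
    qed auto
    also have "\<dots> = 4 ^ ?n * (unit_ball_vol (real ?n) * R ^ ?n)"
      using R by (simp add: content_ball power_mult_distrib)
    finally show ?thesis .
  qed
  have "ennreal (k\<^sup>2) * (\<integral>\<^sup>+x\<in>D. ennreal ((norm (g x))\<^sup>2) \<partial>lborel) \<le> J"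
  proof -
    have "ennreal (k\<^sup>2) * (\<integral>\<^sup>+x\<in>D. ennreal ((norm (g x))\<^sup>2) \<partial>lborel)
       = (\<integral>\<^sup>+x. ennreal (k\<^sup>2) * (ennreal ((norm (g x))\<^sup>2) * indicator D x) \<partial>lborel)"
      by (rule nn_integral_cmult[symmetric]) measurable
    also have "\<dots> \<le> J"
      unfolding J_def
    proof (rule nn_integral_mono)
      fix x
      show "ennreal (k\<^sup>2) * (ennreal ((norm (g x))\<^sup>2) * indicator D x)
        \<le> ennreal ((\<zeta> x)\<^sup>2 * (max 0 ((-1) * (u x - 2 * k)))\<^sup>2 * (norm (g x))\<^sup>2) * indicator (ball \<xi> (4 * R)) x"
      proof (cases "x \<in> D")
        case True
        then have x: "x \<in> ball \<xi> (4 * R)" "\<zeta> x = 1" using D(1) R \<zeta>(4)[of x] by force+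
        have "k\<^sup>2 \<le> (max 0 ((-1) * (u x - 2 * k)))\<^sup>2"
          using D(2)[OF True] k0 by (intro power_mono) auto
        then have "k\<^sup>2 * (norm (g x))\<^sup>2 \<le> (max 0 ((-1) * (u x - 2 * k)))\<^sup>2 * (norm (g x))\<^sup>2"
          by (rule mult_right_mono) simp
        then show ?thesis using x True by (simp add: ennreal_mult[symmetric] ennreal_leI)
      qed simp
    qed
    finally show ?thesis .
  qed
  then have "ennreal (k\<^sup>2) * (\<integral>\<^sup>+x\<in>D. ennreal ((norm (g x))\<^sup>2) \<partial>lborel)
      \<le> ennreal ((256 * Lam + 2) * ((2 * k) ^ 4 / (4 * R - 3 * R)\<^sup>2) * a / lam)"
    using J by (rule order_trans)
  from ennreal_mult_le_imp[OF _ _ this]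
  have "(\<integral>\<^sup>+x\<in>D. ennreal ((norm (g x))\<^sup>2) \<partial>lborel)
      \<le> ennreal ((256 * Lam + 2) * ((2 * k) ^ 4 / (4 * R - 3 * R)\<^sup>2) * a / lam / k\<^sup>2)"
    using k0 L0 lam by (simp add: a_def)
  also have "(256 * Lam + 2) * ((2 * k) ^ 4 / (4 * R - 3 * R)\<^sup>2) * a / lam / k\<^sup>2
     = 16 * (256 * Lam + 2) / lam * (k\<^sup>2 / R\<^sup>2) * a"
    using k0 R lam by (simp add: power_mult_distrib field_simps power4_eq_xxxx power2_eq_square)
  also have "\<dots> \<le> 16 * (256 * Lam + 2) / lam * (k\<^sup>2 / R\<^sup>2) * (4 ^ ?n * (unit_ball_vol (real ?n) * R ^ ?n))"
    using aw L0 lam by (intro mult_left_mono) auto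
  also have "\<dots> = energy_const lam Lam ?n * (k\<^sup>2 / R\<^sup>2) * (unit_ball_vol (real ?n) * R ^ ?n)"
    by (simp add: energy_const_def)
  finally show ?thesis by (simp add: ennreal_leI)
qed

text \<open>A truncation of \<open>u\<close> between the levels \<open>k / 4\<close> and \<open>k\<close> takes both values \<open>0\<close> and \<open>1\<close>
  on large sets, so the translation estimate bounds the \<open>L\<^sup>1\<close> norm of its gradient from below. That gradient
  lives on the strip \<open>{k / 4 < u < k}\<close> and is bounded in \<open>L\<^sup>2\<close> by the Caccioppoli inequality at level
  \<open>2 k\<close>, so the strip cannot be thin.\<close>

lemma gap_measure:
  assumes R: "0 < R" "cball \<xi> (4 * R) \<subseteq> \<Omega>" and k: "2 * R \<le> k" and q: "k \<le> q" and c: "0 < c"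
    and vol: "c * (unit_ball_vol (real CARD('n)) * R ^ CARD('n))\<^sup>2
      \<le> measure lborel {x \<in> ball \<xi> R. 0 < (-1) * (u x - k / 4)} * measure lborel {x \<in> ball \<xi> R. 0 < 1 * (u x - q)}"
  shows "gap_const lam Lam CARD('n) c * (unit_ball_vol (real CARD('n)) * R ^ CARD('n))
    \<le> measure lborel {x \<in> cball \<xi> (3 * R). k / 4 < u x \<and> u x < k}"
proof -
  let ?n = "CARD('n)"
  define \<omega> where "\<omega> = unit_ball_vol (real ?n) * R ^ ?n"
  have \<omega>: "0 < \<omega>" using R by (simp add: \<omega>_def)
  have k0: "0 < k" using R k by simp
  have L0: "0 \<le> Lam" using lam by linarith
  define B where "B = energy_const lam Lam ?n"
  have B: "0 < B" using lam L0 by (simp add: B_def energy_const_def add_nonneg_pos)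
  define K where "K = cball \<xi> (3 * R)"
  have "K \<subseteq> cball \<xi> (4 * R)" using R by (auto simp: K_def)
  then have K: "compact K" "K \<subseteq> \<Omega>" using R(2) by (auto simp: K_def)
  have [measurable]: "K \<in> sets borel" by (simp add: K_def)
  have bK: "ball \<xi> R \<subseteq> K" "ball \<xi> R \<subseteq> \<Omega>" using R K(2) by (auto simp: K_def subset_iff)
  define F where "F = (\<lambda>s. ramp ((s - k / 4) / (3 * k / 4)))"
  define F' where "F' = (\<lambda>s. ramp' ((s - k / 4) / (3 * k / 4)) * (4 / (3 * k)))"
  have F: "(F has_real_derivative F' s) (at s)" for s
  proof -
    have "((\<lambda>s. (s - k / 4) / (3 * k / 4)) has_real_derivative 4 / (3 * k)) (at s)"
      using k0 by (auto intro!: derivative_eq_intros)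
    from DERIV_chain2[OF ramp_deriv this] show ?thesis by (simp add: F_def F'_def)
  qed
  have F'c: "continuous_on UNIV F'"
    unfolding F'_def using k0 by (intro continuous_intros continuous_on_compose2[OF ramp'_cont]) auto
  have Fc: "continuous_on UNIV F" using F DERIV_continuous_on by blast
  have F'b: "\<bar>F' s\<bar> \<le> 6 / k" for s
  proof -
    have "\<bar>F' s\<bar> \<le> 4 * (4 / (3 * k))"
      unfolding F'_def abs_mult using k0 by (intro mult_mono ramp_values(7)) auto
    also have "\<dots> \<le> 6 / k" using k0 by (simp add: field_simps)
    finally show ?thesis .
  qed
  have F'0: "F' s = 0" if "s \<le> k / 4 \<or> k \<le> s" for s
  proof -
    have "(s - k / 4) / (3 * k / 4) \<le> 0 \<or> 1 \<le> (s - k / 4) / (3 * k / 4)"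
      using that k0 by (auto simp: field_simps divide_le_0_iff)
    then show ?thesis using ramp_values(3,4) by (auto simp: F'_def)
  qed
  have [measurable]: "F \<in> borel_measurable borel" "F' \<in> borel_measurable borel"
    using Fc F'c borel_measurable_continuous_onI by auto
  define u' where "u' = (\<lambda>x. indicator K x * u x)"
  have u'u: "u' x = u x" if "x \<in> K" for x using that by (simp add: u'_def)
  have [measurable]: "u' \<in> borel_measurable borel"
    unfolding u'_def by (rule u_restrict_borel[OF K])
  define W where "W = (\<lambda>x. F (u' x))"
  define gW where "gW = (\<lambda>x. F' (u' x) *\<^sub>R g x)"
  have [measurable]: "W \<in> borel_measurable borel" "gW \<in> borel_measurable borel"
    unfolding W_def gW_def by measurable
  have ap: "C1_approx K W gW"
    unfolding W_def gW_def u'_def by (rule C1_approx_compose_u[OF K F F'c])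
  define D where "D = {x \<in> K. k / 4 < u x \<and> u x < k}"
  have D': "D = K \<inter> {x. k / 4 < u' x \<and> u' x < k}" using u'u by (auto simp: D_def)
  have Dm[measurable]: "D \<in> sets borel" unfolding D' by measurable
  have Db: "bounded D" by (rule bounded_subset[OF bounded_cball[of \<xi> "3 * R"]]) (auto simp: D_def K_def)
  define \<delta> where "\<delta> = measure lborel D"
  have \<delta>: "emeasure lborel D = ennreal \<delta>" "0 \<le> \<delta>" using ennreal_lborel_finite_measure[OF Db] by (simp_all add: \<delta>_def)
  define \<tau> where "\<tau> = c / (24 * 2 ^ ?n * B)"
  have \<tau>: "0 < \<tau>" using c B by (simp add: \<tau>_def)
  \<comment> \<open>Scaled by \<open>k / R\<close>, the size of the gradient, so that
    \<open>\<tau>\<close> is dimensionless and the bound becomes \<open>6 / R\<close> times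
    \<open>\<delta> / \<tau> + \<tau> * B * \<omega>\<close>.\<close>
  define s where "s = k / (R * \<tau>)"
  have s: "0 < s" using k0 R \<tau> by (simp add: s_def)
  define \<Gamma> where "\<Gamma> = (\<integral>\<^sup>+x\<in>K. ennreal (norm (gW x)) \<partial>lborel)"
  have \<Gamma>: "\<Gamma> \<le> ennreal (6 / R * (\<delta> / \<tau> + \<tau> * B * \<omega>))"
  proof -
    have "\<Gamma> \<le> (\<integral>\<^sup>+x. ennreal (6 / k) * (ennreal \<bar>norm (g x)\<bar> * indicator D x) \<partial>lborel)"
      unfolding \<Gamma>_def
    proof (rule nn_integral_mono)
      fix x
      show "ennreal (norm (gW x)) * indicator K x \<le> ennreal (6 / k) * (ennreal \<bar>norm (g x)\<bar> * indicator D x)"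
      proof (cases "x \<in> K \<and> x \<notin> D")
        case True
        then have "gW x = 0" using F'0[of "u x"] u'u[of x] by (force simp: gW_def D_def)
        then show ?thesis by simp
      next
        case False
        have "norm (gW x) \<le> 6 / k * norm (g x)" unfolding gW_def norm_scaleR using F'b by (intro mult_right_mono) auto
        then have "ennreal (norm (gW x)) \<le> ennreal (6 / k) * ennreal (norm (g x))"
          using k0 by (simp add: ennreal_mult[symmetric] ennreal_leI)
        then show ?thesis using False by (auto simp: indicator_def D_def)
      qed
    qed
    also have "\<dots> = ennreal (6 / k) * (\<integral>\<^sup>+x\<in>D. ennreal \<bar>norm (g x)\<bar> \<partial>lborel)"
      by (rule nn_integral_cmult) measurable
    also have "\<dots> \<le> ennreal (6 / k) * (ennreal s * ennreal \<delta> + ennreal (1 / s) * ennreal (B * (k\<^sup>2 / R\<^sup>2) * \<omega>))"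
    proof (rule mult_left_mono)
      have "(\<integral>\<^sup>+x\<in>D. ennreal \<bar>norm (g x)\<bar> \<partial>lborel)
        \<le> ennreal s * emeasure lborel D + ennreal (1 / s) * (\<integral>\<^sup>+x\<in>D. ennreal ((norm (g x))\<^sup>2) \<partial>lborel)"
        by (rule nn_integral_abs_le_square) (use s in auto)
      also have "\<dots> \<le> ennreal s * ennreal \<delta> + ennreal (1 / s) * ennreal (B * (k\<^sup>2 / R\<^sup>2) * \<omega>)"
        unfolding \<delta>(1) B_def \<omega>_def
        by (intro add_mono mult_left_mono gradient_energy_below_level[OF R k Dm]) (auto simp: D_def K_def)
      finally show "(\<integral>\<^sup>+x\<in>D. ennreal \<bar>norm (g x)\<bar> \<partial>lborel)
        \<le> ennreal s * ennreal \<delta> + ennreal (1 / s) * ennreal (B * (k\<^sup>2 / R\<^sup>2) * \<omega>)" .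
    qed simp
    also have "ennreal s * ennreal \<delta> + ennreal (1 / s) * ennreal (B * (k\<^sup>2 / R\<^sup>2) * \<omega>)
       = ennreal (s * \<delta> + 1 / s * (B * (k\<^sup>2 / R\<^sup>2) * \<omega>))"
      by (rule ennreal_lin_comb) (use s \<delta> B \<omega> in auto)
    also have "ennreal (6 / k) * \<dots> = ennreal (6 / k * (s * \<delta> + 1 / s * (B * (k\<^sup>2 / R\<^sup>2) * \<omega>)))"
      by (rule ennreal_mult[symmetric]) (use k0 s \<delta> B \<omega> in auto)
    also have "6 / k * (s * \<delta> + 1 / s * (B * (k\<^sup>2 / R\<^sup>2) * \<omega>)) = 6 / R * (\<delta> / \<tau> + \<tau> * B * \<omega>)"
      using k0 R \<tau> by (simp add: s_def field_simps power2_eq_square)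
    finally show ?thesis .
  qed
  define P where "P = {x \<in> ball \<xi> R. 0 < (-1) * (u x - k / 4)}"
  define Q where "Q = {x \<in> ball \<xi> R. 0 < 1 * (u x - q)}"
  have [measurable]: "P \<in> sets borel" "Q \<in> sets borel"
    using open_superlevel[OF bK(2), of 0 "-1" "k / 4"] open_superlevel[OF bK(2), of 0 1 q] by (auto simp: P_def Q_def)
  have PQ: "P \<subseteq> ball \<xi> R" "Q \<subseteq> ball \<xi> R" by (auto simp: P_def Q_def)
  have mPQ: "emeasure lborel P = ennreal (measure lborel P)" "emeasure lborel Q = ennreal (measure lborel Q)"
    by (rule ennreal_lborel_finite_measure, rule bounded_subset[OF bounded_ball[of \<xi> R]], use PQ in blast)+
  have "emeasure lborel P * emeasure lborel Q \<le> emeasure lborel (ball (0::real^'n) (2 * R)) * (ennreal (2 * R) * \<Gamma>)"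
  proof (rule measure_prod_le_translations[OF _ _ _ PQ, where W=W])
    show "W x = 1" if "x \<in> P" for x
    proof -
      have "x \<in> K" "u x < k / 4" using that bK by (auto simp: P_def)
      then show ?thesis using k0 unfolding W_def F_def by (simp add: u'u) (rule ramp_values(1), simp add: divide_le_0_iff)
    qed
    show "W x = 0" if "x \<in> Q" for x
    proof -
      have "x \<in> K" "k \<le> u x" using that bK q by (auto simp: Q_def)
      then show ?thesis using k0 unfolding W_def F_def by (simp add: u'u) (rule ramp_values(2), simp add: field_simps)
    qed
    fix z :: "real^'n" assume z: "norm z < 2 * R"
    have "(\<integral>\<^sup>+x\<in>ball \<xi> R. ennreal \<bar>W (x + z) - W x\<bar> \<partial>lborel) \<le> ennreal (norm z) * \<Gamma>"
      unfolding \<Gamma>_def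
    proof (rule C1_approx_translation[OF ap K(1)])
      fix x and s :: real assume x: "x \<in> ball \<xi> R" and s: "0 \<le> s" "s \<le> 1"
      have "dist \<xi> (x + s *\<^sub>R z) \<le> dist \<xi> x + dist x (x + s *\<^sub>R z)" by (rule dist_triangle)
      also have "dist x (x + s *\<^sub>R z) = s * norm z" using s by (simp add: dist_norm)
      also have "\<dots> \<le> 1 * (2 * R)" using s z by (intro mult_mono) auto
      finally show "x + s *\<^sub>R z \<in> K" using x by (simp add: K_def)
    qed measurable
    also have "\<dots> \<le> ennreal (2 * R) * \<Gamma>" using z by (intro mult_right_mono ennreal_leI) auto
    finally show "(\<integral>\<^sup>+x\<in>ball \<xi> R. ennreal \<bar>W (x + z) - W x\<bar> \<partial>lborel) \<le> ennreal (2 * R) * \<Gamma>" .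
  qed measurable
  also have "\<dots> \<le> ennreal (2 ^ ?n * \<omega>) * (ennreal (2 * R) * ennreal (6 / R * (\<delta> / \<tau> + \<tau> * B * \<omega>)))"
    using R by (intro mult_mono \<Gamma>) (simp_all add: emeasure_ball \<omega>_def power_mult_distrib mult_ac)
  also have "\<dots> = ennreal (2 ^ ?n * \<omega> * (2 * R * (6 / R * (\<delta> / \<tau> + \<tau> * B * \<omega>))))"
    using R \<omega> \<delta> \<tau> B by (simp only: ennreal_mult[symmetric] mult_nonneg_nonneg add_nonneg_nonneg
        divide_nonneg_pos less_imp_le zero_le_power zero_le_numeral)
  also have "2 ^ ?n * \<omega> * (2 * R * (6 / R * (\<delta> / \<tau> + \<tau> * B * \<omega>))) = 12 * 2 ^ ?n * \<omega> * (\<delta> / \<tau>) + c / 2 * \<omega>\<^sup>2"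
    using R B by (simp add: \<tau>_def field_simps power2_eq_square)
  finally have "ennreal (measure lborel P * measure lborel Q) \<le> ennreal (12 * 2 ^ ?n * \<omega> * (\<delta> / \<tau>) + c / 2 * \<omega>\<^sup>2)"
    unfolding mPQ by (simp only: ennreal_mult measure_nonneg)
  then have "measure lborel P * measure lborel Q \<le> 12 * 2 ^ ?n * \<omega> * (\<delta> / \<tau>) + c / 2 * \<omega>\<^sup>2"
    by (rule ennreal_le_iff[THEN iffD1, rotated]) (use \<omega> \<delta> \<tau> c in auto)
  then have "c * \<omega>\<^sup>2 \<le> 12 * 2 ^ ?n * \<omega> * (\<delta> / \<tau>) + c / 2 * \<omega>\<^sup>2"
    using vol by (simp add: P_def Q_def \<omega>_def)
  then have "c / 2 * \<omega>\<^sup>2 \<le> 12 * 2 ^ ?n * \<omega> * (\<delta> / \<tau>)" by linarith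
  then have "\<omega> * (c / 2 * \<omega>) \<le> \<omega> * (12 * 2 ^ ?n * (\<delta> / \<tau>))"
    by (simp only: power2_eq_square mult_ac)
  then have "c / 2 * \<omega> \<le> 12 * 2 ^ ?n * (\<delta> / \<tau>)" using \<omega> by (rule mult_left_le_imp_le)
  then have "c * \<omega> * \<tau> / (24 * 2 ^ ?n) \<le> \<delta>" using \<tau> by (simp add: field_simps)
  also have "c * \<omega> * \<tau> / (24 * 2 ^ ?n) = gap_const lam Lam ?n c * \<omega>"
    by (simp add: gap_const_def \<tau>_def B_def power2_eq_square mult_ac)
  finally show ?thesis by (simp add: \<omega>_def \<delta>_def D_def K_def)
qed

text \<open>If \<open>u\<close> is large on a substantial part of the ball, then each of the \<open>J\<close>
  disjoint strips \<open>{k (i + 1) < u < k i}\<close> takes a fixed fraction of the volume, because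
  \<open>u \<xi> = 0\<close> excludes, by the De Giorgi lemma from below, that \<open>{u < k i}\<close> is small.
  The lower bound on \<open>S\<close> keeps all levels above the radius, so that the measure term of the
  functional remains a lower order perturbation.\<close>

lemma flatness:
  assumes R: "0 < R" "cball \<xi> (4 * R) \<subseteq> \<Omega>" and zero: "u \<xi> = 0"
    and bd: "\<And>x. x \<in> ball \<xi> (4 * R) \<Longrightarrow> u x \<le> 4 * S * R"
    and c: "c = dg_threshold lam Lam 16 CARD('n) * dg_threshold lam Lam 2 CARD('n)" "0 < c"
    and S: "8 * 4 ^ J \<le> S" and J: "3 ^ CARD('n) < real J * gap_const lam Lam CARD('n) c"
    and x: "x \<in> ball \<xi> (R / 2)"
  shows "u x \<le> S * R / 2"
proof (cases "measure lborel {x \<in> ball \<xi> R. 0 < 1 * (u x - S * R / 4)}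
      \<le> dg_threshold lam Lam 16 CARD('n) * (unit_ball_vol (real CARD('n)) * R ^ CARD('n))")
  case True
  have "1 \<le> (4::real) ^ J" by simp
  then have S1: "1 \<le> S" using S by linarith
  have c2: "cball \<xi> (2 * R) \<subseteq> \<Omega>" using R subset_cball[of "2 * R" "4 * R" \<xi>] by auto
  \<comment> \<open>Here \<open>\<kappa> = 4 * S * R\<close> and \<open>H = S * R / 4\<close>,
    whence the ratio \<open>16\<close> in the threshold. The factor \<open>1\<close> is the value of
    \<open>\<sigma>\<close>.\<close>
  have "1 * (u x - S * R / 4) \<le> S * R / 4"
  proof (rule de_giorgi[OF R(1) c2 _ _ _ _ _ True x])
    show "R \<le> 4 * S * R" using R S1 mult_mono[of 1 "4 * S" R R] by simp
    show "1 * (u y - S * R / 4) \<le> 4 * S * R" if "y \<in> ball \<xi> R" for y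
    proof -
      have "u y \<le> 4 * S * R" using bd[of y] that R by auto
      moreover have "0 \<le> S * R / 4" using R S1 by simp
      ultimately show ?thesis by simp
    qed
  qed (use R S1 in auto)
  then have "u x \<le> S * R / 4 + S * R / 4" by simp
  also have "\<dots> = S * R / 2" by simp
  finally show ?thesis .
next
  case False
  let ?n = "CARD('n)"
  define \<omega> where "\<omega> = unit_ball_vol (real ?n) * R ^ ?n"
  have \<omega>: "0 < \<omega>" using R by (simp add: \<omega>_def)
  have c2: "cball \<xi> (2 * R) \<subseteq> \<Omega>" using R subset_cball[of "2 * R" "4 * R" \<xi>] by auto
  have b1: "ball \<xi> R \<subseteq> \<Omega>" using R c2 by (auto simp: subset_iff)
  \<comment> \<open>The ratio \<open>4\<close> fits the truncation between \<open>k / 4\<close> and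
    \<open>k\<close>. After \<open>J\<close> steps down from \<open>S * R / 4\<close> the level is
    still at least \<open>2 * R\<close>, because \<open>S \<ge> 8 * 4 ^ J\<close>.\<close>
  define k where "k = (\<lambda>i::nat. S * R / 4 / 4 ^ i)"
  have kS: "k (Suc i) = k i / 4" for i by (simp add: k_def)
  have S0: "0 < S" using S by (rule less_le_trans[rotated]) simp
  have k0: "0 < k i" for i using S0 R by (simp add: k_def)
  have kR: "2 * R \<le> k i" if "i \<le> J" for i
  proof -
    have "(4::real) ^ i \<le> 4 ^ J" using that by (intro power_increasing) auto
    then have "8 * 4 ^ i \<le> S" using S by linarith
    then have "8 * 4 ^ i * R \<le> S * R" using R by (intro mult_right_mono) auto
    then show ?thesis by (simp add: k_def field_simps)
  qed
  have kle: "k i \<le> k j" if "j \<le> i" for i j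
    unfolding k_def using S0 R that by (intro divide_left_mono power_increasing) auto
  have low: "dg_threshold lam Lam 2 ?n * \<omega> < measure lborel {x \<in> ball \<xi> R. 0 < (-1) * (u x - k i)}" if i: "i \<le> J" for i
  proof (rule ccontr)
    assume "\<not> ?thesis"
    then have sm: "measure lborel {x \<in> ball \<xi> R. 0 < (-1) * (u x - k i)} \<le> dg_threshold lam Lam 2 ?n * (unit_ball_vol (real ?n) * R ^ ?n)"
      by (simp add: \<omega>_def)
    \<comment> \<open>With \<open>\<kappa> = k i\<close> and \<open>H = k i / 2\<close> the ratio is
      \<open>2\<close>. The bound would give \<open>u \<xi> \<ge> k i / 2 > 0\<close> at the
      centre.\<close>
    have "(-1) * (u \<xi> - k i) \<le> k i / 2"
    proof (rule de_giorgi[OF R(1) c2 _ _ _ _ _ sm])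
      show "R \<le> k i" using kR[OF i] R by simp
      show "(-1) * (u y - k i) \<le> k i" if "y \<in> ball \<xi> R" for y
        using nonneg[of y] that b1 by auto
    qed (use R k0 in auto)
    then show False using zero k0[of i] by simp
  qed
  define D where "D = (\<lambda>i. {x \<in> cball \<xi> (3 * R). k (Suc i) < u x \<and> u x < k i})"
  \<comment> \<open>The sublevel set is taken at \<open>k (Suc i)\<close>, whence the condition
    \<open>i < J\<close>. The upper set is \<open>{u > S * R / 4}\<close> for every
    \<open>i\<close>, as \<open>k i \<le> k 0\<close>.\<close>
  have gap: "gap_const lam Lam ?n c * \<omega> \<le> measure lborel (D i)" if i: "i < J" for i
  proof -
    have "c * (unit_ball_vol (real ?n) * R ^ ?n)\<^sup>2
       \<le> measure lborel {x \<in> ball \<xi> R. 0 < (-1) * (u x - k i / 4)} * measure lborel {x \<in> ball \<xi> R. 0 < 1 * (u x - S * R / 4)}"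
    proof -
      have d2: "0 \<le> dg_threshold lam Lam 2 ?n * \<omega>" "0 \<le> dg_threshold lam Lam 16 ?n * \<omega>"
        using \<omega> lam by (simp_all add: dg_threshold_def dg_const_def)
      have "c * \<omega>\<^sup>2 = (dg_threshold lam Lam 2 ?n * \<omega>) * (dg_threshold lam Lam 16 ?n * \<omega>)"
        by (simp add: c(1) power2_eq_square)
      also have "\<dots> \<le> measure lborel {x \<in> ball \<xi> R. 0 < (-1) * (u x - k (Suc i))} * measure lborel {x \<in> ball \<xi> R. 0 < 1 * (u x - S * R / 4)}"
        using low[of "Suc i"] i False d2 by (intro mult_mono) (auto simp: \<omega>_def)
      finally show ?thesis by (simp add: \<omega>_def kS)
    qed
    then show ?thesis
      using gap_measure[OF R kR[of i] _ c(2), of "S * R / 4"] i kle[of 0 i] by (simp add: D_def kS \<omega>_def k_def)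
  qed
  have cK: "cball \<xi> (3 * R) \<subseteq> \<Omega>" using R subset_cball[of "3 * R" "4 * R" \<xi>] by auto
  have Dm: "D i \<in> sets borel" for i
  proof -
    have [measurable]: "(\<lambda>x. indicator (cball \<xi> (3 * R)) x * u x) \<in> borel_measurable borel"
      by (rule u_restrict_borel[OF compact_cball cK])
    have "D i = cball \<xi> (3 * R) \<inter> {x. k (Suc i) < indicator (cball \<xi> (3 * R)) x * u x \<and> indicator (cball \<xi> (3 * R)) x * u x < k i}"
      by (auto simp: D_def indicator_def split: if_splits)
    also have "\<dots> \<in> sets borel" by measurable
    finally show ?thesis .
  qed
  have disj: "disjoint_family_on D {..<J}"
    unfolding disjoint_family_on_def
  proof (intro ballI impI)
    fix i j :: nat assume "i \<noteq> j"
    then consider "Suc i \<le> j" | "Suc j \<le> i" by linarith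
    then show "D i \<inter> D j = {}"
      by cases (use kle in \<open>fastforce simp: D_def\<close>)+
  qed
  have mD: "emeasure lborel (D i) = ennreal (measure lborel (D i))" for i
    by (rule ennreal_lborel_finite_measure[OF bounded_subset[OF bounded_cball[of \<xi> "3 * R"]]]) (auto simp: D_def)
  have "ennreal (\<Sum>i<J. measure lborel (D i)) = (\<Sum>i<J. emeasure lborel (D i))"
    unfolding mD by (rule sum_ennreal[symmetric]) simp
  also have "\<dots> = emeasure lborel (\<Union>i<J. D i)"
    by (rule sum_emeasure) (use Dm disj in auto)
  also have "\<dots> \<le> emeasure lborel (cball \<xi> (3 * R))"
    by (rule emeasure_mono) (auto simp: D_def)
  also have "\<dots> = ennreal (3 ^ ?n * \<omega>)"
    using R by (simp add: emeasure_cball \<omega>_def power_mult_distrib mult_ac)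
  finally have "(\<Sum>i<J. measure lborel (D i)) \<le> 3 ^ ?n * \<omega>"
    using \<omega> by (subst (asm) ennreal_le_iff) auto
  moreover have "(\<Sum>i<J. gap_const lam Lam ?n c * \<omega>) \<le> (\<Sum>i<J. measure lborel (D i))"
    by (rule sum_mono) (use gap in auto)
  ultimately have "real J * gap_const lam Lam ?n c * \<omega> \<le> 3 ^ ?n * \<omega>" by simp
  then have "real J * gap_const lam Lam ?n c \<le> 3 ^ ?n" using \<omega> by simp
  with J show ?thesis by simp
qed

text \<open>The bound \<open>S * R / 2\<close> on radius \<open>R / 2\<close> equals
  \<open>4 * S * (R / 8)\<close> on radius \<open>4 * (R / 8)\<close>, which is the hypothesis for
  \<open>R / 8\<close> with the same \<open>S\<close>. Hence nothing is lost along the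
  scales.\<close>

lemma linear_growth:
  assumes R: "0 < R" "cball \<xi> (4 * R) \<subseteq> \<Omega>" and zero: "u \<xi> = 0"
    and bd: "\<And>x. x \<in> ball \<xi> (4 * R) \<Longrightarrow> u x \<le> 4 * S * R"
    and c: "c = dg_threshold lam Lam 16 CARD('n) * dg_threshold lam Lam 2 CARD('n)" "0 < c"
    and S: "8 * 4 ^ J \<le> S" and J: "3 ^ CARD('n) < real J * gap_const lam Lam CARD('n) c"
    and x: "x \<in> ball \<xi> (4 * R)"
  shows "u x \<le> 8 * S * dist x \<xi>"
proof -
  have S0: "0 < S" using S by (rule less_le_trans[rotated]) simp
  have scale: "\<forall>x\<in>ball \<xi> (4 * (R / 8 ^ j)). u x \<le> 4 * S * (R / 8 ^ j)" for j :: nat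
  proof (induction j)
    case 0
    then show ?case using bd by simp
  next
    case (Suc j)
    have le: "R / 8 ^ j \<le> R" using R by (simp add: divide_le_eq)
    have sub: "cball \<xi> (4 * (R / 8 ^ j)) \<subseteq> \<Omega>"
      using R(2) subset_cball[of "4 * (R / 8 ^ j)" "4 * R" \<xi>] le by auto
    show ?case
    proof
      fix x assume "x \<in> ball \<xi> (4 * (R / 8 ^ Suc j))"
      then have x: "x \<in> ball \<xi> ((R / 8 ^ j) / 2)" by simp
      have "u x \<le> S * (R / 8 ^ j) / 2"
        by (rule flatness[OF _ sub zero _ c S J x]) (use Suc R in auto)
      also have "\<dots> = 4 * S * (R / 8 ^ Suc j)" by (simp add: mult_ac)
      finally show "u x \<le> 4 * S * (R / 8 ^ Suc j)" .
    qed
  qed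
  show ?thesis
  proof (cases "x = \<xi>")
    case False
    define \<rho> where "\<rho> = dist \<xi> x"
    have \<rho>: "0 < \<rho>" "\<rho> < 4 * R" using False x by (auto simp: \<rho>_def)
    have "\<exists>j. 4 * (R / 8 ^ j) \<le> \<rho>"
    proof -
      have "(\<lambda>j. 4 * R * (1 / 8) ^ j) \<longlonglongrightarrow> 4 * R * 0"
        by (intro tendsto_mult tendsto_const LIMSEQ_power_zero) auto
      then have "\<forall>\<^sub>F j in sequentially. 4 * R * (1 / 8) ^ j < \<rho>"
        using \<rho>(1) by (intro order_tendstoD) auto
      then obtain j where "4 * R * (1 / 8) ^ j < \<rho>" using eventually_happens'[OF sequentially_bot] by blast
      then show ?thesis by (intro exI[of _ j]) (simp add: power_divide)
    qed
    \<comment> \<open>The first scale whose ball no longer contains \<open>x\<close>. The bound is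
      available one scale earlier, and this costs a factor \<open>8\<close>.\<close>
    define j where "j = (LEAST j. 4 * (R / 8 ^ j) \<le> \<rho>)"
    have j: "4 * (R / 8 ^ j) \<le> \<rho>" unfolding j_def by (rule LeastI_ex) fact
    have "j \<noteq> 0" using j \<rho> by (intro notI) simp
    then obtain i where i: "j = Suc i" by (cases j) auto
    have "\<not> 4 * (R / 8 ^ i) \<le> \<rho>" using not_less_Least[of i "\<lambda>j. 4 * (R / 8 ^ j) \<le> \<rho>"] i j_def by simp
    then have "x \<in> ball \<xi> (4 * (R / 8 ^ i))" by (simp add: \<rho>_def)
    then have "u x \<le> 4 * S * (R / 8 ^ i)" using scale by blast
    also have "\<dots> = 8 * S * (4 * (R / 8 ^ j))" by (simp add: i)
    also have "\<dots> \<le> 8 * S * \<rho>" using j S0 by (intro mult_left_mono) auto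
    finally show ?thesis by (simp add: \<rho>_def dist_commute)
  qed (use zero in simp)
qed

end

section \<open>From the ball around the zero to the whole domain\<close>

lemma dist_frontier:
  fixes \<xi> :: "'a::euclidean_space"
  assumes "open \<Omega>" "bounded \<Omega>" "\<xi> \<in> \<Omega>"
  shows "0 < infdist \<xi> (frontier \<Omega>)" "ball \<xi> (infdist \<xi> (frontier \<Omega>)) \<subseteq> \<Omega>"
proof -
  \<comment> \<open>The distance to an empty set is \<open>0\<close> by convention, so positivity
    needs this. A nonempty bounded open set is not the whole space, hence has a frontier.\<close>
  have ne: "frontier \<Omega> \<noteq> {}"
    using assms frontier_eq_empty[of \<Omega>] not_bounded_UNIV by auto
  have "\<xi> \<notin> frontier \<Omega>" using assms frontier_disjoint_eq[of \<Omega>] by blast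
  then show pos: "0 < infdist \<xi> (frontier \<Omega>)"
    using ne by (simp add: infdist_pos_not_in_closed)
  show "ball \<xi> (infdist \<xi> (frontier \<Omega>)) \<subseteq> \<Omega>"
  proof (rule ccontr)
    let ?B = "ball \<xi> (infdist \<xi> (frontier \<Omega>))"
    assume "\<not> ?B \<subseteq> \<Omega>"
    moreover have "\<xi> \<in> ?B \<inter> \<Omega>" using assms(3) pos by simp
    ultimately have "?B \<inter> frontier \<Omega> \<noteq> {}"
      by (intro connected_Int_frontier connected_ball) blast+
    then obtain y where "y \<in> ?B" "y \<in> frontier \<Omega>" by blast
    then show False using infdist_le[of y "frontier \<Omega>" \<xi>] by simp
  qed
qed

theorem mainTheorem8:
  fixes lam Lam d M :: real
  assumes "0 < lam" and "lam \<le> Lam"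
  shows "\<exists>C>0. \<forall>(\<Omega> :: (real^'n::finite) set) A u0 \<xi>.
           lipschitz_domain \<Omega> \<and> elliptic_coeffs lam Lam \<Omega> A \<and>
           local_min A \<Omega> u0 \<and> continuous_on \<Omega> u0 \<and> (\<forall>X\<in>\<Omega>. 0 \<le> u0 X) \<and>
           bounded (u0 ` \<Omega>) \<and> (SUP X\<in>\<Omega>. \<bar>u0 X\<bar>) = M \<and>
           \<xi> \<in> \<Omega> \<and> u0 \<xi> = 0 \<and> infdist \<xi> (frontier \<Omega>) = d
           \<longrightarrow> (\<forall>X\<in>\<Omega>. u0 X \<le> C * dist X \<xi>)"
proof -
  let ?n = "CARD('n)"
  define c where "c = dg_threshold lam Lam 16 ?n * dg_threshold lam Lam 2 ?n"
  have "0 < Lam" using assms by linarith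
  then have c: "0 < c" "0 < gap_const lam Lam ?n c"
  proof -
    have "0 < dg_const lam Lam" using assms \<open>0 < Lam\<close> by (simp add: dg_const_def add_pos_pos)
    then show "0 < c" by (simp add: c_def dg_threshold_def)
    then show "0 < gap_const lam Lam ?n c"
      using assms \<open>0 < Lam\<close> by (simp add: gap_const_def energy_const_def)
  qed
  obtain J :: nat where J: "3 ^ ?n < real J * gap_const lam Lam ?n c"
    using ex_less_of_nat_mult[OF c(2)] by blast
  \<comment> \<open>Any fraction below \<open>1/4\<close> lets the closed ball of radius
    \<open>4 * R\<close> fit into the open ball of radius \<open>d\<close>.\<close>
  define R where "R = d / 5"
  \<comment> \<open>The first entry keeps all \<open>J\<close> levels above the radius, the second
    starts the iteration from \<open>M \<le> 4 * S * R\<close>. The first also keeps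
    \<open>S\<close> positive for values of \<open>d\<close> and \<open>M\<close> that no domain
    realises.\<close>
  define S where "S = max (8 * 4 ^ J) (M / (4 * R))"
  have S: "8 * 4 ^ J \<le> S" by (simp add: S_def)
  then have S0: "0 < S" by (rule less_le_trans[rotated]) simp
  show ?thesis
  proof (intro exI[of _ "8 * S"] conjI allI impI ballI)
    show "0 < 8 * S" using S0 by simp
    fix \<Omega> :: "(real^'n) set" and A u0 \<xi> X
    assume h: "lipschitz_domain \<Omega> \<and> elliptic_coeffs lam Lam \<Omega> A \<and>
           local_min A \<Omega> u0 \<and> continuous_on \<Omega> u0 \<and> (\<forall>X\<in>\<Omega>. 0 \<le> u0 X) \<and>
           bounded (u0 ` \<Omega>) \<and> (SUP X\<in>\<Omega>. \<bar>u0 X\<bar>) = M \<and>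
           \<xi> \<in> \<Omega> \<and> u0 \<xi> = 0 \<and> infdist \<xi> (frontier \<Omega>) = d"
    assume X: "X \<in> \<Omega>"
    have \<Omega>: "open \<Omega>" "bounded \<Omega>" using h by (auto simp: lipschitz_domain_def)
    have d: "0 < d" "ball \<xi> d \<subseteq> \<Omega>" using dist_frontier[OF \<Omega>] h by auto
    have R: "0 < R" using d by (simp add: R_def)
    have "cball \<xi> (4 * R) \<subseteq> ball \<xi> d" using d(1) by (auto simp: R_def)
    then have sub: "cball \<xi> (4 * R) \<subseteq> \<Omega>" using d(2) by blast
    have "bounded (u0 ` \<Omega>)" using h by simp
    then obtain b where "\<forall>y\<in>u0 ` \<Omega>. norm y \<le> b" unfolding bounded_iff by blast
    then have bdd: "bdd_above ((\<lambda>x. \<bar>u0 x\<bar>) ` \<Omega>)" by (intro bdd_aboveI2[of _ _ b]) auto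
    have M: "u0 x \<le> M" if "x \<in> \<Omega>" for x
      using cSUP_upper[OF that bdd] h by (auto simp: abs_le_iff)
    have MS: "M \<le> 4 * S * R"
    proof -
      have "M / (4 * R) \<le> S" by (simp add: S_def)
      then show ?thesis using R by (simp add: divide_le_eq mult_ac)
    qed
    obtain gu where "has_weak_gradient \<Omega> u0 gu" "L2vec_on \<Omega> gu"
      using h by (auto simp: local_min_def H1_on_def)
    then obtain g where g: "has_weak_gradient \<Omega> u0 g" "g \<in> borel_measurable borel"
      "(\<integral>\<^sup>+x\<in>\<Omega>. ennreal ((norm (g x))\<^sup>2) \<partial>lborel) < \<infinity>"
      using borel_weak_gradient[OF _ \<Omega>(1)] by blast
    interpret minimizer \<Omega> A u0 g lam Lam
      by unfold_locales (use assms h g \<Omega> in auto)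
    show "u0 X \<le> 8 * S * dist X \<xi>"
    proof (cases "X \<in> ball \<xi> (4 * R)")
      case True
      show ?thesis
      proof (rule linear_growth[OF R sub _ _ c_def c(1) S J True])
        show "u0 x \<le> 4 * S * R" if "x \<in> ball \<xi> (4 * R)" for x
        proof -
          have "x \<in> cball \<xi> (4 * R)" using that by simp
          then have "x \<in> \<Omega>" using sub by blast
          then show ?thesis using M[of x] MS by linarith
        qed
      qed (use h in simp)
    next
      \<comment> \<open>Away from the zero the supremum bound suffices:
        \<open>M \<le> 4 * S * R \<le> S * dist X \<xi>\<close>.\<close>
      case False
      then have "4 * R \<le> dist X \<xi>" by (simp add: dist_commute)
      then have "S * (4 * R) \<le> S * dist X \<xi>" using S0 by (intro mult_left_mono) auto
      moreover have "0 \<le> S * dist X \<xi>" using S0 by simp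
      ultimately show ?thesis using M[OF X] MS by simp
    qed
  qed
qed

end
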